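(* Let $C$ be an ordered field. The complete $\mathcal{L}_{\mathrm{Ham}}$-theory $T_{\mathrm{Ham}}$ of independent dense Hamel spaces over $C$ is distal.
   Context: Let $C$ be an ordered field. A $2$-ordered $C$-vector space is a $C$-vector space $G$ with two total orderings $<_0,<_1$ such that $G$ is an ordered $C$-vector space with respect to each of them (i.e., each $<_i$ is translation invariant and $\lambda>0,\ x>_i0\Rightarrow \lambda x>_i 0$). Put $G_\infty=G\cup\{\infty\}$, with $G<_0\infty$ and $G<_1\infty$. A Hamel valuation on $G$ is a map $v:G\to G_\infty$ such that for all $x,y\in G$ and $\lambda\in C^{\times}$: $v(x)=\infty$ iff $x=0$; $v(x+y)\ge_0\min_0(v(x),v(y))$; $v(\lambda x)=v(x)$; if $0<_1x<_1y$ then $v(x)\ge_0 v(y)$; $v(v(x))=v(x)$ (with $v(\infty)=\infty$); and $v(x)>_1 0$. A Hamel space over $C$ is such a pair $(G,v)$. It is independent if for all $a_0,b_0,a_1,b_1\in G\cup\{\pm\infty\}$ with $a_0<_0b_0$ and $a_1<_1b_1$ there is $z\in G$ with $a_0<_0z<_0b_0$ and $a_1<_1z<_1b_1$; it is dense if for all $a<_0b$ in $G$ there is $c\in G$ with $a<_0v(c)<_0b$. The language is $\mathcal{L}_{\mathrm{Ham}}=\{0,+,(\lambda_c)_{c\in C},<_0,<_1,v,\infty\}$, a Hamel space being viewed as a structure with universe $G_\infty$, where $\lambda_c$ is scalar multiplication by $c$, and $g+\infty=\infty+g=\infty+\infty=\lambda_c(\infty)=v(\infty)=\infty$. $T_{\mathrm{Ham}}$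 is the $\mathcal{L}_{\mathrm{Ham}}$-theory whose models are exactly the independent dense Hamel spaces over $C$. A complete theory $T$ is distal if, in a monster model, for every parameter set $A$ and every indiscernible sequence $(a_i)_{i\in I}$ with $I=I_1+(c)+I_2$, $I_1,I_2$ infinite, such that $(a_i)_{i\in I_1+I_2}$ is $A$-indiscernible, the whole sequence $(a_i)_{i\in I}$ is $A$-indiscernible. *)

theory Defs
  imports Complex_Main
begin

text \<open>Hamel spaces over an ordered field C (type 'c), with underlying group G (type 'g).
  The structure has universe G_inf = 'g option, where None plays the role of infinity.\<close>

definition less_inf :: "('g \<Rightarrow> 'g \<Rightarrow> bool) \<Rightarrow> 'g option \<Rightarrow> 'g option \<Rightarrow> bool" where
  "less_inf lt p q = (case (p, q) of (Some x, Some y) \<Rightarrow> lt x y | (Some _, None) \<Rightarrow> True | _ \<Rightarrow> False)"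

definition le_inf :: "('g \<Rightarrow> 'g \<Rightarrow> bool) \<Rightarrow> 'g option \<Rightarrow> 'g option \<Rightarrow> bool" where
  "le_inf lt p q = (less_inf lt p q \<or> p = q)"

definition min_inf :: "('g \<Rightarrow> 'g \<Rightarrow> bool) \<Rightarrow> 'g option \<Rightarrow> 'g option \<Rightarrow> 'g option" where
  "min_inf lt p q = (if le_inf lt p q then p else q)"

definition v_ext :: "('g \<Rightarrow> 'g option) \<Rightarrow> 'g option \<Rightarrow> 'g option" where
  "v_ext v p = (case p of None \<Rightarrow> None | Some x \<Rightarrow> v x)"

definition ordered_vs :: "('c::linordered_field \<Rightarrow> 'g::ab_group_add \<Rightarrow> 'g) \<Rightarrow> ('g \<Rightarrow> 'g \<Rightarrow> bool) \<Rightarrow> bool" where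
  "ordered_vs sc lt \<longleftrightarrow>
     (\<forall>x. \<not> lt x x) \<and> (\<forall>x y z. lt x y \<longrightarrow> lt y z \<longrightarrow> lt x z) \<and>
     (\<forall>x y. lt x y \<or> x = y \<or> lt y x) \<and>
     (\<forall>x y z. lt x y \<longrightarrow> lt (x + z) (y + z)) \<and>
     (\<forall>l x. 0 < l \<and> lt 0 x \<longrightarrow> lt 0 (sc l x))"

definition hamel_space ::
  "('c::linordered_field \<Rightarrow> 'g::ab_group_add \<Rightarrow> 'g) \<Rightarrow> ('g \<Rightarrow> 'g \<Rightarrow> bool) \<Rightarrow> ('g \<Rightarrow> 'g \<Rightarrow> bool)
     \<Rightarrow> ('g \<Rightarrow> 'g option) \<Rightarrow> bool" where
  "hamel_space sc lt0 lt1 v \<longleftrightarrow>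
     Vector_Spaces.vector_space sc \<and> ordered_vs sc lt0 \<and> ordered_vs sc lt1 \<and>
     (\<forall>x. v x = None \<longleftrightarrow> x = 0) \<and>
     (\<forall>x y. le_inf lt0 (min_inf lt0 (v x) (v y)) (v (x + y))) \<and>
     (\<forall>l x. l \<noteq> 0 \<longrightarrow> v (sc l x) = v x) \<and>
     (\<forall>x y. lt1 0 x \<longrightarrow> lt1 x y \<longrightarrow> le_inf lt0 (v y) (v x)) \<and>
     (\<forall>x. v_ext v (v x) = v x) \<and>
     (\<forall>x. less_inf lt1 (Some 0) (v x))"

text \<open>Independence: bounds in G \<union> {-inf, +inf}; a lower bound None means -inf,
  an upper bound None means +inf (lower bound +inf / upper bound -inf make the
  hypothesis a0 < b0 false, so they need not be considered).\<close>
definition lower_ok :: "('g \<Rightarrow> 'g \<Rightarrow> bool) \<Rightarrow> 'g option \<Rightarrow> 'g \<Rightarrow> bool" where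
  "lower_ok lt a z = (case a of None \<Rightarrow> True | Some x \<Rightarrow> lt x z)"
definition upper_ok :: "('g \<Rightarrow> 'g \<Rightarrow> bool) \<Rightarrow> 'g option \<Rightarrow> 'g \<Rightarrow> bool" where
  "upper_ok lt b z = (case b of None \<Rightarrow> True | Some x \<Rightarrow> lt z x)"
definition bounds_ok :: "('g \<Rightarrow> 'g \<Rightarrow> bool) \<Rightarrow> 'g option \<Rightarrow> 'g option \<Rightarrow> bool" where
  "bounds_ok lt a b = (case (a, b) of (Some x, Some y) \<Rightarrow> lt x y | _ \<Rightarrow> True)"

definition independent :: "('g \<Rightarrow> 'g \<Rightarrow> bool) \<Rightarrow> ('g \<Rightarrow> 'g \<Rightarrow> bool) \<Rightarrow> bool" where
  "independent lt0 lt1 \<longleftrightarrow>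
     (\<forall>a0 b0 a1 b1. bounds_ok lt0 a0 b0 \<longrightarrow> bounds_ok lt1 a1 b1 \<longrightarrow>
        (\<exists>z. lower_ok lt0 a0 z \<and> upper_ok lt0 b0 z \<and> lower_ok lt1 a1 z \<and> upper_ok lt1 b1 z))"

definition dense_hamel :: "('g \<Rightarrow> 'g \<Rightarrow> bool) \<Rightarrow> ('g \<Rightarrow> 'g option) \<Rightarrow> bool" where
  "dense_hamel lt0 v \<longleftrightarrow>
     (\<forall>a b. lt0 a b \<longrightarrow> (\<exists>c. less_inf lt0 (Some a) (v c) \<and> less_inf lt0 (v c) (Some b)))"

definition model_T_Ham ::
  "('c::linordered_field \<Rightarrow> 'g::ab_group_add \<Rightarrow> 'g) \<Rightarrow> ('g \<Rightarrow> 'g \<Rightarrow> bool) \<Rightarrow> ('g \<Rightarrow> 'g \<Rightarrow> bool)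
     \<Rightarrow> ('g \<Rightarrow> 'g option) \<Rightarrow> bool" where
  "model_T_Ham sc lt0 lt1 v \<longleftrightarrow>
     hamel_space sc lt0 lt1 v \<and> independent lt0 lt1 \<and> dense_hamel lt0 v"

datatype ('c, 'u) trm = Var nat | Cst 'u | Zero | Infty
  | Plus "('c, 'u) trm" "('c, 'u) trm" | Scal 'c "('c, 'u) trm" | Val "('c, 'u) trm"

datatype ('c, 'u) fm = Eq "('c, 'u) trm" "('c, 'u) trm" | Less0 "('c, 'u) trm" "('c, 'u) trm"
  | Less1 "('c, 'u) trm" "('c, 'u) trm" | Neg "('c, 'u) fm" | Conj "('c, 'u) fm" "('c, 'u) fm"
  | Ex nat "('c, 'u) fm"

fun params_trm :: "('c, 'u) trm \<Rightarrow> 'u set" where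
  "params_trm (Var k) = {}"
| "params_trm (Cst u) = {u}"
| "params_trm Zero = {}"
| "params_trm Infty = {}"
| "params_trm (Plus s t) = params_trm s \<union> params_trm t"
| "params_trm (Scal c t) = params_trm t"
| "params_trm (Val t) = params_trm t"

fun params_fm :: "('c, 'u) fm \<Rightarrow> 'u set" where
  "params_fm (Eq s t) = params_trm s \<union> params_trm t"
| "params_fm (Less0 s t) = params_trm s \<union> params_trm t"
| "params_fm (Less1 s t) = params_trm s \<union> params_trm t"
| "params_fm (Neg f) = params_fm f"
| "params_fm (Conj f g) = params_fm f \<union> params_fm g"
| "params_fm (Ex k f) = params_fm f"

fun eval :: "('c \<Rightarrow> 'g::ab_group_add \<Rightarrow> 'g) \<Rightarrow> ('g \<Rightarrow> 'g option) \<Rightarrow> (nat \<Rightarrow> 'g option)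
    \<Rightarrow> ('c, 'g option) trm \<Rightarrow> 'g option" where
  "eval sc v e (Var k) = e k"
| "eval sc v e (Cst u) = u"
| "eval sc v e Zero = Some 0"
| "eval sc v e Infty = None"
| "eval sc v e (Plus s t) =
     (case (eval sc v e s, eval sc v e t) of (Some x, Some y) \<Rightarrow> Some (x + y) | _ \<Rightarrow> None)"
| "eval sc v e (Scal c t) = map_option (sc c) (eval sc v e t)"
| "eval sc v e (Val t) = v_ext v (eval sc v e t)"

fun sat :: "('c \<Rightarrow> 'g::ab_group_add \<Rightarrow> 'g) \<Rightarrow> ('g \<Rightarrow> 'g \<Rightarrow> bool) \<Rightarrow> ('g \<Rightarrow> 'g \<Rightarrow> bool)
    \<Rightarrow> ('g \<Rightarrow> 'g option) \<Rightarrow> (nat \<Rightarrow> 'g option) \<Rightarrow> ('c, 'g option) fm \<Rightarrow> bool" where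
  "sat sc lt0 lt1 v e (Eq s t) = (eval sc v e s = eval sc v e t)"
| "sat sc lt0 lt1 v e (Less0 s t) = less_inf lt0 (eval sc v e s) (eval sc v e t)"
| "sat sc lt0 lt1 v e (Less1 s t) = less_inf lt1 (eval sc v e s) (eval sc v e t)"
| "sat sc lt0 lt1 v e (Neg f) = (\<not> sat sc lt0 lt1 v e f)"
| "sat sc lt0 lt1 v e (Conj f g) = (sat sc lt0 lt1 v e f \<and> sat sc lt0 lt1 v e g)"
| "sat sc lt0 lt1 v e (Ex k f) = (\<exists>u. sat sc lt0 lt1 v (e(k := u)) f)"

definition seq_env :: "nat \<Rightarrow> ('i \<Rightarrow> 'g option list) \<Rightarrow> 'i list \<Rightarrow> nat \<Rightarrow> 'g option" where
  "seq_env n a is = (\<lambda>k. if k < length is * n then a (is ! (k div n)) ! (k mod n) else None)"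

definition indiscernible ::
  "('c \<Rightarrow> 'g::ab_group_add \<Rightarrow> 'g) \<Rightarrow> ('g \<Rightarrow> 'g \<Rightarrow> bool) \<Rightarrow> ('g \<Rightarrow> 'g \<Rightarrow> bool)
     \<Rightarrow> ('g \<Rightarrow> 'g option) \<Rightarrow> 'g option set \<Rightarrow> 'i::linorder set \<Rightarrow> nat \<Rightarrow> ('i \<Rightarrow> 'g option list) \<Rightarrow> bool" where
  "indiscernible sc lt0 lt1 v A I n a \<longleftrightarrow>
     (\<forall>(\<phi> :: ('c, 'g option) fm) is js. params_fm \<phi> \<subseteq> A \<longrightarrow>
        sorted_wrt (<) is \<longrightarrow> sorted_wrt (<) js \<longrightarrow> set is \<subseteq> I \<longrightarrow> set js \<subseteq> I \<longrightarrow>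
        length is = length js \<longrightarrow>
        (sat sc lt0 lt1 v (seq_env n a is) \<phi> \<longleftrightarrow> sat sc lt0 lt1 v (seq_env n a js) \<phi>))"

end

theory Submission
  imports Defs
begin

text \<open>Quantifier elimination. Call \<open>h\<close> with \<open>v h = h\<close> a value. A term in a value \<open>h\<close> is
  \<open>l h + s\<close> with \<open>s\<close> free of \<open>h\<close>, because \<open>v (l h + s)\<close> is \<open>h\<close> or \<open>v s\<close> unless \<open>h = v s\<close>; its
  \<open>lt1\<close>-sign is decided in the same way. So only the \<open>lt0\<close>-cut of \<open>h\<close> matters, and by density a map
  preserving finitely many comparisons extends to \<open>h\<close>. To extend it to a general \<open>x\<close>, first extend
  it to the values \<open>v (x - c)\<close>, from the innermost outwards; what remains are \<open>lt0\<close>-inequalities and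
  \<open>lt1\<close>-open conditions on \<open>x\<close>, which are decoupled by independence.

  Distality. Grouping the sequence into blocks and fixing the terms far from the central index, it
  suffices to compare a single block at \<open>0\<close> with its neighbours. Along these blocks every term with
  parameters in \<open>A\<close> has the form \<open>s k + d\<close> with \<open>s\<close> parameter-free and \<open>d\<close> constant: since \<open>t k\<close> is
  monotone and \<open>v\<close> is \<open>lt1\<close>-convex, \<open>v (d - t k)\<close> is either constant or equal to \<open>v (t m - t k)\<close> for
  an extreme index \<open>m\<close>. A comparison of \<open>s k\<close> with a constant that agrees on both sides of \<open>0\<close>
  agrees at \<open>0\<close>, by monotonicity of \<open>s\<close> in both orders.\<close>

section \<open>Ordered vector spaces with a point at infinity\<close>

lemma less_inf_simps [simp]:
  "less_inf lt (Some x) (Some y) = lt x y"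
  "less_inf lt (Some x) None = True"
  "less_inf lt None p = False"
  by (auto simp: less_inf_def)

definition oplus :: "'g::ab_group_add option \<Rightarrow> 'g option \<Rightarrow> 'g option" where
  "oplus p q = (case (p, q) of (Some x, Some y) \<Rightarrow> Some (x + y) | _ \<Rightarrow> None)"

lemma oplus_simps [simp]:
  "oplus None q = None" "oplus p None = None" "oplus (Some x) (Some y) = Some (x + y)"
  by (auto simp: oplus_def split: option.splits)

lemma oplus_zero [simp]: "oplus (Some 0) p = p" "oplus p (Some 0) = p"
  by (cases p; simp)+

lemma oplus_eq_None_iff: "oplus p q = None \<longleftrightarrow> p = None \<or> q = None"
  by (cases p; cases q) simp_all

lemma oplus_oplus_swap: "oplus (oplus p q) (oplus p' q') = oplus (oplus p p') (oplus q q')"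
  by (cases p; cases q; cases p'; cases q') (simp_all add: add_ac)

definition affine :: "('c \<Rightarrow> 'g \<Rightarrow> 'g) \<Rightarrow> 'c \<Rightarrow> 'g::ab_group_add \<Rightarrow> 'g option \<Rightarrow> 'g option" where
  "affine sc l x p = oplus (Some (sc l x)) p"

text \<open>The solution \<open>x\<close> of \<open>l x + p = l' x + q\<close>; it is the junk value \<open>0\<close> if \<open>l = l'\<close>.\<close>

definition affine_root ::
  "('c::field \<Rightarrow> 'g \<Rightarrow> 'g) \<Rightarrow> 'c \<Rightarrow> 'g::ab_group_add option \<Rightarrow> 'c \<Rightarrow> 'g option \<Rightarrow> 'g option" where
  "affine_root sc l p l' q = map_option (sc (1 / (l - l'))) (oplus q (map_option (sc (- 1)) p))"

definition lower_image ::
  "('g \<Rightarrow> 'g \<Rightarrow> bool) \<Rightarrow> 'b set \<Rightarrow> ('b \<Rightarrow> 'g option) \<Rightarrow> 'g \<Rightarrow> ('b \<Rightarrow> 'g option) \<Rightarrow> 'g set" where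
  "lower_image lt S f x g = {r. \<exists>w\<in>S. less_inf lt (f w) (Some x) \<and> g w = Some r}"

definition upper_image ::
  "('g \<Rightarrow> 'g \<Rightarrow> bool) \<Rightarrow> 'b set \<Rightarrow> ('b \<Rightarrow> 'g option) \<Rightarrow> 'g \<Rightarrow> ('b \<Rightarrow> 'g option) \<Rightarrow> 'g set" where
  "upper_image lt S f x g = {r. \<exists>w\<in>S. less_inf lt (Some x) (f w) \<and> g w = Some r}"

lemma finite_image_cut:
  assumes "finite S"
  shows "finite (lower_image lt S f x g)" "finite (upper_image lt S f x g)"
proof -
  have "lower_image lt S f x g \<subseteq> the ` g ` S" "upper_image lt S f x g \<subseteq> the ` g ` S"
    unfolding lower_image_def upper_image_def by force+
  with assms show "finite (lower_image lt S f x g)" "finite (upper_image lt S f x g)"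
    by (meson finite_imageI finite_subset)+
qed

locale ordered_vector_space =
  fixes sc :: "'c::linordered_field \<Rightarrow> 'g::ab_group_add \<Rightarrow> 'g"
    and lt :: "'g \<Rightarrow> 'g \<Rightarrow> bool"
  assumes vector_space: "Vector_Spaces.vector_space sc"
    and ordered_vs: "ordered_vs sc lt"
begin

definition le :: "'g \<Rightarrow> 'g \<Rightarrow> bool" where
  "le x y \<longleftrightarrow> lt x y \<or> x = y"

sublocale vs: Vector_Spaces.vector_space sc
  by (rule vector_space)

sublocale linordered_ab_group_add "(+)" 0 "(-)" uminus le lt
proof
  have irrefl: "\<And>x. \<not> lt x x" and trans: "\<And>x y z. lt x y \<Longrightarrow> lt y z \<Longrightarrow> lt x z"
    and total: "\<And>x y. lt x y \<or> x = y \<or> lt y x"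
    and add: "\<And>x y z. lt x y \<Longrightarrow> lt (x + z) (y + z)"
    using ordered_vs unfolding ordered_vs_def by blast+
  fix x y z :: 'g
  show "lt x y = (le x y \<and> \<not> le y x)" using irrefl trans by (auto simp: le_def)
  show "le x x" by (simp add: le_def)
  show "le x y \<Longrightarrow> le y z \<Longrightarrow> le x z" using trans by (auto simp: le_def)
  show "le x y \<Longrightarrow> le y x \<Longrightarrow> x = y" using irrefl trans by (auto simp: le_def)
  show "le x y \<or> le y x" using total by (auto simp: le_def)
  show "le x y \<Longrightarrow> le (z + x) (z + y)"
    using add[of x y z] by (auto simp: le_def add.commute)
qed

sublocale ext: linorder "le_inf lt" "less_inf lt"
  by standard (auto simp: le_inf_def less_inf_def split: option.splits)

lemma diff_cancel_right [simp]: "lt (x - z) (y - z) \<longleftrightarrow> lt x y" "le (x - z) (y - z) \<longleftrightarrow> le x y"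
  using add_less_cancel_right[of x "- z" y] add_le_cancel_right[of x "- z" y] by simp_all

lemma diff_cancel_left [simp]: "lt (z - x) (z - y) \<longleftrightarrow> lt y x" "le (z - x) (z - y) \<longleftrightarrow> le y x"
  using add_less_cancel_left[of z "- x" "- y"] add_le_cancel_left[of z "- x" "- y"] by simp_all

lemma scale_pos: "0 < l \<Longrightarrow> lt 0 x \<Longrightarrow> lt 0 (sc l x)"
  using ordered_vs unfolding ordered_vs_def by blast

lemma scale_pos_iff: "0 < l \<Longrightarrow> lt 0 (sc l x) \<longleftrightarrow> lt 0 x"
  using scale_pos[of l x] scale_pos[of "inverse l" "sc l x"] by auto

lemma scale_neg_iff: "l < 0 \<Longrightarrow> lt 0 (sc l x) \<longleftrightarrow> lt x 0"
  using scale_pos_iff[of "- l" "- x"] by simp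

lemma scale_half_double [simp]: "sc (1/2) (x + x) = x"
  by (simp add: vs.scale_right_distrib flip: vs.scale_left_distrib)

lemma scale_two: "sc 2 x = x + x"
  using vs.scale_left_distrib[of 1 1 x] by simp

lemma midpoint_between:
  assumes "lt x y" shows "lt x (sc (1/2) (x + y))" "lt (sc (1/2) (x + y)) y"
proof -
  have "sc (1/2) (x + y) - x = sc (1/2) (y - x)" "y - sc (1/2) (x + y) = sc (1/2) (y - x)"
    using scale_half_double[of x] scale_half_double[of y]
    by (simp_all only: vs.scale_right_diff_distrib vs.scale_right_distrib)
      (simp_all add: algebra_simps)
  moreover have "lt 0 (sc (1/2) (y - x))" using assms by (intro scale_pos) simp_all
  ultimately show "lt x (sc (1/2) (x + y))" "lt (sc (1/2) (x + y)) y"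
    by (metis diff_gt_0_iff_gt)+
qed

lemma midpoint_diff: "sc (1/2) (p + q) - a = sc (1/2) ((p - a) + (q - a))"
  using scale_half_double[of a]
  by (simp only: vs.scale_right_diff_distrib vs.scale_right_distrib) (simp add: algebra_simps)

lemma affine_simps [simp]:
  "affine sc l x None = None" "affine sc l x (Some a) = Some (sc l x + a)" "affine sc 0 x p = p"
  by (simp_all add: affine_def)

lemma affine_root_Some [simp]:
  "affine_root sc l (Some a) l' (Some b) = Some (sc (1 / (l - l')) (b - a))"
  by (simp add: affine_root_def)

lemma oplus_affine:
  "oplus (affine sc l x p) (affine sc l' x q) = affine sc (l + l') x (oplus p q)"
  unfolding affine_def by (subst oplus_oplus_swap) (simp add: vs.scale_left_distrib)

lemma scale_affine:
  "map_option (sc c) (affine sc l x p) = affine sc (c * l) x (map_option (sc c) p)"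
  by (cases p) (simp_all add: vs.scale_right_distrib)

lemma affine_cmp_root:
  fixes x a b :: 'g
  assumes "l \<noteq> l'"
  defines "r \<equiv> sc (1 / (l - l')) (b - a)"
  shows "sc l x + a = sc l' x + b \<longleftrightarrow> x = r"
    "lt (sc l x + a) (sc l' x + b) \<longleftrightarrow> (if l' < l then lt x r else lt r x)"
proof -
  have "sc (l - l') r = b - a"
    using assms(1) by (simp add: r_def)
  then have diff: "(sc l' x + b) - (sc l x + a) = sc (l - l') (r - x)"
    by (simp only: vs.scale_right_diff_distrib vs.scale_left_diff_distrib) (simp add: algebra_simps)
  have "sc l x + a = sc l' x + b \<longleftrightarrow> (sc l' x + b) - (sc l x + a) = 0"
    by auto
  then show "sc l x + a = sc l' x + b \<longleftrightarrow> x = r"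
    using assms(1) unfolding diff by auto
  have "lt (sc l x + a) (sc l' x + b) \<longleftrightarrow> lt 0 ((sc l' x + b) - (sc l x + a))"
    by (rule diff_gt_0_iff_gt[symmetric])
  then show "lt (sc l x + a) (sc l' x + b) \<longleftrightarrow> (if l' < l then lt x r else lt r x)"
    using assms(1) scale_pos_iff[of "l - l'"] scale_neg_iff[of "l - l'"] unfolding diff by auto
qed

definition same_order :: "'g option \<Rightarrow> 'g option \<Rightarrow> 'g option \<Rightarrow> 'g option \<Rightarrow> bool" where
  "same_order p q p' q' \<longleftrightarrow> (p = q \<longleftrightarrow> p' = q') \<and> (less_inf lt p q \<longleftrightarrow> less_inf lt p' q')"

lemma same_order_commute: "same_order p q p' q' \<longleftrightarrow> same_order q p q' p'"
  unfolding same_order_def by (metis ext.less_linear ext.less_asym)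

lemma same_order_sym: "same_order p q p' q' \<longleftrightarrow> same_order p' q' p q"
  unfolding same_order_def by blast

lemma same_order_trans:
  "same_order p q p' q' \<Longrightarrow> same_order p' q' p'' q'' \<Longrightarrow> same_order p q p'' q''"
  unfolding same_order_def by blast

lemma same_order_cases:
  assumes "same_order p q p' q'"
  obtains (eq) "p = q" "p' = q'" | (less) "less_inf lt p q" "less_inf lt p' q'"
    | (greater) "less_inf lt q p" "less_inf lt q' p'"
  using assms same_order_commute[of p q p' q'] ext.less_linear[of p q]
  unfolding same_order_def by blast

lemma same_order_None:
  assumes "p = None \<or> q = None" "p = None \<longleftrightarrow> p' = None" "q = None \<longleftrightarrow> q' = None"
  shows "same_order p q p' q'"
  using assms by (cases p; cases q; cases p'; cases q') (simp_all add: same_order_def)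

lemma same_order_between:
  assumes "same_order p q q r" "same_order p d r d" shows "same_order q d r d"
proof -
  consider "less_inf lt p q" "less_inf lt q r" | "less_inf lt q p" "less_inf lt r q"
    | "p = q" "q = r"
    using assms(1) unfolding same_order_def by (metis ext.less_linear)
  then show ?thesis
    using assms(2) unfolding same_order_def
    by cases (metis ext.less_linear ext.less_trans ext.less_irrefl)+
qed

lemma same_order_add_iff:
  "same_order (Some (a + x)) (Some (b + y)) (Some (a' + x)) (Some (b' + y)) \<longleftrightarrow>
    same_order (Some (a - b)) (Some (y - x)) (Some (a' - b')) (Some (y - x))"
proof -
  have diff: "a + x - (b + y) = a - b - (y - x)" for a b
    by (simp add: algebra_simps)
  have "a + x = b + y \<longleftrightarrow> a - b = y - x" for a b
    unfolding eq_iff_diff_eq_0[of "a + x"] eq_iff_diff_eq_0[of "a - b"] diff ..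
  moreover have "lt (a + x) (b + y) \<longleftrightarrow> lt (a - b) (y - x)" for a b
    unfolding diff_less_0_iff_less[of "a + x", symmetric]
      diff_less_0_iff_less[of "a - b", symmetric] diff ..
  ultimately show ?thesis
    unfolding same_order_def less_inf_simps option.inject by (simp only: )
qed

lemma same_order_affine:
  assumes none: "p = None \<longleftrightarrow> p' = None" "q = None \<longleftrightarrow> q' = None"
    and parallel: "l = l' \<Longrightarrow> same_order p q p' q'"
    and root: "l \<noteq> l' \<Longrightarrow>
      same_order (Some x) (affine_root sc l p l' q) (Some x') (affine_root sc l p' l' q')"
  shows "same_order (affine sc l x p) (affine sc l' x q) (affine sc l x' p') (affine sc l' x' q')"
proof (cases "p = None \<or> q = None")
  case True
  then show ?thesis using none
    by (intro same_order_None) (auto simp: affine_def oplus_eq_None_iff)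
next
  case False
  then obtain a b a' b' where [simp]: "p = Some a" "q = Some b" "p' = Some a'" "q' = Some b'"
    using none by auto
  show ?thesis
  proof (cases "l = l'")
    case True
    then show ?thesis using parallel by (simp add: same_order_def)
  next
    case False
    then have "same_order (Some x) (affine_root sc l p l' q) (Some x') (affine_root sc l p' l' q')"
      "same_order (affine_root sc l p l' q) (Some x) (affine_root sc l p' l' q') (Some x')"
      using root same_order_commute by blast+
    then show ?thesis
      by (simp add: same_order_def affine_cmp_root[OF False])
  qed
qed

lemma lower_image_less_upper_image:
  assumes "\<forall>s\<in>S. \<forall>t\<in>S. same_order (f s) (f t) (g s) (g t)"
    and "r \<in> lower_image lt S f x g" "q \<in> upper_image lt S f x g"
  shows "lt r q"
proof -
  obtain s t where "s \<in> S" "less_inf lt (f s) (Some x)" "g s = Some r"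
    "t \<in> S" "less_inf lt (Some x) (f t)" "g t = Some q"
    using assms(2,3) unfolding lower_image_def upper_image_def by blast
  moreover from this have "less_inf lt (f s) (f t)" using ext.less_trans by blast
  ultimately have "less_inf lt (Some r) (Some q)" using assms(1) unfolding same_order_def by metis
  then show ?thesis by simp
qed

lemma same_order_cut:
  assumes "w \<in> S" "f w \<noteq> Some x" "f w = None \<longleftrightarrow> g w = None"
    and "\<forall>r\<in>lower_image lt S f x g. lt r z" "\<forall>r\<in>upper_image lt S f x g. lt z r"
  shows "same_order (f w) (Some x) (g w) (Some z)"
proof (cases "g w")
  case (Some r)
  from assms(2) consider (below) "less_inf lt (f w) (Some x)" | (above) "less_inf lt (Some x) (f w)"
    using ext.less_linear by blast
  then show ?thesis
  proof cases
    case below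
    then have "lt r z" using assms(1,4) Some by (auto simp: lower_image_def)
    then show ?thesis using below Some assms(2) by (auto simp: same_order_def)
  next
    case above
    then have "lt z r" using assms(1,5) Some by (auto simp: upper_image_def)
    then have "\<not> lt r z" "r \<noteq> z" "\<not> less_inf lt (f w) (Some x)"
      using above ext.less_asym less_asym less_irrefl by blast+
    then show ?thesis using Some assms(2) by (simp add: same_order_def)
  qed
qed (use assms(2,3) in \<open>auto simp: same_order_def\<close>)

lemma greatest_lower_bound_ok:
  assumes "finite A"
  obtains m where "\<And>z. lower_ok lt m z \<Longrightarrow> \<forall>x\<in>A. lt x z" "\<And>x. m = Some x \<Longrightarrow> x \<in> A"
proof (cases "A = {}")
  case True
  then show ?thesis using that[of None] by simp
next
  case False
  then have "Max A \<in> A" "\<And>x. x \<in> A \<Longrightarrow> le x (Max A)" using assms by simp_all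
  then show ?thesis
    using that[of "Some (Max A)"] by (auto simp: lower_ok_def intro: le_less_trans)
qed

lemma least_upper_bound_ok:
  assumes "finite B"
  obtains m where "\<And>z. upper_ok lt m z \<Longrightarrow> \<forall>x\<in>B. lt z x" "\<And>x. m = Some x \<Longrightarrow> x \<in> B"
proof (cases "B = {}")
  case True
  then show ?thesis using that[of None] by simp
next
  case False
  then have "Min B \<in> B" "\<And>x. x \<in> B \<Longrightarrow> le (Min B) x" using assms by simp_all
  then show ?thesis
    using that[of "Some (Min B)"] by (auto simp: upper_ok_def intro: less_le_trans)
qed

end

section \<open>Hamel spaces\<close>

locale hamel_valuation =
  fixes sc :: "'c::linordered_field \<Rightarrow> 'g::ab_group_add \<Rightarrow> 'g"
    and lt0 lt1 :: "'g \<Rightarrow> 'g \<Rightarrow> bool"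
    and v :: "'g \<Rightarrow> 'g option"
  assumes hamel_space: "hamel_space sc lt0 lt1 v"
begin

sublocale o0: ordered_vector_space sc lt0
  using hamel_space by (auto simp: hamel_space_def intro: ordered_vector_space.intro)

sublocale o1: ordered_vector_space sc lt1
  using hamel_space by (auto simp: hamel_space_def intro: ordered_vector_space.intro)

lemma v_None_iff [simp]: "v x = None \<longleftrightarrow> x = 0"
  using hamel_space by (auto simp: hamel_space_def)

lemma v_zero [simp]: "v 0 = None"
  by simp

lemma v_scale [simp]: "l \<noteq> 0 \<Longrightarrow> v (sc l x) = v x"
  using hamel_space by (auto simp: hamel_space_def)

lemma v_minus [simp]: "v (- x) = v x"
  using v_scale[of "-1" x] by (simp del: v_scale)

lemma v_diff_commute: "v (x - y) = v (y - x)"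
  using v_minus[of "x - y"] by (simp del: v_minus)

lemma v_uminus_diff: "v (- x - - y) = v (x - y)"
  using v_minus[of "x - y"] by (simp add: add.commute del: v_minus)

lemma v_idem: "v x = Some h \<Longrightarrow> v h = Some h"
  using hamel_space unfolding hamel_space_def v_ext_def by (metis option.simps(5))

lemma v_pos: "v x = Some h \<Longrightarrow> lt1 0 h"
  using hamel_space unfolding hamel_space_def by (metis less_inf_simps(1))

lemma v_add_ge:
  assumes "le_inf lt0 p (v x)" "le_inf lt0 p (v y)" shows "le_inf lt0 p (v (x + y))"
proof -
  have "le_inf lt0 (min_inf lt0 (v x) (v y)) (v (x + y))"
    using hamel_space by (auto simp: hamel_space_def)
  then show ?thesis
    using assms o0.ext.order_trans unfolding min_inf_def by (metis (full_types))
qed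

lemma v_add_less:
  assumes "less_inf lt0 (v x) (v y)" shows "v (x + y) = v x"
proof (rule o0.ext.order.antisym)
  show "le_inf lt0 (v x) (v (x + y))" using assms by (intro v_add_ge) auto
  show "le_inf lt0 (v (x + y)) (v x)"
  proof (rule ccontr)
    assume "\<not> ?thesis"
    then have "less_inf lt0 (v x) (v (x + y))" by simp
    moreover have "le_inf lt0 (o0.ext.min (v (x + y)) (v y)) (v (x + y + - y))"
      by (rule v_add_ge) (simp_all only: o0.ext.min.cobounded1 o0.ext.min.cobounded2 v_minus)
    ultimately show False using assms by (simp add: o0.ext.min_def split: if_splits)
  qed
qed

lemma v_antimono:
  assumes "lt1 0 x" "o1.le x y" shows "le_inf lt0 (v y) (v x)"
  using hamel_space assms unfolding hamel_space_def o1.le_def by auto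

lemma v_between:
  assumes "o1.le a b \<and> lt1 b d \<or> lt1 d b \<and> o1.le b a"
  shows "le_inf lt0 (v (d - a)) (v (d - b))"
  using assms
proof (elim disjE conjE)
  assume "o1.le a b" "lt1 b d"
  then show ?thesis by (intro v_antimono) simp_all
next
  assume "lt1 d b" "o1.le b a"
  then have "le_inf lt0 (v (a - d)) (v (b - d))" by (intro v_antimono) simp_all
  then show ?thesis by (simp only: v_diff_commute[of d])
qed

lemma v_add_nonneg:
  assumes "o1.le 0 x" "o1.le 0 y" "v y = p" "le_inf lt0 p (v x)" shows "v (x + y) = p"
proof (cases "y = 0")
  case True
  then have "p = None" using assms(3) by auto
  then have "v x = None" using assms(4) by (cases "v x") (auto simp: le_inf_def)
  then show ?thesis using True assms by auto
next
  case False
  then have "lt1 0 y" using assms by (auto simp: o1.le_def)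
  moreover have "o1.le y (x + y)" using assms by simp
  ultimately have "le_inf lt0 (v (x + y)) p" using v_antimono assms by blast
  moreover have "le_inf lt0 p (v (x + y))" using assms by (intro v_add_ge) auto
  ultimately show ?thesis by simp
qed

lemma pos_add_iff:
  assumes "less_inf lt0 (v x) (v y)" shows "lt1 0 (x + y) \<longleftrightarrow> lt1 0 x"
proof -
  have pos_add: "lt1 0 (x + y)" if "lt1 0 x" "less_inf lt0 (v x) (v y)" for x y
  proof (rule ccontr)
    assume "\<not> ?thesis"
    then have "o1.le x (- y)" using o1.add_right_mono[of "x + y" 0 "- y"] by simp
    then have "le_inf lt0 (v (- y)) (v x)" using v_antimono that by blast
    then show False using that by simp
  qed
  have "x \<noteq> 0" using assms by auto
  then consider (pos) "lt1 0 x" | (neg) "lt1 0 (- x)" using o1.less_linear[of x 0] by auto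
  then show ?thesis
  proof cases
    case pos
    then show ?thesis using pos_add[OF _ assms] by simp
  next
    case neg
    then have "lt1 0 (- x + - y)" using assms by (intro pos_add) simp_all
    then have "lt1 0 (- (x + y))" by (simp add: add.commute)
    then have "lt1 (x + y) 0" "lt1 x 0" using neg by (simp_all only: o1.neg_0_less_iff_less)
    then show ?thesis using o1.less_asym by blast
  qed
qed

lemma v_eq_open_above:
  assumes "lt1 s x" "v (x - s) = Some h"
  obtains p q where "lt1 p x" "lt1 x q" "\<And>z. lt1 p z \<Longrightarrow> lt1 z q \<Longrightarrow> v (z - s) = Some h"
proof
  let ?p = "sc (1/2) (s + x)" and ?q = "x + (x - s)"
  show "lt1 ?p x" "lt1 x ?q" using assms o1.midpoint_between by auto
  fix z assume z: "lt1 ?p z" "lt1 z ?q"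
  have sp: "lt1 s ?p" using assms(1) by (rule o1.midpoint_between)
  have "?p - s = sc (1/2) (x - s)" using o1.midpoint_diff[of s x s] by simp
  then have "v (s - ?p) = Some h" using assms(2) by (simp add: v_diff_commute[of s])
  moreover have "le_inf lt0 (v (s - z)) (v (s - ?p))"
    using sp z(1) by (intro v_between) (simp add: o1.le_def)
  moreover have "?q - s = sc 2 (x - s)" by (simp add: o1.scale_two algebra_simps)
  then have "v (s - ?q) = Some h" using assms(2) v_diff_commute[of s ?q] by simp
  moreover have "le_inf lt0 (v (s - ?q)) (v (s - z))"
    using o1.less_trans[OF sp z(1)] z(2) by (intro v_between) (simp add: o1.le_def)
  ultimately show "v (z - s) = Some h" by (simp add: v_diff_commute[of s])
qed

lemma v_eq_open:
  assumes "v (x - s) = Some h"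
  obtains p q where "lt1 p x" "lt1 x q" "\<And>z. lt1 p z \<Longrightarrow> lt1 z q \<Longrightarrow> v (z - s) = Some h"
proof -
  have "x \<noteq> s" using assms by auto
  then consider (pos) "lt1 s x" | (neg) "lt1 (- s) (- x)" using o1.less_linear[of x s] by auto
  then show ?thesis
  proof cases
    case pos
    then show ?thesis using v_eq_open_above assms that by blast
  next
    case neg
    moreover have "v (- x - - s) = Some h" using assms by (simp only: v_uminus_diff)
    ultimately obtain p q where pq: "lt1 p (- x)" "lt1 (- x) q"
      and v: "\<And>z. lt1 p z \<Longrightarrow> lt1 z q \<Longrightarrow> v (z - - s) = Some h" using v_eq_open_above by blast
    show ?thesis
    proof (rule that)
      show "lt1 (- q) x" using pq(2) by (rule o1.minus_less_iff[THEN iffD1])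
      show "lt1 x (- p)" using pq(1) by (rule o1.less_minus_iff[THEN iffD1])
      fix z assume "lt1 (- q) z" "lt1 z (- p)"
      then have "v (- z - - s) = Some h"
        by (intro v) (auto intro: o1.less_minus_iff[THEN iffD1] o1.minus_less_iff[THEN iffD1])
      then show "v (z - s) = Some h" by (simp only: v_uminus_diff)
    qed
  qed
qed

lemma v_affine_value:
  assumes "v h = Some h" "l \<noteq> 0"
  shows "less_inf lt0 (v a) (Some h) \<Longrightarrow> v (sc l h + a) = v a"
    "less_inf lt0 (Some h) (v a) \<Longrightarrow> v (sc l h + a) = Some h"
  using v_add_less[of a "sc l h"] v_add_less[of "sc l h" a] assms by (simp_all add: add.commute)

lemma same_order_value:
  assumes h: "v h = Some h" "v h' = Some h'"
    and "o0.same_order (v r) (Some h) (v r') (Some h')"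
    and sign: "o1.same_order (Some 0) (Some r) (Some 0) (Some r')"
    and self: "o1.same_order (v r) (Some r) (v r') (Some r')"
  shows "o1.same_order (Some h) (Some r) (Some h') (Some r')"
proof -
  have pos: "lt1 0 h" "lt1 0 h'" using h v_pos by blast+
  from assms(3) show ?thesis
  proof (cases rule: o0.same_order_cases)
    case eq
    then show ?thesis using self by simp
  next
    case less
    have "lt1 h r \<longleftrightarrow> lt1 0 r" "h \<noteq> r" if "v h = Some h" "less_inf lt0 (v r) (Some h)" for h r
      using pos_add_iff[of r "- h"] that by auto
    then show ?thesis using less h sign by (simp add: o1.same_order_def)
  next
    case greater
    have "\<not> lt1 h r" "h \<noteq> r" if "v h = Some h" "less_inf lt0 (Some h) (v r)" for h r
      using pos_add_iff[of h "- r"] v_pos[OF that(1)] that o1.less_asym[of h r] by auto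
    then show ?thesis using greater h by (simp add: o1.same_order_def)
  qed
qed

end

definition candidates ::
  "('c::field \<Rightarrow> 'g \<Rightarrow> 'g) \<Rightarrow> 'g::ab_group_add set \<Rightarrow> 'g set \<Rightarrow> 'g set" where
  "candidates sc P H =
    {sc (1/2) (p + q) |p q. p \<in> P \<and> q \<in> P} \<union> {p + h |p h. p \<in> P \<and> h \<in> H} \<union>
    {p - h |p h. p \<in> P \<and> h \<in> H}"

lemma candidates_mono: "P \<subseteq> P' \<Longrightarrow> H \<subseteq> H' \<Longrightarrow> candidates sc P H \<subseteq> candidates sc P' H'"
  unfolding candidates_def by blast

context hamel_valuation
begin

lemma v_ball_diff:
  assumes "le_inf lt0 k (v (p - x))" "le_inf lt0 k (v (a - x))" shows "le_inf lt0 k (v (p - a))"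
  using v_add_ge[of k "p - x" "x - a"] assms by (simp add: v_diff_commute[of x])

lemma v_midpoint_above:
  assumes "lt1 p x" "lt1 x q" "o1.le a p" "v (x - a) = Some k"
    and "le_inf lt0 (Some k) (v (p - a))" "le_inf lt0 (Some k) (v (q - a))"
  shows "v (sc (1/2) (p + q) - a) = Some k"
proof -
  have "lt1 a x" "lt1 a q"
    using assms(1-3) o1.le_less_trans o1.less_trans by blast+
  then have "le_inf lt0 (v (q - a)) (v (x - a))"
    using assms(2) by (intro v_antimono) (simp_all add: o1.le_def)
  then have "v (q - a) = Some k" using assms(4,6) by simp
  then have "v ((p - a) + (q - a)) = Some k"
    using assms(3,5) \<open>lt1 a q\<close> by (intro v_add_nonneg) (auto simp: o1.le_def)
  then show ?thesis by (simp add: o1.midpoint_diff)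
qed

lemma v_midpoint_below:
  assumes "lt1 p x" "lt1 x q" "o1.le q a" "v (x - a) = Some k"
    and "le_inf lt0 (Some k) (v (p - a))" "le_inf lt0 (Some k) (v (q - a))"
  shows "v (sc (1/2) (p + q) - a) = Some k"
proof -
  have "v (sc (1/2) (- q + - p) - - a) = Some k"
    using assms by (intro v_midpoint_above[of "- q" "- x"])
      (simp_all only: v_uminus_diff o1.neg_less_iff_less o1.neg_le_iff_le)
  moreover have "sc (1/2) (- q + - p) = - sc (1/2) (p + q)"
    by (simp flip: o0.vs.scale_minus_right)
  ultimately show ?thesis by (simp only: v_uminus_diff)
qed

lemma ball_gap_between:
  assumes "finite L" "finite U" "L \<noteq> {}" "U \<noteq> {}" "\<forall>p\<in>L. lt1 p x" "\<forall>q\<in>U. lt1 x q"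
    and ball: "\<forall>p\<in>L \<union> U. le_inf lt0 (Some k) (v (p - x))"
  shows "\<exists>y\<in>candidates sc (L \<union> U) {k}. le_inf lt0 (Some k) (v (y - x)) \<and>
    (\<forall>p\<in>L. lt1 p y) \<and> (\<forall>q\<in>U. lt1 y q) \<and> (\<forall>a\<in>L \<union> U. v (x - a) = Some k \<longrightarrow> v (y - a) = Some k)"
proof -
  define p where "p = o1.Max L"
  define q where "q = o1.Min U"
  let ?y = "sc (1/2) (p + q)"
  have p: "p \<in> L" "\<And>a. a \<in> L \<Longrightarrow> o1.le a p" and q: "q \<in> U" "\<And>a. a \<in> U \<Longrightarrow> o1.le q a"
    using assms(1-4) by (auto simp: p_def q_def o1.Max_in o1.Min_in)
  have px: "lt1 p x" and xq: "lt1 x q" using p(1) q(1) assms(5,6) by blast+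
  have y: "lt1 p ?y" "lt1 ?y q" using o1.midpoint_between[of p q] o1.less_trans[OF px xq] by blast+
  have ball_pq: "le_inf lt0 (Some k) (v (p - a))" "le_inf lt0 (Some k) (v (q - a))"
    if "a \<in> L \<union> U" for a
    using p(1) q(1) ball that by (auto intro!: v_ball_diff[of "Some k" _ x a])
  have "?y \<in> candidates sc (L \<union> U) {k}"
    using p(1) q(1) unfolding candidates_def by blast
  moreover have "le_inf lt0 (Some k) (v (?y - x))"
    using v_add_ge[of "Some k" "p - x" "q - x"] p(1) q(1) ball by (simp add: o1.midpoint_diff)
  moreover have "\<forall>a\<in>L. lt1 a ?y" "\<forall>a\<in>U. lt1 ?y a"
    using p(2) q(2) o1.le_less_trans[OF _ y(1)] o1.less_le_trans[OF y(2)] by blast+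
  moreover have "\<forall>a\<in>L \<union> U. v (x - a) = Some k \<longrightarrow> v (?y - a) = Some k"
    using p(2) q(2) v_midpoint_above[OF px xq _ _ ball_pq] v_midpoint_below[OF px xq _ _ ball_pq]
    by blast
  ultimately show ?thesis by blast
qed

lemma ball_gap_above:
  assumes "finite L" "L \<noteq> {}" "v k = Some k"
    and ball: "\<forall>p\<in>L. le_inf lt0 (Some k) (v (p - x))"
  shows "\<exists>p\<in>L. le_inf lt0 (Some k) (v (p + k - x)) \<and> (\<forall>a\<in>L. lt1 a (p + k) \<and> v (p + k - a) = Some k)"
proof
  let ?p = "o1.Max L"
  have pos: "lt1 0 k" using assms(3) by (rule v_pos)
  show p: "?p \<in> L" using assms(1,2) by simp
  have "le_inf lt0 (Some k) (v ((?p - x) + k))"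
    using p assms(3) ball by (intro v_add_ge) auto
  moreover have "lt1 a (?p + k) \<and> v (?p + k - a) = Some k" if a: "a \<in> L" for a
  proof
    have "o1.le a ?p" using a assms(1,2) by simp
    then show "lt1 a (?p + k)" using pos o1.add_le_less_mono[of a ?p 0 k] by simp
    have "v ((?p - a) + k) = Some k"
      using \<open>o1.le a ?p\<close> pos assms(3) v_ball_diff[of "Some k" ?p x a] p a ball
      by (intro v_add_nonneg) (auto simp: o1.le_def)
    then show "v (?p + k - a) = Some k" by (simp add: algebra_simps)
  qed
  ultimately show
    "le_inf lt0 (Some k) (v (?p + k - x)) \<and> (\<forall>a\<in>L. lt1 a (?p + k) \<and> v (?p + k - a) = Some k)"
    by (simp add: algebra_simps)
qed

lemma ball_gap_below:
  assumes "finite U" "U \<noteq> {}" "v k = Some k"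
    and ball: "\<forall>q\<in>U. le_inf lt0 (Some k) (v (q - x))"
  shows "\<exists>q\<in>U. le_inf lt0 (Some k) (v (q - k - x)) \<and> (\<forall>a\<in>U. lt1 (q - k) a \<and> v (q - k - a) = Some k)"
proof -
  have "\<forall>p\<in>uminus ` U. le_inf lt0 (Some k) (v (p - - x))"
    using ball by (simp only: ball_simps v_uminus_diff)
  then obtain q where q: "q \<in> U" "le_inf lt0 (Some k) (v (- q + k - - x))"
    "\<And>a. a \<in> U \<Longrightarrow> lt1 (- a) (- q + k) \<and> v (- q + k - - a) = Some k"
    using ball_gap_above[of "uminus ` U" k "- x"] assms(1-3) by auto
  have reflect: "- q + k = - (q - k)" by simp
  show ?thesis
    using q unfolding reflect v_uminus_diff o1.neg_less_iff_less by blast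
qed

lemma ball_gap:
  assumes "finite L" "finite U" "L \<union> U \<noteq> {}" "v k = Some k"
    and L: "\<forall>p\<in>L. lt1 p x" and U: "\<forall>q\<in>U. lt1 x q"
    and ball: "\<forall>p\<in>L \<union> U. le_inf lt0 (Some k) (v (p - x))"
  shows "\<exists>y\<in>candidates sc (L \<union> U) {k}. le_inf lt0 (Some k) (v (y - x)) \<and>
    (\<forall>p\<in>L. lt1 p y) \<and> (\<forall>q\<in>U. lt1 y q) \<and> (\<forall>a\<in>L \<union> U. v (x - a) = Some k \<longrightarrow> v (y - a) = Some k)"
proof -
  consider (both) "L \<noteq> {}" "U \<noteq> {}" | (lower) "L \<noteq> {}" "U = {}" | (upper) "L = {}" "U \<noteq> {}"
    using assms(3) by blast
  then show ?thesis
  proof cases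
    case both
    then show ?thesis using ball_gap_between assms(1,2) L U ball by blast
  next
    case lower
    then obtain p where "p \<in> L" "le_inf lt0 (Some k) (v (p + k - x))"
      "\<forall>a\<in>L. lt1 a (p + k) \<and> v (p + k - a) = Some k"
      using ball_gap_above[of L k x] assms(1,4) ball by auto
    moreover from this have "p + k \<in> candidates sc (L \<union> U) {k}" unfolding candidates_def by blast
    ultimately show ?thesis using lower by blast
  next
    case upper
    then obtain q where "q \<in> U" "le_inf lt0 (Some k) (v (q - k - x))"
      "\<forall>a\<in>U. lt1 (q - k) a \<and> v (q - k - a) = Some k"
      using ball_gap_below[of U k x] assms(2,4) ball by auto
    moreover from this have "q - k \<in> candidates sc (L \<union> U) {k}" unfolding candidates_def by blast
    ultimately show ?thesis using upper by blast
  qed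
qed

lemma same_order_outside_ball:
  assumes "less_inf lt0 (v (x - p)) (v (y - x))"
  shows "o1.same_order (Some p) (Some x) (Some p) (Some y)"
proof -
  have "p \<noteq> x" using assms by auto
  moreover have "p \<noteq> y" using assms by (auto simp: v_diff_commute[of x])
  moreover have "lt1 p y \<longleftrightarrow> lt1 p x" using pos_add_iff[OF assms] by simp
  ultimately show ?thesis by (simp add: o1.same_order_def)
qed

lemma ball_candidate:
  assumes "finite P" "x \<notin> P" "v k = Some k" "c \<in> P" "le_inf lt0 (Some k) (v (c - x))"
  obtains y where "y \<in> candidates sc P {k}" "le_inf lt0 (Some k) (v (y - x))"
    and "\<And>p. p \<in> P \<Longrightarrow> le_inf lt0 (Some k) (v (p - x)) \<Longrightarrow>
      o1.same_order (Some p) (Some x) (Some p) (Some y)"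
    and "\<And>p. p \<in> P \<Longrightarrow> v (x - p) = Some k \<Longrightarrow> v (y - p) = Some k"
proof -
  define L where "L = {p \<in> P. le_inf lt0 (Some k) (v (p - x)) \<and> lt1 p x}"
  define U where "U = {p \<in> P. le_inf lt0 (Some k) (v (p - x)) \<and> lt1 x p}"
  have near: "p \<in> L \<union> U" if "p \<in> P" "le_inf lt0 (Some k) (v (p - x))" for p
    using that assms(2) o1.less_linear[of p x] unfolding L_def U_def by blast
  have "finite L" "finite U" using assms(1) by (simp_all add: L_def U_def)
  moreover have "\<forall>p\<in>L. lt1 p x" "\<forall>q\<in>U. lt1 x q" "\<forall>p\<in>L \<union> U. le_inf lt0 (Some k) (v (p - x))"
    by (auto simp: L_def U_def)
  moreover have "L \<union> U \<noteq> {}" using near assms(4,5) by blast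
  ultimately obtain y where y: "y \<in> candidates sc (L \<union> U) {k}" "le_inf lt0 (Some k) (v (y - x))"
    "\<forall>p\<in>L. lt1 p y" "\<forall>q\<in>U. lt1 y q" "\<forall>a\<in>L \<union> U. v (x - a) = Some k \<longrightarrow> v (y - a) = Some k"
    using ball_gap[of L U k x] assms(3) by blast
  show ?thesis
  proof (rule that)
    have "L \<union> U \<subseteq> P" by (auto simp: L_def U_def)
    then show "y \<in> candidates sc P {k}" using y(1) candidates_mono by blast
    show "o1.same_order (Some p) (Some x) (Some p) (Some y)"
      if "p \<in> P" "le_inf lt0 (Some k) (v (p - x))" for p
      using near[OF that] y(3,4) o1.less_asym[of p] o1.less_irrefl
      by (auto simp: o1.same_order_def L_def U_def)
    show "v (y - p) = Some k" if "p \<in> P" "v (x - p) = Some k" for p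
      using near[OF that(1)] y(5) that(2) by (simp add: v_diff_commute[of p])
  qed (fact y(2))
qed

text \<open>The position relative to the points at distance less than \<open>k\<close> only depends on the ball of
  value \<open>k\<close> around \<open>x\<close>.\<close>

lemma candidate_same_position:
  assumes "finite P" "x \<notin> P" "v k = Some k" "c \<in> P" "le_inf lt0 (Some k) (v (c - x))"
  obtains y where "y \<in> candidates sc P {k}"
    and "\<forall>p\<in>P. o1.same_order (Some p) (Some x) (Some p) (Some y)"
    and "\<forall>a\<in>P. le_inf lt0 (v (x - a)) (Some k) \<longrightarrow> v (y - a) = v (x - a)"
proof -
  obtain y where y: "y \<in> candidates sc P {k}" "le_inf lt0 (Some k) (v (y - x))"
    and order: "\<And>p. p \<in> P \<Longrightarrow> le_inf lt0 (Some k) (v (p - x)) \<Longrightarrow>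
      o1.same_order (Some p) (Some x) (Some p) (Some y)"
    and val: "\<And>p. p \<in> P \<Longrightarrow> v (x - p) = Some k \<Longrightarrow> v (y - p) = Some k"
    by (rule ball_candidate[OF assms]) blast
  have far: "less_inf lt0 (v (x - p)) (v (y - x))" if "less_inf lt0 (v (x - p)) (Some k)" for p
    using that y(2) by (rule o0.ext.less_le_trans)
  show ?thesis
  proof (rule that[OF y(1)]; intro ballI impI)
    fix p assume p: "p \<in> P"
    show "o1.same_order (Some p) (Some x) (Some p) (Some y)"
    proof (cases "le_inf lt0 (Some k) (v (p - x))")
      case True
      then show ?thesis by (rule order[OF p])
    next
      case False
      then have "less_inf lt0 (v (x - p)) (Some k)"
        by (simp add: v_diff_commute[of x] o0.ext.not_le)
      then show ?thesis by (intro same_order_outside_ball far)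
    qed
    assume le: "le_inf lt0 (v (x - p)) (Some k)"
    show "v (y - p) = v (x - p)"
    proof (cases "v (x - p) = Some k")
      case True
      then show ?thesis using val[OF p] by simp
    next
      case False
      then have "less_inf lt0 (v (x - p)) (v (y - x))" using le by (intro far) auto
      from v_add_less[OF this] show ?thesis by simp
    qed
  qed
qed

lemma constrained_candidate:
  assumes "finite R" "finite \<Gamma>" "\<Gamma> \<noteq> {}" "x \<notin> R" and \<Gamma>: "\<forall>(a, h)\<in>\<Gamma>. v (x - a) = Some h"
  obtains y where "y \<in> candidates sc (R \<union> fst ` \<Gamma>) (snd ` \<Gamma>)"
    "\<forall>r\<in>R. o1.same_order (Some r) (Some x) (Some r) (Some y)" "\<forall>(a, h)\<in>\<Gamma>. v (y - a) = Some h"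
proof -
  let ?P = "R \<union> fst ` \<Gamma>" and ?k = "o0.Max (snd ` \<Gamma>)"
  have k: "?k \<in> snd ` \<Gamma>" and k_max: "\<And>a h. (a, h) \<in> \<Gamma> \<Longrightarrow> o0.le h ?k"
    using assms(2,3) by (simp_all add: rev_image_eqI)
  then obtain c where c: "(c, ?k) \<in> \<Gamma>" by auto
  then have "v (x - c) = Some ?k" using \<Gamma> by blast
  then have k_value: "v ?k = Some ?k" "le_inf lt0 (Some ?k) (v (c - x))"
    by (simp_all add: v_idem v_diff_commute[of c])
  have P: "finite ?P" "x \<notin> ?P" "c \<in> ?P" using assms(1,2,4) \<Gamma> c by force+
  obtain y where y: "y \<in> candidates sc ?P {?k}"
    "\<forall>p\<in>?P. o1.same_order (Some p) (Some x) (Some p) (Some y)"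
    "\<forall>a\<in>?P. le_inf lt0 (v (x - a)) (Some ?k) \<longrightarrow> v (y - a) = v (x - a)"
    by (rule candidate_same_position[OF P(1,2) k_value(1) P(3) k_value(2)])
  have "v (y - a) = Some h" if "(a, h) \<in> \<Gamma>" for a h
  proof -
    have "v (x - a) = Some h" "a \<in> ?P" using that \<Gamma> by force+
    moreover have "le_inf lt0 (Some h) (Some ?k)"
      using k_max[OF that] by (auto simp: le_inf_def o0.le_def)
    ultimately show ?thesis using y(3) by simp
  qed
  moreover have "y \<in> candidates sc ?P (snd ` \<Gamma>)"
    using y(1) k candidates_mono[of ?P ?P "{?k}" "snd ` \<Gamma>" sc] by blast
  ultimately show ?thesis using that y(2) by blast
qed

end

locale T_Ham_model = hamel_valuation sc lt0 lt1 v
  for sc :: "'c::linordered_field \<Rightarrow> 'g::ab_group_add \<Rightarrow> 'g"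
    and lt0 lt1 :: "'g \<Rightarrow> 'g \<Rightarrow> bool"
    and v :: "'g \<Rightarrow> 'g option" +
  assumes independent: "independent lt0 lt1" and dense: "dense_hamel lt0 v"
begin

lemma independent_finite:
  assumes "finite A0" "finite B0" "finite A1" "finite B1"
    and "\<forall>x\<in>A0. \<forall>y\<in>B0. lt0 x y" "\<forall>x\<in>A1. \<forall>y\<in>B1. lt1 x y"
  obtains z where "\<forall>x\<in>A0. lt0 x z" "\<forall>y\<in>B0. lt0 z y" "\<forall>x\<in>A1. lt1 x z" "\<forall>y\<in>B1. lt1 z y"
proof -
  obtain a0 where a0: "\<And>z. lower_ok lt0 a0 z \<Longrightarrow> \<forall>x\<in>A0. lt0 x z" "\<And>x. a0 = Some x \<Longrightarrow> x \<in> A0"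
    using o0.greatest_lower_bound_ok[OF assms(1)] by blast
  obtain b0 where b0: "\<And>z. upper_ok lt0 b0 z \<Longrightarrow> \<forall>x\<in>B0. lt0 z x" "\<And>x. b0 = Some x \<Longrightarrow> x \<in> B0"
    using o0.least_upper_bound_ok[OF assms(2)] by blast
  obtain a1 where a1: "\<And>z. lower_ok lt1 a1 z \<Longrightarrow> \<forall>x\<in>A1. lt1 x z" "\<And>x. a1 = Some x \<Longrightarrow> x \<in> A1"
    using o1.greatest_lower_bound_ok[OF assms(3)] by blast
  obtain b1 where b1: "\<And>z. upper_ok lt1 b1 z \<Longrightarrow> \<forall>x\<in>B1. lt1 z x" "\<And>x. b1 = Some x \<Longrightarrow> x \<in> B1"
    using o1.least_upper_bound_ok[OF assms(4)] by blast
  have "bounds_ok lt0 a0 b0" "bounds_ok lt1 a1 b1"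
    using a0(2) b0(2) a1(2) b1(2) assms(5,6) by (auto simp: bounds_ok_def split: option.splits)
  then obtain z where "lower_ok lt0 a0 z" "upper_ok lt0 b0 z" "lower_ok lt1 a1 z"
    "upper_ok lt1 b1 z"
    using independent unfolding independent_def by blast
  then show ?thesis using that a0(1) b0(1) a1(1) b1(1) by blast
qed

lemma value_between_finite:
  assumes "finite A" "finite B" "\<forall>x\<in>A. \<forall>y\<in>B. lt0 x y"
  obtains h where "v h = Some h" "\<forall>x\<in>A. lt0 x h" "\<forall>y\<in>B. lt0 h y"
proof -
  obtain x where x: "\<forall>a\<in>A. lt0 a x" "\<forall>b\<in>B. lt0 x b"
    using independent_finite[of A B "{}" "{}"] assms by auto
  obtain y where y: "lt0 x y" "\<forall>b\<in>B. lt0 y b"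
    using independent_finite[of "{x}" B "{}" "{}"] assms x by auto
  obtain c where c: "less_inf lt0 (Some x) (v c)" "less_inf lt0 (v c) (Some y)"
    using dense y(1) unfolding dense_hamel_def by blast
  then obtain h where h: "v c = Some h" by (cases "v c") auto
  then have "lt0 x h" "lt0 h y" using c by simp_all
  then show ?thesis using that[of h] v_idem[OF h] x y o0.less_trans by blast
qed

end

section \<open>Terms\<close>

declare eval.simps(5) [simp del]

lemma eval_Plus [simp]: "eval sc v e (Plus s t) = oplus (eval sc v e s) (eval sc v e t)"
  by (simp add: eval.simps(5) oplus_def)

lemma v_ext_simps [simp]: "v_ext v None = None" "v_ext v (Some x) = v x"
  by (simp_all add: v_ext_def)

primrec vars_trm :: "('c, 'u) trm \<Rightarrow> nat set" where
  "vars_trm (Var k) = {k}"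
| "vars_trm (Cst u) = {}"
| "vars_trm Zero = {}"
| "vars_trm Infty = {}"
| "vars_trm (Plus s t) = vars_trm s \<union> vars_trm t"
| "vars_trm (Scal c t) = vars_trm t"
| "vars_trm (Val t) = vars_trm t"

lemma finite_vars_trm: "finite (vars_trm t)"
  by (induction t) auto

lemma eval_cong: "(\<And>k. k \<in> vars_trm t \<Longrightarrow> e k = e' k) \<Longrightarrow> eval sc v e t = eval sc v e' t"
  by (induction t) auto

lemma eval_fresh: "j \<notin> vars_trm t \<Longrightarrow> eval sc v (e(j := w)) t = eval sc v e t"
  by (rule eval_cong) auto

primrec inst_trm ::
  "(nat \<Rightarrow> ('c, 'w) trm) \<Rightarrow> ('u \<Rightarrow> ('c, 'w) trm) \<Rightarrow> ('c, 'u) trm \<Rightarrow> ('c, 'w) trm" where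
  "inst_trm f g (Var k) = f k"
| "inst_trm f g (Cst u) = g u"
| "inst_trm f g Zero = Zero"
| "inst_trm f g Infty = Infty"
| "inst_trm f g (Plus s t) = Plus (inst_trm f g s) (inst_trm f g t)"
| "inst_trm f g (Scal c t) = Scal c (inst_trm f g t)"
| "inst_trm f g (Val t) = Val (inst_trm f g t)"

lemma params_inst_trm:
  "(\<And>k. params_trm (f k) \<subseteq> B) \<Longrightarrow> (\<And>u. u \<in> params_trm t \<Longrightarrow> params_trm (g u) \<subseteq> B) \<Longrightarrow>
    params_trm (inst_trm f g t) \<subseteq> B"
  by (induction t) auto

lemma vars_inst_trm:
  "(\<And>k. vars_trm (f k) \<subseteq> K) \<Longrightarrow> (\<And>u. vars_trm (g u) \<subseteq> K) \<Longrightarrow> vars_trm (inst_trm f g t) \<subseteq> K"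
  by (induction t) auto

lemma eval_inst_trm:
  "(\<And>u. u \<in> params_trm t \<Longrightarrow> eval sc v e (g u) = u) \<Longrightarrow>
    eval sc v e (inst_trm f g t) = eval sc v (\<lambda>k. eval sc v e (f k)) t"
  by (induction t) auto

primrec val_args :: "nat \<Rightarrow> ('c, 'u) trm \<Rightarrow> ('c, 'u) trm set" where
  "val_args k (Var i) = {}"
| "val_args k (Cst u) = {}"
| "val_args k Zero = {}"
| "val_args k Infty = {}"
| "val_args k (Plus s t) = val_args k s \<union> val_args k t"
| "val_args k (Scal c t) = val_args k t"
| "val_args k (Val t) = val_args k t \<union> (if k \<in> vars_trm t then {t} else {})"

lemma finite_val_args: "finite (val_args k t)"
  by (induction t) auto

lemma val_args_subterm:
  "u \<in> val_args k t \<Longrightarrow> vars_trm u \<subseteq> vars_trm t" "u \<in> val_args k t \<Longrightarrow> params_trm u \<subseteq> params_trm t"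
  by (induction t) (auto split: if_splits)

lemma innermost_val_arg:
  "val_args k t \<noteq> {} \<Longrightarrow> \<exists>u\<in>val_args k t. val_args k u = {}"
  by (induction t) (auto split: if_splits)

primrec abstract_val :: "('c, 'u) trm \<Rightarrow> nat \<Rightarrow> ('c, 'u) trm \<Rightarrow> ('c, 'u) trm" where
  "abstract_val u j (Var i) = Var i"
| "abstract_val u j (Cst w) = Cst w"
| "abstract_val u j Zero = Zero"
| "abstract_val u j Infty = Infty"
| "abstract_val u j (Plus s t) = Plus (abstract_val u j s) (abstract_val u j t)"
| "abstract_val u j (Scal c t) = Scal c (abstract_val u j t)"
| "abstract_val u j (Val t) = (if t = u then Var j else Val (abstract_val u j t))"

lemma params_abstract_val: "params_trm (abstract_val u j t) \<subseteq> params_trm t"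
  by (induction t) auto

lemma vars_abstract_val: "vars_trm (abstract_val u j t) \<subseteq> insert j (vars_trm t)"
  by (induction t) auto

lemma val_args_abstract_val:
  assumes "j \<noteq> k"
  shows "val_args k (abstract_val u j t) \<subseteq> abstract_val u j ` (val_args k t - {u})"
proof (induction t)
  case (Val t)
  have "k \<in> vars_trm t" if "k \<in> vars_trm (abstract_val u j t)"
    using that assms vars_abstract_val[of u j t] by blast
  then show ?case using Val by auto
qed auto

lemma card_val_args_abstract_val:
  assumes "finite T" "u \<in> \<Union> (val_args k ` T)" "j \<noteq> k"
  shows "card (\<Union> (val_args k ` abstract_val u j ` T)) < card (\<Union> (val_args k ` T))"
proof -
  let ?V = "\<Union> (val_args k ` T)"
  have finV: "finite ?V" using assms(1) by (simp add: finite_val_args)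
  have "\<Union> (val_args k ` abstract_val u j ` T) \<subseteq> abstract_val u j ` (?V - {u})"
    using val_args_abstract_val[OF assms(3)] by fastforce
  then have "card (\<Union> (val_args k ` abstract_val u j ` T)) \<le> card (?V - {u})"
    using finV by (meson card_image_le card_mono finite_Diff finite_imageI order_trans)
  also have "\<dots> < card ?V" using finV assms(2) by (rule card_Diff1_less)
  finally show ?thesis .
qed

lemma eval_abstract_val:
  "e j = eval sc v e (Val u) \<Longrightarrow> eval sc v e (abstract_val u j t) = eval sc v e t"
  by (induction t) auto

abbreviation (input) diff_trm ::
  "('c::linordered_field, 'u) trm \<Rightarrow> ('c, 'u) trm \<Rightarrow> ('c, 'u) trm" where
  "diff_trm s t \<equiv> Plus s (Scal (- 1) t)"

definition root_trm ::
  "'c::linordered_field \<Rightarrow> ('c, 'u) trm \<Rightarrow> 'c \<Rightarrow> ('c, 'u) trm \<Rightarrow> ('c, 'u) trm" where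
  "root_trm l s l' s' = Scal (1 / (l - l')) (diff_trm s' s)"

lemma eval_root_trm [simp]:
  "eval sc v e (root_trm l s l' s') = affine_root sc l (eval sc v e s) l' (eval sc v e s')"
  by (simp add: root_trm_def affine_root_def)

text \<open>The terms against which \<open>x\<close> must be compared to decide all atomic formulas between the affine
  terms \<open>l x + s\<close>, \<open>(l, s) \<in> L\<close>.\<close>

definition affine_base :: "('c::linordered_field \<times> ('c, 'u) trm) set \<Rightarrow> ('c, 'u) trm set" where
  "affine_base L = insert Infty (snd ` L \<union> (\<lambda>((l, s), (l', s')). root_trm l s l' s') ` (L \<times> L))"

lemma affine_base_memI:
  assumes "(l, s) \<in> L" "(l', s') \<in> L"
  shows "Infty \<in> affine_base L" "s \<in> affine_base L" "root_trm l s l' s' \<in> affine_base L"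
  using assms unfolding affine_base_def by force+

lemma finite_affine_base: "finite L \<Longrightarrow> finite (affine_base L)"
  by (simp add: affine_base_def)

lemma params_affine_base:
  assumes "\<forall>s\<in>snd ` L. params_trm s \<subseteq> A" "t \<in> affine_base L" shows "params_trm t \<subseteq> A"
  using assms unfolding affine_base_def root_trm_def by fastforce

context hamel_valuation
begin

abbreviation ev where "ev \<equiv> eval sc v"

abbreviation terms_over :: "'g option set \<Rightarrow> ('c, 'g option) trm set" where
  "terms_over A \<equiv> {t. params_trm t \<subseteq> A}"

definition same_orders :: "'g option \<Rightarrow> 'g option \<Rightarrow> 'g option \<Rightarrow> 'g option \<Rightarrow> bool" where
  "same_orders p q p' q' \<longleftrightarrow> o0.same_order p q p' q' \<and> o1.same_order p q p' q'"

lemma same_orders_commute: "same_orders p q p' q' \<longleftrightarrow> same_orders q p q' p'"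
  unfolding same_orders_def using o0.same_order_commute o1.same_order_commute by blast

lemma same_orders_sym: "same_orders p q p' q' \<longleftrightarrow> same_orders p' q' p q"
  unfolding same_orders_def using o0.same_order_sym o1.same_order_sym by blast

lemma same_orders_trans:
  "same_orders p q p' q' \<Longrightarrow> same_orders p' q' p'' q'' \<Longrightarrow> same_orders p q p'' q''"
  unfolding same_orders_def using o0.same_order_trans o1.same_order_trans by blast

lemma same_orders_refl: "same_orders p q p q"
  unfolding same_orders_def o0.same_order_def o1.same_order_def by simp

lemma same_orders_eq: "same_orders p q p' q' \<Longrightarrow> p = q \<longleftrightarrow> p' = q'"
  unfolding same_orders_def o0.same_order_def by blast

lemma same_orders_None:
  "p = None \<or> q = None \<Longrightarrow> p = None \<longleftrightarrow> p' = None \<Longrightarrow> q = None \<longleftrightarrow> q' = None \<Longrightarrow>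
    same_orders p q p' q'"
  by (simp add: same_orders_def o0.same_order_None o1.same_order_None)

lemma same_orders_between:
  "same_orders p q q r \<Longrightarrow> same_orders p d r d \<Longrightarrow> same_orders q d r d"
  unfolding same_orders_def by (meson o0.same_order_between o1.same_order_between)

lemma same_orders_add_iff:
  "same_orders (Some (a + x)) (Some (b + y)) (Some (a' + x)) (Some (b' + y)) \<longleftrightarrow>
    same_orders (Some (a - b)) (Some (y - x)) (Some (a' - b')) (Some (y - x))"
  unfolding same_orders_def o0.same_order_add_iff o1.same_order_add_iff ..

definition same_type ::
  "('c, 'g option) trm set \<Rightarrow> (nat \<Rightarrow> 'g option) \<Rightarrow> (nat \<Rightarrow> 'g option) \<Rightarrow> bool" where
  "same_type S e e' \<longleftrightarrow> (\<forall>s\<in>S. \<forall>t\<in>S. same_orders (ev e s) (ev e t) (ev e' s) (ev e' t))"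

lemma same_typeD:
  "same_type S e e' \<Longrightarrow> s \<in> S \<Longrightarrow> t \<in> S \<Longrightarrow> same_orders (ev e s) (ev e t) (ev e' s) (ev e' t)"
  unfolding same_type_def by blast

lemma same_type_mono: "same_type S e e' \<Longrightarrow> T \<subseteq> S \<Longrightarrow> same_type T e e'"
  unfolding same_type_def by blast

lemma same_type_sym: "same_type S e e' \<Longrightarrow> same_type S e' e"
  unfolding same_type_def using same_orders_sym by blast

lemma same_type_None_iff:
  "same_type S e e' \<Longrightarrow> Infty \<in> S \<Longrightarrow> s \<in> S \<Longrightarrow> ev e s = None \<longleftrightarrow> ev e' s = None"
  using same_orders_eq[OF same_typeD[of S e e' s Infty]] by simp

lemma same_type_transfer:
  assumes "same_type S f f'" "\<And>t. t \<in> T \<Longrightarrow> \<exists>s\<in>S. ev e t = ev f s \<and> ev e' t = ev f' s"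
  shows "same_type T e e'"
  unfolding same_type_def
proof (intro ballI)
  fix t t' assume "t \<in> T" "t' \<in> T"
  then obtain s s' where "s \<in> S" "ev e t = ev f s" "ev e' t = ev f' s"
    "s' \<in> S" "ev e t' = ev f s'" "ev e' t' = ev f' s'"
    using assms(2) by blast
  then show "same_orders (ev e t) (ev e t') (ev e' t) (ev e' t')"
    using same_typeD[OF assms(1)] by simp
qed

definition same_position ::
  "('c, 'g option) trm set \<Rightarrow> (nat \<Rightarrow> 'g option) \<Rightarrow> 'g \<Rightarrow> (nat \<Rightarrow> 'g option) \<Rightarrow> 'g \<Rightarrow> bool" where
  "same_position S e x e' x' \<longleftrightarrow>
    same_type S e e' \<and> (\<forall>w\<in>S. same_orders (ev e w) (Some x) (ev e' w) (Some x'))"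

lemma same_position_mono: "same_position S e x e' x' \<Longrightarrow> T \<subseteq> S \<Longrightarrow> same_position T e x e' x'"
  unfolding same_position_def using same_type_mono by blast

lemma same_position_member:
  assumes "same_type S e e'" "Infty \<in> S" "w \<in> S" "ev e w = Some x"
  obtains x' where "ev e' w = Some x'" "same_position S e x e' x'"
proof -
  obtain x' where x': "ev e' w = Some x'" using same_type_None_iff[OF assms(1-3)] assms(4) by auto
  have "same_orders (ev e s) (Some x) (ev e' s) (Some x')" if "s \<in> S" for s
    using same_typeD[OF assms(1) that assms(3)] assms(4) x' by simp
  then show ?thesis using that x' assms(1) unfolding same_position_def by blast
qed

lemma same_orders_affine:
  assumes "same_position (affine_base L) e x e' x'" "(l, s) \<in> L" "(l', s') \<in> L"
  shows "same_orders (affine sc l x (ev e s)) (affine sc l' x (ev e s'))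
    (affine sc l x' (ev e' s)) (affine sc l' x' (ev e' s'))"
proof -
  note base = affine_base_memI[OF assms(2,2)] affine_base_memI[OF assms(3,3)]
    affine_base_memI[OF assms(2,3)]
  have type: "same_type (affine_base L) e e'" using assms(1) by (simp add: same_position_def)
  have "same_orders (ev e (root_trm l s l' s')) (Some x) (ev e' (root_trm l s l' s')) (Some x')"
    using assms(1) base(9) unfolding same_position_def by blast
  then have "same_orders (Some x) (affine_root sc l (ev e s) l' (ev e s'))
      (Some x') (affine_root sc l (ev e' s) l' (ev e' s'))"
    by (simp add: same_orders_commute)
  then show ?thesis
    using same_type_None_iff[OF type base(1,2)] same_type_None_iff[OF type base(1,5)]
      same_typeD[OF type base(2,5)]
    unfolding same_orders_def by (intro conjI o0.same_order_affine o1.same_order_affine) blast+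
qed

lemma same_type_affine:
  assumes "same_position (affine_base L) e x e' x'"
    and "\<And>t. t \<in> T \<Longrightarrow>
        \<exists>(l, s)\<in>L. ev f t = affine sc l x (ev e s) \<and> ev f' t = affine sc l x' (ev e' s)"
  shows "same_type T f f'"
  unfolding same_type_def
proof (intro ballI)
  fix t t' assume "t \<in> T" "t' \<in> T"
  obtain l s where s: "(l, s) \<in> L" "ev f t = affine sc l x (ev e s)"
    "ev f' t = affine sc l x' (ev e' s)"
    using assms(2)[OF \<open>t \<in> T\<close>] by blast
  obtain l' s' where s': "(l', s') \<in> L" "ev f t' = affine sc l' x (ev e s')"
    "ev f' t' = affine sc l' x' (ev e' s')"
    using assms(2)[OF \<open>t' \<in> T\<close>] by blast
  show "same_orders (ev f t) (ev f t') (ev f' t) (ev f' t')"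
    unfolding s(2,3) s'(2,3) by (rule same_orders_affine[OF assms(1) s(1) s'(1)])
qed

lemma flat_trm_affine:
  fixes t :: "('c, 'g option) trm"
  assumes "val_args k t = {}"
  shows "\<exists>l s. params_trm s \<subseteq> params_trm t \<and> vars_trm s \<subseteq> vars_trm t \<and>
    (\<forall>e x. ev (e(k := Some x)) t = affine sc l x (ev e s))" (is "?flat t")
proof -
  have const: "?flat t" if "k \<notin> vars_trm t" for t
    using that by (intro exI[of _ 0] exI[of _ t]) (simp add: eval_fresh del: fun_upd_apply)
  show ?thesis using assms
  proof (induction t)
    case (Var i)
    show ?case
    proof (cases "i = k")
      case True
      then show ?thesis by (intro exI[of _ 1] exI[of _ Zero]) simp
    qed (rule const, simp)
  next
    case (Plus t1 t2)
    then have "?flat t1" "?flat t2" by simp_all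
    then obtain l s l' s' where
      "params_trm s \<subseteq> params_trm t1" "vars_trm s \<subseteq> vars_trm t1"
      "\<And>e x. ev (e(k := Some x)) t1 = affine sc l x (ev e s)"
      "params_trm s' \<subseteq> params_trm t2" "vars_trm s' \<subseteq> vars_trm t2"
      "\<And>e x. ev (e(k := Some x)) t2 = affine sc l' x (ev e s')"
      by blast
    then show ?case
      by (intro exI[of _ "l + l'"] exI[of _ "Plus s s'"])
        (auto simp: o0.oplus_affine simp del: fun_upd_apply)
  next
    case (Scal c t)
    then have "?flat t" by simp
    then obtain l s where
      "params_trm s \<subseteq> params_trm t" "vars_trm s \<subseteq> vars_trm t"
      "\<And>e x. ev (e(k := Some x)) t = affine sc l x (ev e s)"
      by blast
    then show ?case
      by (intro exI[of _ "c * l"] exI[of _ "Scal c s"])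
        (auto simp: o0.scale_affine simp del: fun_upd_apply)
  next
    case (Val t)
    then show ?case by (intro const) (simp split: if_splits)
  qed (rule const, simp)+
qed

text \<open>If \<open>Q e e'\<close> states that a formula has the same truth value at \<open>e\<close> and \<open>e'\<close>, this says that the
  formula is equivalent to a quantifier-free one over \<open>A\<close>.\<close>

definition forced_over ::
  "'g option set \<Rightarrow> ((nat \<Rightarrow> 'g option) \<Rightarrow> (nat \<Rightarrow> 'g option) \<Rightarrow> bool) \<Rightarrow> bool" where
  "forced_over A Q \<longleftrightarrow> (\<exists>S. finite S \<and> S \<subseteq> terms_over A \<and> (\<forall>e e'. same_type S e e' \<longrightarrow> Q e e'))"

lemma forced_overI:
  "finite S \<Longrightarrow> S \<subseteq> terms_over A \<Longrightarrow> (\<And>e e'. same_type S e e' \<Longrightarrow> Q e e') \<Longrightarrow> forced_over A Q"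
  unfolding forced_over_def by blast

lemma forced_overE:
  assumes "forced_over A Q"
  obtains S where "finite S" "S \<subseteq> terms_over A" "\<And>e e'. same_type S e e' \<Longrightarrow> Q e e'"
  using assms unfolding forced_over_def by blast

lemma forced_over_mono:
  "forced_over A P \<Longrightarrow> A \<subseteq> B \<Longrightarrow> (\<And>e e'. P e e' \<Longrightarrow> Q e e') \<Longrightarrow> forced_over B Q"
  unfolding forced_over_def by (metis (mono_tags, lifting) mem_Collect_eq subset_iff)

lemma forced_over_conj:
  assumes "forced_over A P" "forced_over A Q" shows "forced_over A (\<lambda>e e'. P e e' \<and> Q e e')"
proof -
  obtain S where S: "finite S" "S \<subseteq> terms_over A" "\<And>e e'. same_type S e e' \<Longrightarrow> P e e'"
    using assms(1) forced_overE by blast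
  obtain T where T: "finite T" "T \<subseteq> terms_over A" "\<And>e e'. same_type T e e' \<Longrightarrow> Q e e'"
    using assms(2) forced_overE by blast
  show ?thesis
  proof (rule forced_overI)
    show "finite (S \<union> T)" "S \<union> T \<subseteq> terms_over A" using S T by simp_all
    show "P e e' \<and> Q e e'" if "same_type (S \<union> T) e e'" for e e'
      using S(3) T(3) same_type_mono[OF that] by blast
  qed
qed

lemma forced_over_swap: "forced_over A Q \<Longrightarrow> forced_over A (\<lambda>e e'. Q e' e)"
  unfolding forced_over_def by (meson same_type_sym)

lemma forced_over_subst:
  assumes "forced_over A Q" "params_trm u \<subseteq> A"
  shows "forced_over A (\<lambda>e e'. Q (e(j := ev e u)) (e'(j := ev e' u)))"
proof -
  obtain S where S: "finite S" "S \<subseteq> terms_over A" "\<And>e e'. same_type S e e' \<Longrightarrow> Q e e'"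
    using assms(1) forced_overE by blast
  let ?subst = "inst_trm (Var(j := u)) Cst"
  have subst: "ev e (?subst t) = ev (e(j := ev e u)) t" for e and t :: "('c, 'g option) trm"
  proof -
    have "(\<lambda>k. ev e ((Var(j := u)) k)) = e(j := ev e u)" by auto
    then show ?thesis by (simp add: eval_inst_trm)
  qed
  show ?thesis
  proof (rule forced_overI)
    show "finite (?subst ` S)" using S(1) by simp
    have "params_trm (?subst t) \<subseteq> A" if "params_trm t \<subseteq> A" for t
      using that assms(2) by (intro params_inst_trm) auto
    then show "?subst ` S \<subseteq> terms_over A" using S(2) by blast
    show "Q (e(j := ev e u)) (e'(j := ev e' u))" if "same_type (?subst ` S) e e'" for e e'
    proof (intro S(3) same_type_transfer[OF that])
      fix t assume "t \<in> S"
      then show "\<exists>s\<in>?subst ` S. ev (e(j := ev e u)) t = ev e s \<and> ev (e'(j := ev e' u)) t = ev e' s"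
        by (intro bexI[of _ "?subst t"]) (simp_all only: subst imageI)
    qed
  qed
qed

end

section \<open>Extending maps that preserve finitely many comparisons\<close>

definition candidate_trms ::
  "('c::linordered_field, 'u) trm set \<Rightarrow> ('c, 'u) trm set \<Rightarrow> ('c, 'u) trm set" where
  "candidate_trms P G =
    (\<lambda>(p, q). Scal (1/2) (Plus p q)) ` (P \<times> P) \<union> (\<lambda>(p, g). Plus p g) ` (P \<times> G) \<union>
    (\<lambda>(p, g). diff_trm p g) ` (P \<times> G)"

lemma finite_candidate_trms: "finite P \<Longrightarrow> finite G \<Longrightarrow> finite (candidate_trms P G)"
  by (simp add: candidate_trms_def)

lemma params_candidate_trms:
  assumes "\<forall>s\<in>P \<union> G. params_trm s \<subseteq> A" "c \<in> candidate_trms P G" shows "params_trm c \<subseteq> A"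
  using assms unfolding candidate_trms_def by fastforce

context hamel_valuation
begin

definition finite_values :: "(nat \<Rightarrow> 'g option) \<Rightarrow> ('c, 'g option) trm set \<Rightarrow> 'g set" where
  "finite_values e S = {a. \<exists>s\<in>S. ev e s = Some a}"

lemma finite_finite_values: "finite S \<Longrightarrow> finite (finite_values e S)"
proof -
  assume "finite S"
  moreover have "finite_values e S \<subseteq> the ` ev e ` S" unfolding finite_values_def by force
  ultimately show ?thesis by (meson finite_imageI finite_subset)
qed

lemma candidates_eval:
  assumes "y \<in> candidates sc (finite_values e P) (finite_values e G)"
  shows "\<exists>c\<in>candidate_trms P G. ev e c = Some y"
proof -
  consider (mid) p q where "p \<in> finite_values e P" "q \<in> finite_values e P" "y = sc (1/2) (p + q)"
    | (add) p h where "p \<in> finite_values e P" "h \<in> finite_values e G" "y = p + h"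
    | (sub) p h where "p \<in> finite_values e P" "h \<in> finite_values e G" "y = p - h"
    using assms unfolding candidates_def by blast
  then show ?thesis
  proof cases
    case mid
    then obtain s t where "s \<in> P" "t \<in> P" "ev e s = Some p" "ev e t = Some q"
      by (auto simp: finite_values_def)
    then show ?thesis using mid(3)
      by (intro bexI[of _ "Scal (1/2) (Plus s t)"]) (auto simp: candidate_trms_def)
  next
    case add
    then obtain s t where "s \<in> P" "t \<in> G" "ev e s = Some p" "ev e t = Some h"
      by (auto simp: finite_values_def)
    then show ?thesis using add(3)
      by (intro bexI[of _ "Plus s t"]) (auto simp: candidate_trms_def)
  next
    case sub
    then obtain s t where "s \<in> P" "t \<in> G" "ev e s = Some p" "ev e t = Some h"
      by (auto simp: finite_values_def)
    then show ?thesis using sub(3)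
      by (intro bexI[of _ "diff_trm s t"]) (auto simp: candidate_trms_def)
  qed
qed

definition val_constraints ::
  "(('c, 'g option) trm \<times> ('c, 'g option) trm) set \<Rightarrow> (nat \<Rightarrow> 'g option) \<Rightarrow> 'g \<Rightarrow> bool" where
  "val_constraints \<Gamma> e x \<longleftrightarrow>
    (\<forall>(s, g)\<in>\<Gamma>. \<exists>a h. ev e s = Some a \<and> ev e g = Some h \<and> v (x - a) = Some h)"

lemma val_constraintsD:
  "val_constraints \<Gamma> e x \<Longrightarrow> (s, g) \<in> \<Gamma> \<Longrightarrow>
    \<exists>a h. ev e s = Some a \<and> ev e g = Some h \<and> v (x - a) = Some h"
  unfolding val_constraints_def by blast

lemma val_constraints_insert:
  "val_constraints (insert (s, g) \<Gamma>) e x \<longleftrightarrow>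
    (\<exists>a h. ev e s = Some a \<and> ev e g = Some h \<and> v (x - a) = Some h) \<and> val_constraints \<Gamma> e x"
  unfolding val_constraints_def by simp

lemma val_constraints_fresh:
  assumes "\<forall>(s, g)\<in>\<Gamma>. j \<notin> vars_trm s \<union> vars_trm g"
  shows "val_constraints \<Gamma> (e(j := w)) x \<longleftrightarrow> val_constraints \<Gamma> e x"
proof -
  have "ev (e(j := w)) s = ev e s" "ev (e(j := w)) g = ev e g" if "(s, g) \<in> \<Gamma>" for s g
    using assms that by (auto intro!: eval_fresh)
  then show ?thesis unfolding val_constraints_def by fastforce
qed

lemma val_constraints_trm:
  assumes "ev e c = Some x"
  shows "val_constraints \<Gamma> e x \<longleftrightarrow>
    (\<forall>(s, g)\<in>\<Gamma>. ev e (Val (diff_trm c s)) = ev e g \<and> ev e g \<noteq> None)"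
proof -
  have "(\<exists>a h. ev e s = Some a \<and> ev e g = Some h \<and> v (x - a) = Some h) \<longleftrightarrow>
    ev e (Val (diff_trm c s)) = ev e g \<and> ev e g \<noteq> None" for s g :: "('c, 'g option) trm"
    using assms by (cases "ev e s"; cases "ev e g") auto
  then show ?thesis unfolding val_constraints_def by (simp only: )
qed

lemma val_constraints_transfer:
  assumes type: "same_type F e e'" and "Infty \<in> F" "c \<in> F" "ev e c = Some y" "val_constraints \<Gamma> e y"
    and F: "\<forall>(s, g)\<in>\<Gamma>. Val (diff_trm c s) \<in> F \<and> g \<in> F"
  obtains y' where "ev e' c = Some y'" "val_constraints \<Gamma> e' y'"
proof -
  obtain y' where y': "ev e' c = Some y'" using same_type_None_iff[OF assms(1-3)] assms(4) by auto
  have "ev e' (Val (diff_trm c s)) = ev e' g \<and> ev e' g \<noteq> None" if "(s, g) \<in> \<Gamma>" for s g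
  proof -
    have sg: "Val (diff_trm c s) \<in> F" "g \<in> F" using F that by auto
    have "ev e (Val (diff_trm c s)) = ev e g \<and> ev e g \<noteq> None"
      using assms(5) that unfolding val_constraints_trm[OF assms(4)] by blast
    then show ?thesis
      using same_orders_eq[OF same_typeD[OF type sg]] same_type_None_iff[OF type \<open>Infty \<in> F\<close> sg(2)]
      by (simp only: simp_thms)
  qed
  then show ?thesis using that[OF y'] unfolding val_constraints_trm[OF y'] by blast
qed

lemma val_constraints_open:
  assumes "finite \<Gamma>" "val_constraints \<Gamma> e y"
  shows "\<exists>P Q. finite P \<and> finite Q \<and> (\<forall>p\<in>P. lt1 p y) \<and> (\<forall>q\<in>Q. lt1 y q) \<and>
    (\<forall>z. (\<forall>p\<in>P. lt1 p z) \<longrightarrow> (\<forall>q\<in>Q. lt1 z q) \<longrightarrow> val_constraints \<Gamma> e z)"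
  using assms
proof (induction \<Gamma> rule: finite_induct)
  case empty
  show ?case by (intro exI[of _ "{}"]) (simp add: val_constraints_def)
next
  case (insert g \<Gamma>)
  obtain s r where g: "g = (s, r)" by (cases g)
  obtain P Q where PQ: "finite P" "finite Q" "\<forall>p\<in>P. lt1 p y" "\<forall>q\<in>Q. lt1 y q"
    "\<And>z. \<forall>p\<in>P. lt1 p z \<Longrightarrow> \<forall>q\<in>Q. lt1 z q \<Longrightarrow> val_constraints \<Gamma> e z"
    using insert.IH insert.prems unfolding g val_constraints_insert by blast
  obtain a h where ah: "ev e s = Some a" "ev e r = Some h" "v (y - a) = Some h"
    using insert.prems unfolding g val_constraints_insert by blast
  obtain p q where "lt1 p y" "lt1 y q" "\<And>z. lt1 p z \<Longrightarrow> lt1 z q \<Longrightarrow> v (z - a) = Some h"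
    using v_eq_open[OF ah(3)] by blast
  then show ?case
    using PQ ah(1,2) unfolding g val_constraints_insert
    by (intro exI[of _ "insert p P"] exI[of _ "insert q Q"]) simp
qed

lemma constrained_candidate_trm:
  assumes "finite S" "finite \<Gamma>" "\<Gamma> \<noteq> {}" "val_constraints \<Gamma> e x" "x \<notin> finite_values e S"
  obtains c y where "c \<in> candidate_trms (S \<union> fst ` \<Gamma>) (snd ` \<Gamma>)" "ev e c = Some y"
    "val_constraints \<Gamma> e y" "\<forall>w\<in>S. o1.same_order (ev e w) (Some x) (ev e w) (Some y)"
proof -
  define \<Delta> where "\<Delta> = (\<lambda>(s, g). (the (ev e s), the (ev e g))) ` \<Gamma>"
  have \<Delta>: "\<exists>a h. ev e s = Some a \<and> ev e g = Some h \<and> (a, h) \<in> \<Delta> \<and> v (x - a) = Some h"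
    if "(s, g) \<in> \<Gamma>" for s g
    using val_constraintsD[OF assms(4) that] that unfolding \<Delta>_def by force
  have "a \<in> finite_values e (fst ` \<Gamma>) \<and> h \<in> finite_values e (snd ` \<Gamma>) \<and> v (x - a) = Some h"
    if ah: "(a, h) \<in> \<Delta>" for a h
  proof -
    obtain s g where "(s, g) \<in> \<Gamma>" "a = the (ev e s)" "h = the (ev e g)"
      using ah unfolding \<Delta>_def by auto
    then show ?thesis
      using val_constraintsD[OF assms(4)] unfolding finite_values_def by force
  qed
  then have "fst ` \<Delta> \<subseteq> finite_values e (fst ` \<Gamma>)" "snd ` \<Delta> \<subseteq> finite_values e (snd ` \<Gamma>)"
    and x: "\<forall>(a, h)\<in>\<Delta>. v (x - a) = Some h"
    by auto
  moreover have "finite \<Delta>" "\<Delta> \<noteq> {}" using assms(2,3) by (simp_all add: \<Delta>_def)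
  ultimately obtain y where y: "y \<in> candidates sc (finite_values e S \<union> fst ` \<Delta>) (snd ` \<Delta>)"
    "\<forall>r\<in>finite_values e S. o1.same_order (Some r) (Some x) (Some r) (Some y)"
    "\<forall>(a, h)\<in>\<Delta>. v (y - a) = Some h"
    using constrained_candidate[OF finite_finite_values[OF assms(1)] _ _ assms(5)] by blast
  have "finite_values e S \<union> fst ` \<Delta> \<subseteq> finite_values e (S \<union> fst ` \<Gamma>)"
    using \<open>fst ` \<Delta> \<subseteq> _\<close> unfolding finite_values_def by blast
  then have "y \<in> candidates sc (finite_values e (S \<union> fst ` \<Gamma>)) (finite_values e (snd ` \<Gamma>))"
    using y(1) candidates_mono \<open>snd ` \<Delta> \<subseteq> _\<close> by blast
  then obtain c where "c \<in> candidate_trms (S \<union> fst ` \<Gamma>) (snd ` \<Gamma>)" "ev e c = Some y"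
    using candidates_eval by blast
  moreover have "val_constraints \<Gamma> e y"
    unfolding val_constraints_def using \<Delta> y(3) by fastforce
  moreover have "o1.same_order (ev e w) (Some x) (ev e w) (Some y)" if "w \<in> S" for w
  proof (cases "ev e w")
    case None
    then show ?thesis by (simp add: o1.same_order_def)
  next
    case (Some r)
    then show ?thesis using y(2) that by (auto simp: finite_values_def)
  qed
  ultimately show ?thesis using that by blast
qed

end

context T_Ham_model
begin

lemma value_fill:
  assumes "finite S" "same_type S e e'" "Infty \<in> S" "h \<notin> finite_values e S"
  obtains h' where "v h' = Some h'" "\<forall>w\<in>S. o0.same_order (ev e w) (Some h) (ev e' w) (Some h')"
proof -
  let ?L = "lower_image lt0 S (ev e) h (ev e')" and ?U = "upper_image lt0 S (ev e) h (ev e')"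
  have "\<forall>s\<in>S. \<forall>t\<in>S. o0.same_order (ev e s) (ev e t) (ev e' s) (ev e' t)"
    using assms(2) unfolding same_type_def same_orders_def by blast
  then have "\<forall>x\<in>?L. \<forall>y\<in>?U. lt0 x y" using o0.lower_image_less_upper_image by blast
  then obtain h' where h': "v h' = Some h'" "\<forall>x\<in>?L. lt0 x h'" "\<forall>y\<in>?U. lt0 h' y"
    using value_between_finite[OF finite_image_cut[OF assms(1)]] by blast
  have "o0.same_order (ev e w) (Some h) (ev e' w) (Some h')" if "w \<in> S" for w
    using that assms(4) same_type_None_iff[OF assms(2,3) that] h'(2,3)
    by (intro o0.same_order_cut) (auto simp: finite_values_def)
  then show ?thesis using that h'(1) by blast
qed

lemma constrained_fill:
  assumes "finite S" "same_type S e e'" "Infty \<in> S" "x \<notin> finite_values e S"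
    and "finite \<Gamma>" "val_constraints \<Gamma> e' y" "y \<notin> finite_values e' S"
  obtains z where "val_constraints \<Gamma> e' z"
    "\<forall>w\<in>S. o0.same_order (ev e w) (Some x) (ev e' w) (Some z)"
    "\<forall>w\<in>S. o1.same_order (ev e' w) (Some y) (ev e' w) (Some z)"
proof -
  obtain P Q where PQ: "finite P" "finite Q" "\<forall>p\<in>P. lt1 p y" "\<forall>q\<in>Q. lt1 y q"
    "\<And>z. \<forall>p\<in>P. lt1 p z \<Longrightarrow> \<forall>q\<in>Q. lt1 z q \<Longrightarrow> val_constraints \<Gamma> e' z"
    using val_constraints_open[OF assms(5,6)] by blast
  let ?L0 = "lower_image lt0 S (ev e) x (ev e')" and ?U0 = "upper_image lt0 S (ev e) x (ev e')"
  let ?L1 = "lower_image lt1 S (ev e') y (ev e')" and ?U1 = "upper_image lt1 S (ev e') y (ev e')"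
  have "\<forall>s\<in>S. \<forall>t\<in>S. o0.same_order (ev e s) (ev e t) (ev e' s) (ev e' t)"
    using assms(2) unfolding same_type_def same_orders_def by blast
  then have cut0: "\<forall>x\<in>?L0. \<forall>y\<in>?U0. lt0 x y" using o0.lower_image_less_upper_image by blast
  have "\<forall>p\<in>?L1 \<union> P. lt1 p y" "\<forall>q\<in>?U1 \<union> Q. lt1 y q"
    using PQ(3,4) by (auto simp: lower_image_def upper_image_def)
  then have cut1: "\<forall>p\<in>?L1 \<union> P. \<forall>q\<in>?U1 \<union> Q. lt1 p q" using o1.less_trans by blast
  obtain z where z: "\<forall>x\<in>?L0. lt0 x z" "\<forall>x\<in>?U0. lt0 z x" "\<forall>x\<in>?L1 \<union> P. lt1 x z" "\<forall>x\<in>?U1 \<union> Q. lt1 z x"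
    using independent_finite[OF _ _ _ _ cut0 cut1] finite_image_cut[OF assms(1)] PQ(1,2)
    by (metis finite_Un)
  have "o0.same_order (ev e w) (Some x) (ev e' w) (Some z)" if "w \<in> S" for w
    using that assms(4) same_type_None_iff[OF assms(2,3) that] z(1,2)
    by (intro o0.same_order_cut) (auto simp: finite_values_def)
  moreover have "o1.same_order (ev e' w) (Some y) (ev e' w) (Some z)" if "w \<in> S" for w
    using that assms(7) z(3,4) by (intro o1.same_order_cut) (auto simp: finite_values_def)
  ultimately show ?thesis using that PQ(5) z(3,4) by blast
qed

end

definition constraint_base ::
  "('c::linordered_field, 'u) trm set \<Rightarrow> (('c, 'u) trm \<times> ('c, 'u) trm) set \<Rightarrow> ('c, 'u) trm set" where
  "constraint_base S \<Gamma> = (let C = S \<union> candidate_trms (S \<union> fst ` \<Gamma>) (snd ` \<Gamma>) in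
    insert Infty (C \<union> snd ` \<Gamma> \<union> {Val (diff_trm c s) |c s. c \<in> C \<and> s \<in> fst ` \<Gamma>}))"

lemma finite_constraint_base: "finite S \<Longrightarrow> finite \<Gamma> \<Longrightarrow> finite (constraint_base S \<Gamma>)"
  by (simp add: constraint_base_def Let_def finite_candidate_trms finite_image_set2)

lemma params_constraint_base:
  assumes "\<forall>s\<in>S \<union> fst ` \<Gamma> \<union> snd ` \<Gamma>. params_trm s \<subseteq> A" "t \<in> constraint_base S \<Gamma>"
  shows "params_trm t \<subseteq> A"
proof -
  have C: "params_trm c \<subseteq> A" if "c \<in> S \<union> candidate_trms (S \<union> fst ` \<Gamma>) (snd ` \<Gamma>)" for c
    using that params_candidate_trms[OF assms(1)] assms(1) by blast
  consider "t = Infty" | "t \<in> S \<union> candidate_trms (S \<union> fst ` \<Gamma>) (snd ` \<Gamma>)" | "t \<in> snd ` \<Gamma>"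
    | (shift) c s where "t = Val (diff_trm c s)" "s \<in> fst ` \<Gamma>"
      "c \<in> S \<union> candidate_trms (S \<union> fst ` \<Gamma>) (snd ` \<Gamma>)"
    using assms(2) unfolding constraint_base_def Let_def by blast
  then show ?thesis
  proof cases
    case shift
    then show ?thesis using C[OF shift(3)] assms(1) by simp
  qed (use C assms(1) in simp_all)
qed

context hamel_valuation
begin

lemma same_position_value:
  assumes h: "v h = Some h" "v h' = Some h'"
    and type: "same_type (insert Zero (insert Infty (S \<union> Val ` S))) e e'"
    and cut: "\<forall>w\<in>S \<union> Val ` S. o0.same_order (ev e w) (Some h) (ev e' w) (Some h')"
  shows "same_position S e h e' h'"
proof -
  have "o1.same_order (ev e w) (Some h) (ev e' w) (Some h')" if w: "w \<in> S" for w
  proof (cases "ev e w")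
    case None
    then have "ev e' w = None" using same_type_None_iff[OF type, of w] w by simp
    then show ?thesis using None by (simp add: o1.same_order_def)
  next
    case (Some r)
    then obtain r' where r': "ev e' w = Some r'" using same_type_None_iff[OF type, of w] w by auto
    have "o0.same_order (v r) (Some h) (v r') (Some h')"
      using bspec[OF cut, of "Val w"] w Some r' by simp
    moreover have "same_orders (Some 0) (Some r) (Some 0) (Some r')"
      "same_orders (v r) (Some r) (v r') (Some r')"
      using same_typeD[OF type, of Zero w] same_typeD[OF type, of "Val w" w] w Some r' by simp_all
    ultimately have "o1.same_order (Some h) (Some r) (Some h') (Some r')"
      using h same_order_value unfolding same_orders_def by blast
    then show ?thesis using Some r' by (simp add: o1.same_order_commute)
  qed
  moreover have "same_type S e e'" using type by (rule same_type_mono) blast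
  ultimately show ?thesis
    using cut unfolding same_position_def same_orders_def by blast
qed

lemma val_constraints_transfer_base:
  assumes "same_type (constraint_base S \<Gamma>) e e'"
    and "c \<in> S \<union> candidate_trms (S \<union> fst ` \<Gamma>) (snd ` \<Gamma>)" "ev e c = Some y" "val_constraints \<Gamma> e y"
  obtains y' where "ev e' c = Some y'" "val_constraints \<Gamma> e' y'"
proof (rule val_constraints_transfer[OF assms(1) _ _ assms(3,4)])
  show "Infty \<in> constraint_base S \<Gamma>" "c \<in> constraint_base S \<Gamma>"
    using assms(2) by (auto simp: constraint_base_def Let_def)
  show "\<forall>(s, g)\<in>\<Gamma>. Val (diff_trm c s) \<in> constraint_base S \<Gamma> \<and> g \<in> constraint_base S \<Gamma>"
    using assms(2) unfolding constraint_base_def Let_def by force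
qed (rule that)

end

context T_Ham_model
begin

lemma forced_over_value_position:
  assumes "finite S" "S \<subseteq> terms_over A"
  shows "forced_over A (\<lambda>e e'. \<forall>h. v h = Some h \<longrightarrow>
    (\<exists>h'. v h' = Some h' \<and> same_position S e h e' h'))"
proof (rule forced_overI)
  let ?S = "insert Infty (S \<union> Val ` S)" let ?F = "insert Zero (?S \<union> Val ` ?S)"
  show "finite ?F" using assms(1) by simp
  show "?F \<subseteq> terms_over A" using assms(2) by fastforce
  fix e e' assume F: "same_type ?F e e'"
  have S: "same_type ?S e e'" "same_type (insert Zero ?S) e e'"
    by (rule same_type_mono[OF F]; blast)+
  have finS: "finite ?S" using assms(1) by simp
  show "\<forall>h. v h = Some h \<longrightarrow> (\<exists>h'. v h' = Some h' \<and> same_position S e h e' h')"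
  proof (intro allI impI)
    fix h assume h: "v h = Some h"
    show "\<exists>h'. v h' = Some h' \<and> same_position S e h e' h'"
    proof (cases "h \<in> finite_values e ?S")
      case True
      then obtain w where w: "w \<in> ?S" "ev e w = Some h" by (auto simp: finite_values_def)
      then obtain h' where h': "ev e' w = Some h'" "same_position ?S e h e' h'"
        using same_position_member[OF S(1)] by blast
      have "ev e (Val w) = ev e w \<longleftrightarrow> ev e' (Val w) = ev e' w"
        using w(1) by (intro same_orders_eq[OF same_typeD[OF F]]) auto
      then have "v h' = Some h'" using w(2) h'(1) h by simp
      moreover have "same_position S e h e' h'" using h'(2) by (rule same_position_mono) blast
      ultimately show ?thesis by blast
    next
      case False
      then obtain h' where h': "v h' = Some h'"
        "\<forall>w\<in>?S. o0.same_order (ev e w) (Some h) (ev e' w) (Some h')"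
        using value_fill[OF finS S(1)] by blast
      then show ?thesis using same_position_value[OF h h'(1) S(2)] by blast
    qed
  qed
qed

lemma constrained_position_exists:
  assumes "finite S" "finite \<Gamma>" "\<Gamma> \<noteq> {}" and type: "same_type (constraint_base S \<Gamma>) e e'"
    and x: "val_constraints \<Gamma> e x" "x \<notin> finite_values e S"
  shows "\<exists>x'. val_constraints \<Gamma> e' x' \<and> same_position S e x e' x'"
proof -
  have S_type: "same_type (insert Infty S) e e'"
    by (rule same_type_mono[OF type]) (auto simp: constraint_base_def Let_def)
  obtain c y where c: "c \<in> candidate_trms (S \<union> fst ` \<Gamma>) (snd ` \<Gamma>)" "ev e c = Some y"
    "val_constraints \<Gamma> e y"
    and xy: "\<forall>w\<in>S. o1.same_order (ev e w) (Some x) (ev e w) (Some y)"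
    using constrained_candidate_trm[OF assms(1-3) x] by blast
  obtain y' where y': "ev e' c = Some y'" "val_constraints \<Gamma> e' y'"
    using val_constraints_transfer_base[OF type _ c(2,3)] c(1) by blast
  have yy': "same_orders (ev e w) (Some y) (ev e' w) (Some y')" if "w \<in> S" for w
    using same_typeD[OF type, of w c] that c(1,2) y'(1) by (auto simp: constraint_base_def Let_def)
  have "ev e w \<noteq> Some x" if "w \<in> S" for w using x(2) that by (auto simp: finite_values_def)
  then have "ev e' w \<noteq> Some y'" if "w \<in> S" for w
    using that xy same_orders_eq[OF yy'] unfolding o1.same_order_def by blast
  then have fresh: "x \<notin> finite_values e (insert Infty S)" "y' \<notin> finite_values e' (insert Infty S)"
    using x(2) by (auto simp: finite_values_def)
  have "finite (insert Infty S)" using assms(1) by simp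
  then obtain z where z: "val_constraints \<Gamma> e' z"
    "\<forall>w\<in>insert Infty S. o0.same_order (ev e w) (Some x) (ev e' w) (Some z)"
    "\<forall>w\<in>insert Infty S. o1.same_order (ev e' w) (Some y') (ev e' w) (Some z)"
    using constrained_fill[OF _ S_type insertI1 fresh(1) assms(2) y'(2) fresh(2)] by blast
  have "o1.same_order (ev e w) (Some x) (ev e' w) (Some z)" if "w \<in> S" for w
    using xy yy'[OF that] z(3) that o1.same_order_trans unfolding same_orders_def
    by (meson insertI2)
  moreover have "same_type S e e'" using S_type by (rule same_type_mono) blast
  ultimately have "same_position S e x e' z"
    using z(2) unfolding same_position_def same_orders_def by blast
  then show ?thesis using z(1) by blast
qed

lemma forced_over_constrained_position:
  assumes "finite S" "S \<subseteq> terms_over A"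
    and \<Gamma>: "finite \<Gamma>" "\<Gamma> \<noteq> {}" "\<Gamma> \<subseteq> terms_over A \<times> terms_over A"
  shows "forced_over A (\<lambda>e e'. \<forall>x. val_constraints \<Gamma> e x \<longrightarrow>
    (\<exists>x'. val_constraints \<Gamma> e' x' \<and> same_position S e x e' x'))"
proof (rule forced_overI)
  show "finite (constraint_base S \<Gamma>)" using assms(1) \<Gamma>(1) by (rule finite_constraint_base)
  have "\<forall>s\<in>S \<union> fst ` \<Gamma> \<union> snd ` \<Gamma>. params_trm s \<subseteq> A" using assms(2) \<Gamma>(3) by fastforce
  then show "constraint_base S \<Gamma> \<subseteq> terms_over A" using params_constraint_base by blast
  fix e e' assume type: "same_type (constraint_base S \<Gamma>) e e'"
  show "\<forall>x. val_constraints \<Gamma> e x \<longrightarrow> (\<exists>x'. val_constraints \<Gamma> e' x' \<and> same_position S e x e' x')"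
  proof (intro allI impI)
    fix x assume x: "val_constraints \<Gamma> e x"
    show "\<exists>x'. val_constraints \<Gamma> e' x' \<and> same_position S e x e' x'"
    proof (cases "x \<in> finite_values e S")
      case True
      then obtain w where w: "w \<in> S" "ev e w = Some x" by (auto simp: finite_values_def)
      obtain x' where x': "ev e' w = Some x'" "val_constraints \<Gamma> e' x'"
        using val_constraints_transfer_base[OF type _ w(2) x] w(1) by blast
      have "same_type (insert Infty S) e e'"
        by (rule same_type_mono[OF type]) (auto simp: constraint_base_def Let_def)
      then have "same_position (insert Infty S) e x e' x'"
        using same_position_member[of "insert Infty S" e e' w x] w x'(1) by auto
      then show ?thesis using x'(2) same_position_mono by blast
    next
      case False
      then show ?thesis using constrained_position_exists assms(1) \<Gamma>(1,2) type x by blast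
    qed
  qed
qed

end

context hamel_valuation
begin

text \<open>For an element \<open>h\<close> of the value set, \<open>v (l h + s)\<close> is decided by comparing \<open>h\<close> with \<open>v s\<close>.\<close>

lemma val_affine_cases:
  assumes h: "v h = Some h" "v h' = Some h'"
    and pos: "same_position {Infty, s, Val s} e h e' h'"
  shows "\<exists>(m, u)\<in>{(1, Zero), (0, Infty), (0, Val s), (0, Val (Plus (Scal l (Val s)) s))}.
    v_ext v (affine sc l h (ev e s)) = affine sc m h (ev e u) \<and>
    v_ext v (affine sc l h' (ev e' s)) = affine sc m h' (ev e' u)"
proof -
  have none_iff: "ev e s = None \<longleftrightarrow> ev e' s = None"
    using same_type_None_iff[of "{Infty, s, Val s}" e e' s] pos by (simp add: same_position_def)
  consider (zero) "l = 0" | (none) "ev e s = None" | (some) a where "l \<noteq> 0" "ev e s = Some a"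
    by auto
  then show ?thesis
  proof cases
    case zero
    then show ?thesis by simp
  next
    case none
    then show ?thesis using none_iff by simp
  next
    case some
    then obtain a' where a': "ev e' s = Some a'" using none_iff by auto
    have "o0.same_order (v a) (Some h) (v a') (Some h')"
      using pos some(2) a' by (simp add: same_position_def same_orders_def)
    then show ?thesis
    proof (cases rule: o0.same_order_cases)
      case eq
      then show ?thesis using some(2) a' by simp
    next
      case less
      then have "v (sc l h + a) = v a" "v (sc l h' + a') = v a'"
        using v_affine_value(1) h some(1) by blast+
      then show ?thesis using some(2) a' by simp
    next
      case greater
      then have "v (sc l h + a) = Some h" "v (sc l h' + a') = Some h'"
        using v_affine_value(2) h some(1) by blast+
      then show ?thesis using some(2) a' by simp
    qed
  qed
qed

definition affine_pieces ::
  "('c, 'g option) trm set \<Rightarrow> ('c \<times> ('c, 'g option) trm) set \<Rightarrow> nat \<Rightarrow> ('c, 'g option) trm \<Rightarrow>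
    bool" where
  "affine_pieces S L j t \<longleftrightarrow>
    (\<forall>e h e' h'. v h = Some h \<longrightarrow> v h' = Some h' \<longrightarrow> same_position S e h e' h' \<longrightarrow>
      (\<exists>(l, s)\<in>L. ev (e(j := Some h)) t = affine sc l h (ev e s) \<and>
        ev (e'(j := Some h')) t = affine sc l h' (ev e' s)))"

lemma affine_piecesI:
  assumes "\<And>e h e' h'. v h = Some h \<Longrightarrow> v h' = Some h' \<Longrightarrow> same_position S e h e' h' \<Longrightarrow>
    \<exists>l s. (l, s) \<in> L \<and> ev (e(j := Some h)) t = affine sc l h (ev e s) \<and>
      ev (e'(j := Some h')) t = affine sc l h' (ev e' s)"
  shows "affine_pieces S L j t"
  unfolding affine_pieces_def
proof (intro allI impI)
  fix e h e' h' assume "v h = Some h" "v h' = Some h'" "same_position S e h e' h'"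
  from assms[OF this] show "\<exists>(l, s)\<in>L. ev (e(j := Some h)) t = affine sc l h (ev e s) \<and>
      ev (e'(j := Some h')) t = affine sc l h' (ev e' s)" by blast
qed

lemma affine_piecesE:
  assumes "affine_pieces S L j t" "v h = Some h" "v h' = Some h'" "same_position S e h e' h'"
  obtains l s where "(l, s) \<in> L" "ev (e(j := Some h)) t = affine sc l h (ev e s)"
    "ev (e'(j := Some h')) t = affine sc l h' (ev e' s)"
  using assms(1)[unfolded affine_pieces_def, rule_format, OF assms(2-4)] by blast

definition piecewise_affine :: "'g option set \<Rightarrow> nat \<Rightarrow> ('c, 'g option) trm \<Rightarrow> bool" where
  "piecewise_affine A j t \<longleftrightarrow>
    (\<exists>S L. finite S \<and> finite L \<and> S \<union> snd ` L \<subseteq> terms_over A \<and> affine_pieces S L j t)"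

lemma piecewise_affineE:
  assumes "piecewise_affine A j t"
  obtains S L where "finite S" "finite L" "S \<union> snd ` L \<subseteq> terms_over A" "affine_pieces S L j t"
  using assms unfolding piecewise_affine_def by (elim exE conjE)

lemma piecewise_affine_flat:
  assumes "val_args j t = {}" "params_trm t \<subseteq> A" shows "piecewise_affine A j t"
proof -
  obtain l s where s: "params_trm s \<subseteq> params_trm t"
    "\<And>e x. ev (e(j := Some x)) t = affine sc l x (ev e s)"
    using flat_trm_affine[OF assms(1)] by blast
  have "affine_pieces {} {(l, s)} j t"
    by (intro affine_piecesI exI[of _ l] exI[of _ s]) (simp only: s(2) insertI1 simp_thms)
  then show ?thesis using s(1) assms(2) unfolding piecewise_affine_def
    by (intro exI[of _ "{}"] exI[of _ "{(l, s)}"]) auto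
qed

lemma piecewise_affine_Plus:
  assumes "piecewise_affine A j t1" "piecewise_affine A j t2"
  shows "piecewise_affine A j (Plus t1 t2)"
proof -
  obtain S1 L1 where t1: "finite S1" "finite L1" "S1 \<union> snd ` L1 \<subseteq> terms_over A"
    "affine_pieces S1 L1 j t1"
    using assms(1) by (rule piecewise_affineE)
  obtain S2 L2 where t2: "finite S2" "finite L2" "S2 \<union> snd ` L2 \<subseteq> terms_over A"
    "affine_pieces S2 L2 j t2"
    using assms(2) by (rule piecewise_affineE)
  let ?L = "(\<lambda>((l, s), (l', s')). (l + l', Plus s s')) ` (L1 \<times> L2)"
  have "affine_pieces (S1 \<union> S2) ?L j (Plus t1 t2)"
  proof (rule affine_piecesI)
    fix e h e' h' assume h: "v h = Some h" "v h' = Some h'"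
      and pos: "same_position (S1 \<union> S2) e h e' h'"
    obtain l s where ls: "(l, s) \<in> L1"
      "ev (e(j := Some h)) t1 = affine sc l h (ev e s)"
      "ev (e'(j := Some h')) t1 = affine sc l h' (ev e' s)"
      using affine_piecesE[OF t1(4) h same_position_mono[OF pos]] by blast
    obtain l' s' where ls': "(l', s') \<in> L2"
      "ev (e(j := Some h)) t2 = affine sc l' h (ev e s')"
      "ev (e'(j := Some h')) t2 = affine sc l' h' (ev e' s')"
      using affine_piecesE[OF t2(4) h same_position_mono[OF pos]] by blast
    have "(l + l', Plus s s') \<in> ?L" using ls(1) ls'(1) by force
    then show "\<exists>l s. (l, s) \<in> ?L \<and> ev (e(j := Some h)) (Plus t1 t2) = affine sc l h (ev e s) \<and>
        ev (e'(j := Some h')) (Plus t1 t2) = affine sc l h' (ev e' s)"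
      by (intro exI[of _ "l + l'"] exI[of _ "Plus s s'"])
        (simp only: eval_Plus ls(2,3) ls'(2,3) o0.oplus_affine simp_thms)
  qed
  moreover have "snd ` ?L \<subseteq> terms_over A" using t1(3) t2(3) by fastforce
  ultimately show ?thesis using t1 t2 unfolding piecewise_affine_def
    by (intro exI[of _ "S1 \<union> S2"] exI[of _ ?L]) simp
qed

lemma piecewise_affine_Scal:
  assumes "piecewise_affine A j t" shows "piecewise_affine A j (Scal c t)"
proof -
  obtain S L where fin: "finite S" "finite L" and over: "S \<union> snd ` L \<subseteq> terms_over A"
    and pieces: "affine_pieces S L j t"
    using assms by (rule piecewise_affineE)
  let ?L = "(\<lambda>(l, s). (c * l, Scal c s)) ` L"
  have "affine_pieces S ?L j (Scal c t)"
  proof (rule affine_piecesI)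
    fix e h e' h' assume h: "v h = Some h" "v h' = Some h'" and pos: "same_position S e h e' h'"
    obtain l s where ls: "(l, s) \<in> L"
      "ev (e(j := Some h)) t = affine sc l h (ev e s)"
      "ev (e'(j := Some h')) t = affine sc l h' (ev e' s)"
      using affine_piecesE[OF pieces h pos] by blast
    have "(c * l, Scal c s) \<in> ?L" using ls(1) by force
    then show "\<exists>l s. (l, s) \<in> ?L \<and> ev (e(j := Some h)) (Scal c t) = affine sc l h (ev e s) \<and>
        ev (e'(j := Some h')) (Scal c t) = affine sc l h' (ev e' s)"
      by (intro exI[of _ "c * l"] exI[of _ "Scal c s"])
        (simp only: eval.simps ls(2,3) o0.scale_affine simp_thms)
  qed
  moreover have "snd ` ?L \<subseteq> terms_over A" using over by fastforce
  ultimately show ?thesis using fin over unfolding piecewise_affine_def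
    by (intro exI[of _ S] exI[of _ ?L]) simp
qed

lemma piecewise_affine_Val:
  assumes "piecewise_affine A j t" shows "piecewise_affine A j (Val t)"
proof -
  obtain S L where fin: "finite S" "finite L" and over: "S \<union> snd ` L \<subseteq> terms_over A"
    and pieces: "affine_pieces S L j t"
    using assms by (rule piecewise_affineE)
  let ?S = "insert Infty (S \<union> snd ` L \<union> Val ` snd ` L)"
  let ?L = "\<Union>(l, s)\<in>L. {(1, Zero), (0, Infty), (0, Val s), (0, Val (Plus (Scal l (Val s)) s))}"
  have "affine_pieces ?S ?L j (Val t)"
  proof (rule affine_piecesI)
    fix e h e' h' assume h: "v h = Some h" "v h' = Some h'" and pos: "same_position ?S e h e' h'"
    have "same_position S e h e' h'" using pos by (rule same_position_mono) blast
    then obtain l s where ls: "(l, s) \<in> L"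
      "ev (e(j := Some h)) t = affine sc l h (ev e s)"
      "ev (e'(j := Some h')) t = affine sc l h' (ev e' s)"
      using affine_piecesE[OF pieces h] by blast
    have "s \<in> snd ` L" using ls(1) by force
    then have "same_position {Infty, s, Val s} e h e' h'"
      by (intro same_position_mono[OF pos]) simp
    from val_affine_cases[OF h this, of l]
    obtain m u where mu:
      "(m, u) \<in> {(1, Zero), (0, Infty), (0, Val s), (0, Val (Plus (Scal l (Val s)) s))}"
      "v_ext v (affine sc l h (ev e s)) = affine sc m h (ev e u)"
      "v_ext v (affine sc l h' (ev e' s)) = affine sc m h' (ev e' u)" by blast
    have "(m, u) \<in> ?L" using ls(1) mu(1) by blast
    then show "\<exists>l s. (l, s) \<in> ?L \<and> ev (e(j := Some h)) (Val t) = affine sc l h (ev e s) \<and>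
        ev (e'(j := Some h')) (Val t) = affine sc l h' (ev e' s)"
      by (intro exI[of _ m] exI[of _ u]) (simp only: eval.simps ls(2,3) mu(2,3) simp_thms)
  qed
  moreover have "finite ?S" "finite ?L" using fin by auto
  moreover have "?S \<union> snd ` ?L \<subseteq> terms_over A" using over by fastforce
  ultimately show ?thesis unfolding piecewise_affine_def by blast
qed

lemma piecewise_affine: "params_trm t \<subseteq> A \<Longrightarrow> piecewise_affine A j t"
  by (induction t)
    (simp_all add: piecewise_affine_flat piecewise_affine_Plus piecewise_affine_Scal
      piecewise_affine_Val)

end

lemma fresh_variable:
  fixes T :: "('c, 'u) trm set" and \<Gamma> :: "(('c, 'u) trm \<times> ('c, 'u) trm) set"
  assumes "finite T" "finite \<Gamma>"
  obtains j where "j \<noteq> k" "\<forall>t\<in>T. j \<notin> vars_trm t" "\<forall>(s, g)\<in>\<Gamma>. j \<notin> vars_trm s \<union> vars_trm g"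
proof -
  let ?V = "insert k (\<Union> (vars_trm ` (T \<union> fst ` \<Gamma> \<union> snd ` \<Gamma>)))"
  have "finite ?V" using assms by (simp add: finite_vars_trm)
  then obtain j where j: "j \<notin> ?V" using ex_new_if_finite[OF infinite_UNIV_nat] by blast
  show ?thesis
  proof (rule that)
    show "j \<noteq> k" "\<forall>t\<in>T. j \<notin> vars_trm t" using j by simp_all
    show "\<forall>(s, g)\<in>\<Gamma>. j \<notin> vars_trm s \<union> vars_trm g" using j by fastforce
  qed
qed

context T_Ham_model
begin

definition value_ext ::
  "nat \<Rightarrow> ((nat \<Rightarrow> 'g option) \<Rightarrow> (nat \<Rightarrow> 'g option) \<Rightarrow> bool) \<Rightarrow> (nat \<Rightarrow> 'g option) \<Rightarrow> (nat \<Rightarrow> 'g option) \<Rightarrow>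
    bool" where
  "value_ext j Q e e' \<longleftrightarrow>
    (\<forall>h. v h = Some h \<longrightarrow> (\<exists>h'. v h' = Some h' \<and> Q (e(j := Some h)) (e'(j := Some h'))))"

definition constrained_ext ::
  "nat \<Rightarrow> (('c, 'g option) trm \<times> ('c, 'g option) trm) set \<Rightarrow> ('c, 'g option) trm set \<Rightarrow>
    (nat \<Rightarrow> 'g option) \<Rightarrow> (nat \<Rightarrow> 'g option) \<Rightarrow> bool" where
  "constrained_ext k \<Gamma> T e e' \<longleftrightarrow> (\<forall>x. val_constraints \<Gamma> e x \<longrightarrow>
    (\<exists>x'. val_constraints \<Gamma> e' x' \<and> same_type T (e(k := Some x)) (e'(k := Some x'))))"

lemma constrained_extD:
  "constrained_ext k \<Gamma> T e e' \<Longrightarrow> val_constraints \<Gamma> e x \<Longrightarrow>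
    \<exists>x'. val_constraints \<Gamma> e' x' \<and> same_type T (e(k := Some x)) (e'(k := Some x'))"
  unfolding constrained_ext_def by blast

lemma forced_over_value_ext:
  assumes "forced_over A Q" shows "forced_over A (value_ext j Q)"
proof -
  obtain T where T: "finite T" "T \<subseteq> terms_over A" "\<And>e e'. same_type T e e' \<Longrightarrow> Q e e'"
    using assms forced_overE by blast
  have "\<exists>S L. finite S \<and> finite L \<and> S \<union> snd ` L \<subseteq> terms_over A \<and> affine_pieces S L j t"
    if "t \<in> T" for t
    using piecewise_affine[of t A j] T(2) that unfolding piecewise_affine_def by blast
  then obtain S L where SL: "\<And>t. t \<in> T \<Longrightarrow> finite (S t) \<and> finite (L t) \<and>
      S t \<union> snd ` L t \<subseteq> terms_over A \<and> affine_pieces (S t) (L t) j t"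
    by metis
  let ?L = "\<Union> (L ` T)"
  let ?S = "affine_base ?L \<union> \<Union> (S ` T)"
  have "finite ?S" using T(1) SL by (simp add: finite_affine_base)
  moreover have "\<forall>s\<in>snd ` ?L. params_trm s \<subseteq> A" "\<Union> (S ` T) \<subseteq> terms_over A" using SL by blast+
  then have "?S \<subseteq> terms_over A" using params_affine_base[of ?L A] by blast
  ultimately have
    "forced_over A (\<lambda>e e'. \<forall>h. v h = Some h \<longrightarrow> (\<exists>h'. v h' = Some h' \<and> same_position ?S e h e' h'))"
    by (rule forced_over_value_position)
  then show ?thesis
  proof (rule forced_over_mono[OF _ subset_refl])
    fix e e' assume pos: "\<forall>h. v h = Some h \<longrightarrow> (\<exists>h'. v h' = Some h' \<and> same_position ?S e h e' h')"
    have "\<exists>h'. v h' = Some h' \<and> Q (e(j := Some h)) (e'(j := Some h'))" if h: "v h = Some h" for h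
    proof -
      obtain h' where h': "v h' = Some h'" "same_position ?S e h e' h'" using pos h by blast
      have "same_type T (e(j := Some h)) (e'(j := Some h'))"
      proof (rule same_type_affine)
        show "same_position (affine_base ?L) e h e' h'"
          using h'(2) by (rule same_position_mono) blast
        fix t assume t: "t \<in> T"
        have "same_position (S t) e h e' h'"
          using h'(2) by (rule same_position_mono) (use t in blast)
        with SL[OF t] h h'(1) obtain l s where "(l, s) \<in> L t"
          "ev (e(j := Some h)) t = affine sc l h (ev e s)"
          "ev (e'(j := Some h')) t = affine sc l h' (ev e' s)"
          using affine_piecesE by metis
        then show "\<exists>(l, s)\<in>?L. ev (e(j := Some h)) t = affine sc l h (ev e s) \<and>
            ev (e'(j := Some h')) t = affine sc l h' (ev e' s)"
          using t by blast
      qed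
      then show ?thesis using h'(1) T(3) by blast
    qed
    then show "value_ext j Q e e'" unfolding value_ext_def by blast
  qed
qed

lemma forced_over_flat_ext:
  assumes T: "finite T" "T \<subseteq> terms_over A" "\<forall>t\<in>T. val_args k t = {}"
    and \<Gamma>: "finite \<Gamma>" "\<Gamma> \<noteq> {}" "\<Gamma> \<subseteq> terms_over A \<times> terms_over A"
  shows "forced_over A (constrained_ext k \<Gamma> T)"
proof -
  have "\<exists>l s. params_trm s \<subseteq> A \<and> (\<forall>e x. ev (e(k := Some x)) t = affine sc l x (ev e s))"
    if "t \<in> T" for t
    using flat_trm_affine[of k t] T(2,3) that by blast
  then obtain l s where ls: "\<And>t. t \<in> T \<Longrightarrow> params_trm (s t) \<subseteq> A"
    "\<And>t e x. t \<in> T \<Longrightarrow> ev (e(k := Some x)) t = affine sc (l t) x (ev e (s t))"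
    by metis
  let ?L = "(\<lambda>t. (l t, s t)) ` T"
  have "finite (affine_base ?L)" using T(1) by (simp add: finite_affine_base)
  moreover have "affine_base ?L \<subseteq> terms_over A"
    using params_affine_base[of ?L A] ls(1) by auto
  ultimately have position: "forced_over A (\<lambda>e e'. \<forall>x. val_constraints \<Gamma> e x \<longrightarrow>
      (\<exists>x'. val_constraints \<Gamma> e' x' \<and> same_position (affine_base ?L) e x e' x'))"
    using \<Gamma> by (rule forced_over_constrained_position)
  have "same_type T (e(k := Some x)) (e'(k := Some x'))"
    if "same_position (affine_base ?L) e x e' x'" for e x e' x'
    using that by (rule same_type_affine) (use ls(2) in blast)
  then show ?thesis
    unfolding constrained_ext_def by (intro forced_over_mono[OF position subset_refl]) blast
qed

lemma same_type_abstract_val: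
  assumes "j \<noteq> k" "\<forall>t\<in>insert u T. j \<notin> vars_trm t"
    and "w = v_ext v (ev (e(k := x)) u)" "w' = v_ext v (ev (e'(k := x')) u)"
    and "same_type (abstract_val u j ` T) (e(j := w, k := x)) (e'(j := w', k := x'))"
  shows "same_type T (e(k := x)) (e'(k := x'))"
  using assms(5)
proof (rule same_type_transfer)
  fix t assume "t \<in> T"
  have "ev (e(k := x)) t = ev (e(j := w, k := x)) (abstract_val u j t)"
    if "w = v_ext v (ev (e(k := x)) u)" for e :: "nat \<Rightarrow> 'g option" and w x
  proof -
    have fresh: "ev (e(j := w, k := x)) s = ev (e(k := x)) s" if "s \<in> insert u T" for s
      unfolding fun_upd_twist[OF assms(1)] using assms(2) that by (intro eval_fresh) blast
    have "ev (e(j := w, k := x)) (abstract_val u j t) = ev (e(j := w, k := x)) t"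
      using assms(1) that fresh[of u] by (intro eval_abstract_val) simp
    then show ?thesis using fresh \<open>t \<in> T\<close> by simp
  qed
  then show "\<exists>s\<in>abstract_val u j ` T. ev (e(k := x)) t = ev (e(j := w, k := x)) s \<and>
      ev (e'(k := x')) t = ev (e'(j := w', k := x')) s"
    using assms(3,4) \<open>t \<in> T\<close> by blast
qed

lemma v_affine_root:
  assumes "l \<noteq> 0" shows "v (sc l x + b) = v (x - sc (- 1 / l) b)"
proof -
  have "sc l (x - sc (- 1 / l) b) = sc l x + b"
    using assms by (simp add: o0.vs.scale_right_distrib)
  then show ?thesis using v_scale[OF assms, of "x - sc (- 1 / l) b"] by simp
qed

lemma constrained_ext_root:
  assumes "same_type T (e(k := ev e c)) (e'(k := ev e' c))"
    and "same_type (insert Infty (insert c (snd ` \<Gamma> \<union> (\<lambda>s. Val (diff_trm c s)) ` fst ` \<Gamma>))) e e'"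
    and "ev e c = Some x" "val_constraints \<Gamma> e x"
  shows "\<exists>x'. val_constraints \<Gamma> e' x' \<and> same_type T (e(k := Some x)) (e'(k := Some x'))"
proof -
  have "g \<in> snd ` \<Gamma>" "s \<in> fst ` \<Gamma>" if "(s, g) \<in> \<Gamma>" for s g
    using that by force+
  then obtain x' where "ev e' c = Some x'" "val_constraints \<Gamma> e' x'"
    using val_constraints_transfer[OF assms(2) _ _ assms(3,4)] by blast
  then show ?thesis using assms(1,3) by auto
qed

lemma constrained_ext_off_root:
  fixes s :: "('c, 'g option) trm" and l :: 'c
  defines "c \<equiv> Scal (- 1 / l) s"
  assumes j: "j \<noteq> k" "\<forall>t\<in>insert s (insert u T). j \<notin> vars_trm t"
      "\<forall>(s, g)\<in>\<Gamma>. j \<notin> vars_trm s \<union> vars_trm g"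
    and u: "\<And>e x. ev (e(k := Some x)) u = affine sc l x (ev e s)"
    and ext: "value_ext j (constrained_ext k (insert (c, Var j) \<Gamma>) (abstract_val u j ` T)) e e'"
    and l: "l \<noteq> 0" and s: "ev e s = Some p" "ev e' s = Some p'"
    and x: "ev e c \<noteq> Some x" "val_constraints \<Gamma> e x"
  shows "\<exists>x'. val_constraints \<Gamma> e' x' \<and> same_type T (e(k := Some x)) (e'(k := Some x'))"
proof -
  have "x \<noteq> sc (- 1 / l) p" using x(1) s(1) by (auto simp: c_def)
  then have "v (x - sc (- 1 / l) p) \<noteq> None"
    by (simp only: v_None_iff right_minus_eq not_False_eq_True)
  then obtain h where h: "v (x - sc (- 1 / l) p) = Some h" by blast
  have c: "ev (f(j := w)) c = map_option (sc (- 1 / l)) (ev f s)" for f w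
    using j(2) by (simp add: c_def eval_fresh)
  have "val_constraints (insert (c, Var j) \<Gamma>) (e(j := Some h)) x"
    using x(2) h s(1) unfolding val_constraints_insert val_constraints_fresh[OF j(3)] c by simp
  then obtain h' x' where x': "val_constraints (insert (c, Var j) \<Gamma>) (e'(j := Some h')) x'"
    "same_type (abstract_val u j ` T) (e(j := Some h, k := Some x))
      (e'(j := Some h', k := Some x'))"
    using ext v_idem[OF h] constrained_extD unfolding value_ext_def by blast
  then have "v (x' - sc (- 1 / l) p') = Some h'" "val_constraints \<Gamma> e' x'"
    using s(2) unfolding val_constraints_insert val_constraints_fresh[OF j(3)] c by simp_all
  moreover have "same_type T (e(k := Some x)) (e'(k := Some x'))"
    by (intro same_type_abstract_val[OF j(1) _ _ _ x'(2)])
      (use j(2) s l h calculation(1) v_affine_root in \<open>simp_all add: u\<close>)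
  ultimately show ?thesis by blast
qed

text \<open>The value \<open>v u = v (l x + s)\<close> is named by the new variable \<open>j\<close>. Unless \<open>l = 0\<close> or \<open>x\<close> is the
  root \<open>c\<close> of \<open>l x + s\<close>, this value is an element of the value set equal to \<open>v (x - c)\<close>, at the
  price of one more constraint on \<open>x\<close>.\<close>

lemma constrained_ext_abstract_val:
  fixes s :: "('c, 'g option) trm" and l :: 'c
  defines "c \<equiv> Scal (- 1 / l) s"
  assumes j: "j \<noteq> k" "\<forall>t\<in>insert s (insert u T). j \<notin> vars_trm t"
      "\<forall>(s, g)\<in>\<Gamma>. j \<notin> vars_trm s \<union> vars_trm g"
    and u: "\<And>e x. ev (e(k := Some x)) u = affine sc l x (ev e s)"
    and const: "constrained_ext k \<Gamma> (abstract_val u j ` T)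
      (e(j := ev e (Val s))) (e'(j := ev e' (Val s)))"
    and ext: "value_ext j (constrained_ext k (insert (c, Var j) \<Gamma>) (abstract_val u j ` T)) e e'"
    and root: "same_type T (e(k := ev e c)) (e'(k := ev e' c))"
      "same_type (insert Infty (insert c (snd ` \<Gamma> \<union> (\<lambda>s. Val (diff_trm c s)) ` fst ` \<Gamma>))) e e'"
  shows "constrained_ext k \<Gamma> T e e'"
  unfolding constrained_ext_def
proof (intro allI impI)
  fix x assume x: "val_constraints \<Gamma> e x"
  have none: "ev e s = None \<longleftrightarrow> ev e' s = None"
    using same_type_None_iff[OF root(2), of c] by (simp add: c_def)
  consider (const_arg) "l = 0 \<or> ev e s = None" | (at_root) "ev e c = Some x"
    | (off_root) p where "l \<noteq> 0" "ev e s = Some p" "ev e c \<noteq> Some x"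
    by blast
  then show "\<exists>x'. val_constraints \<Gamma> e' x' \<and> same_type T (e(k := Some x)) (e'(k := Some x'))"
  proof cases
    case const_arg
    then have affine: "affine sc l x (ev e s) = ev e s" "affine sc l x (ev e' s) = ev e' s" for x
      using none by auto
    obtain x' where x': "val_constraints \<Gamma> e' x'" "same_type (abstract_val u j ` T)
        (e(j := ev e (Val s), k := Some x)) (e'(j := ev e' (Val s), k := Some x'))"
      using constrained_extD[OF const] x unfolding val_constraints_fresh[OF j(3)] by blast
    have "same_type T (e(k := Some x)) (e'(k := Some x'))"
      by (intro same_type_abstract_val[OF j(1) _ _ _ x'(2)])
        (use j(2) affine in \<open>simp_all add: u\<close>)
    then show ?thesis using x'(1) by blast
  next
    case at_root
    then show ?thesis using constrained_ext_root[OF root] x by blast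
  next
    case off_root
    then obtain p' where "ev e' s = Some p'" using none by auto
    then show ?thesis
      using constrained_ext_off_root[OF j u ext[unfolded c_def]] off_root x unfolding c_def by blast
  qed
qed

lemma forced_over_abstract_val:
  assumes T: "finite T" "T \<subseteq> terms_over A"
    and \<Gamma>: "finite \<Gamma>" "\<Gamma> \<noteq> {}" "\<Gamma> \<subseteq> terms_over A \<times> terms_over A"
    and u: "params_trm u \<subseteq> A" "val_args k u = {}"
    and j: "j \<noteq> k" "\<forall>t\<in>insert u T. j \<notin> vars_trm t" "\<forall>(s, g)\<in>\<Gamma>. j \<notin> vars_trm s \<union> vars_trm g"
    and ext: "\<And>\<Delta>. finite \<Delta> \<Longrightarrow> \<Delta> \<noteq> {} \<Longrightarrow> \<Delta> \<subseteq> terms_over A \<times> terms_over A \<Longrightarrow>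
      forced_over A (constrained_ext k \<Delta> (abstract_val u j ` T))"
  shows "forced_over A (constrained_ext k \<Gamma> T)"
proof -
  obtain l s where s: "params_trm s \<subseteq> params_trm u" "vars_trm s \<subseteq> vars_trm u"
    "\<And>e x. ev (e(k := Some x)) u = affine sc l x (ev e s)"
    using flat_trm_affine[OF u(2)] by blast
  let ?c = "Scal (- 1 / l) s" and ?T = "abstract_val u j ` T"
  let ?F = "insert Infty (insert ?c (snd ` \<Gamma> \<union> (\<lambda>s. Val (diff_trm ?c s)) ` fst ` \<Gamma>))"
  have sA: "params_trm s \<subseteq> A" using s(1) u(1) by blast
  have const: "forced_over A (\<lambda>e e'.
      constrained_ext k \<Gamma> ?T (e(j := ev e (Val s))) (e'(j := ev e' (Val s))))"
    using sA by (intro forced_over_subst[OF ext[OF \<Gamma>]]) simp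
  have "insert (?c, Var j) \<Gamma> \<subseteq> terms_over A \<times> terms_over A" using sA \<Gamma>(3) by simp
  then have "forced_over A (constrained_ext k (insert (?c, Var j) \<Gamma>) ?T)"
    using \<Gamma>(1) by (intro ext) simp_all
  then have val: "forced_over A (value_ext j (constrained_ext k (insert (?c, Var j) \<Gamma>) ?T))"
    by (rule forced_over_value_ext)
  have "params_trm ?c \<subseteq> A" using sA by simp
  then have root: "forced_over A (\<lambda>e e'. same_type T (e(k := ev e ?c)) (e'(k := ev e' ?c)))"
    by (intro forced_over_subst forced_overI[OF T])
  have "finite ?F" "?F \<subseteq> terms_over A" using \<Gamma>(1,3) sA by (simp, fastforce)
  then have "forced_over A (same_type ?F)" by (rule forced_overI)
  note forced = forced_over_conj[OF forced_over_conj[OF const val] forced_over_conj[OF root this]]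
  show ?thesis
    using forced_over_mono[OF forced subset_refl] constrained_ext_abstract_val[OF j(1) _ j(3) s(3)]
      j(2) s(2) by blast
qed

lemma forced_over_constrained_ext:
  assumes "finite T" "T \<subseteq> terms_over A"
    and "finite \<Gamma>" "\<Gamma> \<noteq> {}" "\<Gamma> \<subseteq> terms_over A \<times> terms_over A"
  shows "forced_over A (constrained_ext k \<Gamma> T)"
  using assms
proof (induction "card (\<Union> (val_args k ` T))" arbitrary: T \<Gamma> rule: less_induct)
  case less
  note T = less.prems(1,2) and \<Gamma> = less.prems(3-5)
  show ?case
  proof (cases "\<Union> (val_args k ` T) = {}")
    case True
    then show ?thesis using forced_over_flat_ext[OF T _ \<Gamma>] by blast
  next
    case False
    then obtain t u where t: "t \<in> T" "u \<in> val_args k t" and flat: "val_args k u = {}"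
      using innermost_val_arg by blast
    obtain j where j: "j \<noteq> k" "\<forall>t\<in>insert u T. j \<notin> vars_trm t"
      "\<forall>(s, g)\<in>\<Gamma>. j \<notin> vars_trm s \<union> vars_trm g"
      using fresh_variable[of "insert u T" \<Gamma> k] T(1) \<Gamma>(1) by blast
    show ?thesis
    proof (rule forced_over_abstract_val[OF T \<Gamma> _ flat j])
      show "params_trm u \<subseteq> A" using val_args_subterm(2)[OF t(2)] t(1) T(2) by blast
      have "finite (abstract_val u j ` T)" "abstract_val u j ` T \<subseteq> terms_over A"
        using T params_abstract_val[of u j] by (simp, blast)
      moreover have "card (\<Union> (val_args k ` abstract_val u j ` T)) < card (\<Union> (val_args k ` T))"
        using t by (intro card_val_args_abstract_val[OF T(1) _ j(1)]) blast
      ultimately show "forced_over A (constrained_ext k \<Delta> (abstract_val u j ` T))"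
        if "finite \<Delta>" "\<Delta> \<noteq> {}" "\<Delta> \<subseteq> terms_over A \<times> terms_over A" for \<Delta>
        using less.hyps that by blast
    qed
  qed
qed

lemma forced_over_ext:
  assumes "forced_over A Q"
  shows "forced_over A (\<lambda>e e'. \<forall>p. \<exists>p'. Q (e(k := p)) (e'(k := p')))"
proof -
  obtain T where T: "finite T" "T \<subseteq> terms_over A" "\<And>e e'. same_type T e e' \<Longrightarrow> Q e e'"
    using assms forced_overE by blast
  obtain j where j: "j \<noteq> k" "\<forall>t\<in>T. j \<notin> vars_trm t"
    using fresh_variable[OF T(1) finite.emptyI] by metis
  let ?\<Gamma> = "{(Zero, Var j)} :: (('c, 'g option) trm \<times> ('c, 'g option) trm) set"
  have "forced_over A (constrained_ext k ?\<Gamma> T)"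
    by (rule forced_over_constrained_ext[OF T(1,2)]) simp_all
  then have ext: "forced_over A (value_ext j (constrained_ext k ?\<Gamma> T))"
    by (rule forced_over_value_ext)
  have at: "forced_over A (\<lambda>e e'. Q (e(k := ev e t)) (e'(k := ev e' t)))" if "params_trm t = {}"
    for t :: "('c, 'g option) trm"
    using that by (intro forced_over_subst[OF assms]) simp
  show ?thesis
  proof (rule forced_over_mono[OF forced_over_conj[OF forced_over_conj[OF at[of Infty] at[of Zero]]
    ext] subset_refl])
    fix e e'
    assume forced: "(Q (e(k := ev e Infty)) (e'(k := ev e' Infty)) \<and>
        Q (e(k := ev e Zero)) (e'(k := ev e' Zero))) \<and>
      value_ext j (constrained_ext k ?\<Gamma> T) e e'"
    have fresh: "same_type T (e(k := p)) (e'(k := p'))"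
      if "same_type T (e(j := w, k := p)) (e'(j := w', k := p'))" for w w' p p'
      using that j(2) unfolding fun_upd_twist[OF j(1)] same_type_def by (simp add: eval_fresh)
    have "\<exists>p'. Q (e(k := p)) (e'(k := p'))" for p
    proof (cases "v_ext v p")
      case None
      then consider "p = None" | "p = Some 0" by (cases p) auto
      then show ?thesis using forced by cases auto
    next
      case (Some h)
      then obtain x where x: "p = Some x" "v x = Some h" by (cases p) auto
      then have "val_constraints ?\<Gamma> (e(j := Some h)) x" by (simp add: val_constraints_def)
      then obtain h' x' where
        "same_type T (e(j := Some h, k := Some x)) (e'(j := Some h', k := Some x'))"
        using forced v_idem[OF x(2)] constrained_extD unfolding value_ext_def by blast
      then show ?thesis using T(3) fresh x(1) by blast
    qed
    then show "\<forall>p. \<exists>p'. Q (e(k := p)) (e'(k := p'))" by blast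
  qed simp_all
qed

lemma forced_over_sat:
  fixes f :: "('c, 'g option) fm"
  shows "forced_over (params_fm f) (\<lambda>e e'. sat sc lt0 lt1 v e f \<longleftrightarrow> sat sc lt0 lt1 v e' f)"
proof -
  have atom: "forced_over (params_trm s \<union> params_trm t) (\<lambda>e e'.
      same_orders (ev e s) (ev e t) (ev e' s) (ev e' t))"
    for s t :: "('c, 'g option) trm"
    by (rule forced_overI[of "{s, t}"]) (auto simp: same_type_def)
  show ?thesis
  proof (induction f)
    case (Eq s t)
    show ?case unfolding params_fm.simps
      by (rule forced_over_mono[OF atom subset_refl]) (simp add: same_orders_eq)
  next
    case (Less0 s t)
    show ?case unfolding params_fm.simps
      by (rule forced_over_mono[OF atom subset_refl]) (simp add: same_orders_def o0.same_order_def)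
  next
    case (Less1 s t)
    show ?case unfolding params_fm.simps
      by (rule forced_over_mono[OF atom subset_refl]) (simp add: same_orders_def o1.same_order_def)
  next
    case (Neg f)
    then show ?case by simp
  next
    case (Conj f g)
    then have "forced_over (params_fm f \<union> params_fm g) (\<lambda>e e'.
        sat sc lt0 lt1 v e f \<longleftrightarrow> sat sc lt0 lt1 v e' f)"
      "forced_over (params_fm f \<union> params_fm g) (\<lambda>e e'.
        sat sc lt0 lt1 v e g \<longleftrightarrow> sat sc lt0 lt1 v e' g)"
      by (auto elim: forced_over_mono)
    from forced_over_conj[OF this] show ?case unfolding params_fm.simps
      by (rule forced_over_mono) auto
  next
    case (Ex k f)
    note ext = forced_over_ext[OF Ex.IH, of k]
    show ?case unfolding params_fm.simps sat.simps
      by (rule forced_over_mono[OF forced_over_conj[OF ext forced_over_swap[OF ext]] subset_refl])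
        blast
  qed
qed

theorem same_type_sat:
  fixes f :: "('c, 'g option) fm"
  assumes "same_type (terms_over A) e e'" "params_fm f \<subseteq> A"
  shows "sat sc lt0 lt1 v e f \<longleftrightarrow> sat sc lt0 lt1 v e' f"
proof -
  obtain S where S: "S \<subseteq> terms_over (params_fm f)"
    "\<And>e e'. same_type S e e' \<Longrightarrow> sat sc lt0 lt1 v e f \<longleftrightarrow> sat sc lt0 lt1 v e' f"
    by (rule forced_overE[OF forced_over_sat[of f]]) blast
  have "S \<subseteq> terms_over A" using S(1) assms(2) by blast
  then show ?thesis by (rule S(2)[OF same_type_mono[OF assms(1)]])
qed

end

section \<open>Indiscernible sequences and terms\<close>

definition list_env :: "'a option list \<Rightarrow> nat \<Rightarrow> 'a option" where
  "list_env xs k = (if k < length xs then xs ! k else None)"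

lemma length_concat_const:
  "(\<And>k. k \<in> set ks \<Longrightarrow> length (f k) = m) \<Longrightarrow> length (concat (map f ks)) = length ks * m"
  by (induction ks) auto

definition ascending_blocks ::
  "'k::linorder set \<Rightarrow> 'i::linorder set \<Rightarrow> 'i list \<Rightarrow> ('k \<Rightarrow> 'i list) \<Rightarrow> 'i list \<Rightarrow> bool" where
  "ascending_blocks K J ls blk rs \<longleftrightarrow> (\<forall>ks. sorted_wrt (<) ks \<longrightarrow> set ks \<subseteq> K \<longrightarrow>
    sorted_wrt (<) (ls @ concat (map blk ks) @ rs) \<and> set (ls @ concat (map blk ks) @ rs) \<subseteq> J)"

lemma ascending_blocksD:
  assumes "ascending_blocks K J ls blk rs" "sorted_wrt (<) ks" "set ks \<subseteq> K"
  shows "sorted_wrt (<) (ls @ concat (map blk ks) @ rs)" "set (ls @ concat (map blk ks) @ rs) \<subseteq> J"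
  using assms unfolding ascending_blocks_def by blast+

lemma ascending_blocks_subset:
  assumes "ascending_blocks K J ls blk rs"
  shows "set (ls @ rs) \<subseteq> J" "k \<in> K \<Longrightarrow> set (blk k) \<subseteq> J"
  using ascending_blocksD(2)[OF assms, of "[]"] ascending_blocksD(2)[OF assms, of "[k]"] by simp_all

lemma ascending_blocks_delete:
  assumes "ascending_blocks K J ls blk rs" "m \<in> K" "c \<in> set (blk m)"
  shows "ascending_blocks (K - {m}) (J - {c}) ls blk rs"
proof -
  have ends: "c \<notin> set (ls @ rs)"
    using ascending_blocksD(1)[OF assms(1), of "[m]"] assms(2,3) by (auto simp: sorted_wrt_append)
  have blocks: "c \<notin> set (blk k)" if "k \<in> K - {m}" for k
    using ascending_blocksD(1)[OF assms(1), of "[k, m]"]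
      ascending_blocksD(1)[OF assms(1), of "[m, k]"]
      assms(2,3) that by (cases k m rule: linorder_cases) (auto simp: sorted_wrt_append)
  have "c \<notin> set (ls @ concat (map blk ks) @ rs)" if "set ks \<subseteq> K - {m}" for ks
    using ends blocks that by auto
  then show ?thesis
    using assms(1) unfolding ascending_blocks_def by blast
qed

lemma seq_env_eq_list_env:
  assumes "\<And>i. i \<in> set is \<Longrightarrow> length (a i) = n"
  shows "seq_env n a is = list_env (concat (map a is))"
  using assms
proof (induction "is")
  case Nil
  show ?case by (auto simp: seq_env_def list_env_def)
next
  case (Cons i "is")
  have IH: "seq_env n a is = list_env (concat (map a is))" by (rule Cons.IH) (simp add: Cons.prems)
  have i: "length (a i) = n" by (simp add: Cons.prems)
  show ?case
  proof
    fix k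
    show "seq_env n a (i # is) k = list_env (concat (map a (i # is))) k"
    proof (cases "k < n")
      case True
      then show ?thesis using i by (auto simp: seq_env_def list_env_def nth_append)
    next
      case False
      have "seq_env n a (i # is) k = seq_env n a is (k - n)"
        using False by (cases "n = 0") (auto simp: seq_env_def le_div_geq le_mod_geq)
      also have "\<dots> = list_env (concat (map a (i # is))) k"
        using False i unfolding IH by (auto simp: list_env_def nth_append)
      finally show ?thesis .
    qed
  qed
qed

definition list_inst ::
  "('c, 'u) trm list \<Rightarrow> ('u \<Rightarrow> ('c, 'u) trm) \<Rightarrow> ('c, 'u) trm \<Rightarrow> ('c, 'u) trm" where
  "list_inst ts = inst_trm (\<lambda>k. if k < length ts then ts ! k else Infty)"

lemma eval_list_inst:
  assumes "\<And>u. u \<in> params_trm t \<Longrightarrow> eval sc v e (g u) = u"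
  shows "eval sc v e (list_inst ts g t) = eval sc v (list_env (map (eval sc v e) ts)) t"
proof -
  have "(\<lambda>k. eval sc v e (if k < length ts then ts ! k else Infty)) =
      list_env (map (eval sc v e) ts)"
    by (auto simp: list_env_def)
  then show ?thesis using eval_inst_trm[OF assms] by (simp add: list_inst_def)
qed

lemma params_list_inst:
  assumes "\<And>s. s \<in> set ts \<Longrightarrow> params_trm s \<subseteq> B" "\<And>u. u \<in> params_trm t \<Longrightarrow> params_trm (g u) \<subseteq> B"
  shows "params_trm (list_inst ts g t) \<subseteq> B"
  unfolding list_inst_def using assms by (intro params_inst_trm) auto

lemma vars_list_inst:
  assumes "\<And>s. s \<in> set ts \<Longrightarrow> vars_trm s = {}" "\<And>u. vars_trm (g u) = {}"
  shows "vars_trm (list_inst ts g t) = {}"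
  using vars_inst_trm[of "\<lambda>k. if k < length ts then ts ! k else Infty" "{}" g t] assms
  by (simp add: list_inst_def)

primrec val_depth :: "('c, 'u) trm \<Rightarrow> nat" where
  "val_depth (Var k) = 0"
| "val_depth (Cst u) = 0"
| "val_depth Zero = 0"
| "val_depth Infty = 0"
| "val_depth (Plus s t) = max (val_depth s) (val_depth t)"
| "val_depth (Scal c t) = val_depth t"
| "val_depth (Val t) = Suc (val_depth t)"

lemma val_depth_list_inst:
  assumes "\<And>s. s \<in> set ts \<Longrightarrow> val_depth s = 0" "\<And>u. val_depth (g u) = 0"
  shows "val_depth (list_inst ts g t) = val_depth t"
  unfolding list_inst_def using assms by (induction t) auto

lemma map_list_env_window:
  "map (list_env (xs @ ys @ zs)) [length xs..<length xs + length ys] = ys"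
  by (rule nth_equalityI) (auto simp: list_env_def nth_append)

definition window_trm :: "nat \<Rightarrow> nat \<Rightarrow> ('u \<Rightarrow> ('c, 'u) trm) \<Rightarrow> ('c, 'u) trm \<Rightarrow> ('c, 'u) trm" where
  "window_trm l m = list_inst (map Var [l..<l + m])"

lemma eval_window_trm:
  assumes "length xs = l" "length ys = m"
    and "\<And>u. u \<in> params_trm t \<Longrightarrow> eval sc v (list_env (xs @ ys @ zs)) (g u) = u"
  shows "eval sc v (list_env (xs @ ys @ zs)) (window_trm l m g t) = eval sc v (list_env ys) t"
proof -
  have "map (eval sc v (list_env (xs @ ys @ zs))) (map Var [l..<l + m]) = ys"
    using map_list_env_window[of xs ys zs] assms(1,2) by (simp add: comp_def)
  then show ?thesis using eval_list_inst[OF assms(3)] by (simp add: window_trm_def)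
qed

lemma params_window_trm:
  "(\<And>u. u \<in> params_trm t \<Longrightarrow> params_trm (g u) \<subseteq> B) \<Longrightarrow> params_trm (window_trm l m g t) \<subseteq> B"
  unfolding window_trm_def by (rule params_list_inst) auto

lemma unfreeze_trm:
  fixes t :: "('c, 'g::ab_group_add option) trm"
  assumes "params_trm t \<subseteq> B \<union> set (xs @ zs)"
  shows "\<exists>s. params_trm s \<subseteq> B \<and>
    (\<forall>ys. length ys = m \<longrightarrow> eval sc v (list_env (xs @ ys @ zs)) s = eval sc v (list_env ys) t)"
proof -
  have "\<exists>s :: ('c, 'g option) trm. params_trm s \<subseteq> B \<and>
      (\<forall>ys. length ys = m \<longrightarrow> eval sc v (list_env (xs @ ys @ zs)) s = u)"
    if u: "u \<in> B \<union> set (xs @ zs)" for u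
  proof -
    consider (param) "u \<in> B" | (left) i where "i < length xs" "u = xs ! i" 
      | (right) i where "i < length zs" "u = zs ! i"
      using u by (auto simp: in_set_conv_nth)
    then show ?thesis
    proof cases
      case param
      then show ?thesis by (intro exI[of _ "Cst u"]) simp
    next
      case left
      then show ?thesis by (intro exI[of _ "Var i"]) (simp add: list_env_def nth_append)
    next
      case right
      then show ?thesis
        by (intro exI[of _ "Var (length xs + m + i)"]) (simp add: list_env_def nth_append)
    qed
  qed
  then obtain g :: "'g option \<Rightarrow> ('c, 'g option) trm" where
    g: "\<And>u. u \<in> params_trm t \<Longrightarrow> params_trm (g u) \<subseteq> B"
    "\<And>u ys. u \<in> params_trm t \<Longrightarrow> length ys = m \<Longrightarrow> eval sc v (list_env (xs @ ys @ zs)) (g u) = u"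
    using assms by (metis subsetD)
  show ?thesis
    using g by (intro exI[of _ "window_trm (length xs) m g t"])
      (simp add: params_window_trm eval_window_trm)
qed

definition freeze_trm :: "'u list \<Rightarrow> nat \<Rightarrow> 'u list \<Rightarrow> ('c, 'u) trm \<Rightarrow> ('c, 'u) trm" where
  "freeze_trm xs m zs = list_inst (map Cst xs @ map Var [0..<m] @ map Cst zs) Cst"

lemma eval_freeze_trm:
  assumes "length ys = m"
  shows "eval sc v (list_env ys) (freeze_trm xs m zs t) = eval sc v (list_env (xs @ ys @ zs)) t"
proof -
  have "map (list_env ys) [0..<m] = ys"
    using assms map_list_env_window[of "[]" ys "[]"] by simp
  then have "map (eval sc v (list_env ys)) (map Cst xs @ map Var [0..<m] @ map Cst zs) =
      xs @ ys @ zs"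
    by (simp add: comp_def)
  then show ?thesis by (simp only: freeze_trm_def eval_list_inst eval.simps)
qed

lemma params_freeze_trm: "params_trm (freeze_trm xs m zs t) \<subseteq> params_trm t \<union> set (xs @ zs)"
  unfolding freeze_trm_def by (rule params_list_inst) auto

lemma val_depth_freeze_trm: "val_depth (freeze_trm xs m zs t) = val_depth t"
  unfolding freeze_trm_def by (rule val_depth_list_inst) auto

definition closed_trm :: "'u list \<Rightarrow> ('c, 'u) trm \<Rightarrow> ('c, 'u) trm" where
  "closed_trm xs = list_inst (map Cst xs) Cst"

lemma eval_closed_trm: "eval sc v e (closed_trm xs t) = eval sc v (list_env xs) t"
  by (simp add: closed_trm_def eval_list_inst comp_def)

lemma params_closed_trm: "params_trm (closed_trm xs t) \<subseteq> params_trm t \<union> set xs"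
  unfolding closed_trm_def by (rule params_list_inst) auto

lemma vars_closed_trm: "vars_trm (closed_trm xs t) = {}"
  unfolding closed_trm_def by (rule vars_list_inst) auto

context hamel_valuation
begin

definition term_indiscernible ::
  "'g option set \<Rightarrow> 'i::linorder set \<Rightarrow> ('i \<Rightarrow> 'g option list) \<Rightarrow> bool" where
  "term_indiscernible B J a \<longleftrightarrow> (\<forall>is js. sorted_wrt (<) is \<longrightarrow> sorted_wrt (<) js \<longrightarrow>
    set is \<subseteq> J \<longrightarrow> set js \<subseteq> J \<longrightarrow> length is = length js \<longrightarrow>
    same_type (terms_over B) (list_env (concat (map a is))) (list_env (concat (map a js))))"

lemma term_indiscernibleD:
  assumes "term_indiscernible B J a" "sorted_wrt (<) is" "sorted_wrt (<) js"
    and "set is \<subseteq> J" "set js \<subseteq> J" "length is = length js"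
  shows "same_type (terms_over B) (list_env (concat (map a is))) (list_env (concat (map a js)))"
  using assms unfolding term_indiscernible_def by blast

lemma term_indiscernible_single:
  assumes "term_indiscernible B J a" "params_trm s \<subseteq> B" "params_trm t \<subseteq> B" "k \<in> J" "k' \<in> J"
  shows "same_orders (ev (list_env (a k)) s) (ev (list_env (a k)) t)
    (ev (list_env (a k')) s) (ev (list_env (a k')) t)"
  using same_typeD[OF term_indiscernibleD[OF assms(1), of "[k]" "[k']"]] assms(2-5) by simp

lemma term_indiscernible_pair:
  assumes a: "term_indiscernible B J a" "\<And>i. i \<in> J \<Longrightarrow> length (a i) = n"
    and st: "params_trm s \<subseteq> B" "params_trm t \<subseteq> B"
    and ij: "i \<in> J" "j \<in> J" "i' \<in> J" "j' \<in> J" "i < j" "i' < j'"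
  shows "same_orders (ev (list_env (a i)) s) (ev (list_env (a j)) t)
    (ev (list_env (a i')) s) (ev (list_env (a j')) t)"
proof -
  let ?s = "window_trm 0 n Cst s" and ?t = "window_trm n n Cst t"
  have s: "ev (list_env (a i @ a j)) ?s = ev (list_env (a i)) s"
    and t: "ev (list_env (a i @ a j)) ?t = ev (list_env (a j)) t" if "i \<in> J" "j \<in> J" for i j
    using eval_window_trm[of "[]" 0 "a i" n s sc v "a j" Cst]
      eval_window_trm[of "a i" n "a j" n t sc v "[]" Cst] a(2) that by simp_all
  have "same_type (terms_over B) (list_env (a i @ a j)) (list_env (a i' @ a j'))"
    using term_indiscernibleD[OF a(1), of "[i, j]" "[i', j']"] ij by simp
  moreover have "?s \<in> terms_over B" "?t \<in> terms_over B"
    using st by (auto intro!: params_window_trm)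
  ultimately have "same_orders (ev (list_env (a i @ a j)) ?s) (ev (list_env (a i @ a j)) ?t)
      (ev (list_env (a i' @ a j')) ?s) (ev (list_env (a i' @ a j')) ?t)"
    by (rule same_typeD)
  then show ?thesis using s t ij by simp
qed

lemma term_indiscernible_regroup:
  fixes blk :: "'k::linorder \<Rightarrow> 'i::linorder list"
  assumes a: "term_indiscernible B J a" "\<And>i. i \<in> J \<Longrightarrow> length (a i) = n"
    and blk: "ascending_blocks K J ls blk rs" "\<And>k. k \<in> K \<Longrightarrow> length (blk k) = r"
  shows "term_indiscernible (B \<union> set (concat (map a (ls @ rs)))) K (\<lambda>k. concat (map a (blk k)))"
  unfolding term_indiscernible_def
proof (intro allI impI)
  fix ks ks' :: "'k list"
  assume ks: "sorted_wrt (<) ks" "sorted_wrt (<) ks'" "set ks \<subseteq> K" "set ks' \<subseteq> K"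
    "length ks = length ks'"
  let ?xs = "concat (map a ls)" and ?zs = "concat (map a rs)"
  let ?ys = "\<lambda>ks. concat (map (\<lambda>k. concat (map a (blk k))) ks)"
  have flat: "concat (map a (concat (map blk ks))) = ?ys ks" for ks
    by (induction ks) simp_all
  have len_blk: "length (concat (map blk ks)) = length ks * r" if "set ks \<subseteq> K" for ks
    using that blk(2) by (intro length_concat_const) blast
  have len_b: "length (concat (map a (blk k))) = r * n" if "k \<in> K" for k
    using length_concat_const[of "blk k" a n] a(2) blk(2) ascending_blocks_subset(2)[OF blk(1)] that
    by auto
  have len: "length (?ys ks) = length ks * (r * n)" if "set ks \<subseteq> K" for ks
    using that len_b by (intro length_concat_const) blast
  have "same_type (terms_over B) (list_env (concat (map a (ls @ concat (map blk ks) @ rs))))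
      (list_env (concat (map a (ls @ concat (map blk ks') @ rs))))"
  proof (rule term_indiscernibleD[OF a(1)])
    show "length (ls @ concat (map blk ks) @ rs) = length (ls @ concat (map blk ks') @ rs)"
      using len_blk ks(3-5) by simp
  qed (intro ascending_blocksD[OF blk(1)] ks)+
  then have "same_type (terms_over B) (list_env (?xs @ ?ys ks @ ?zs))
      (list_env (?xs @ ?ys ks' @ ?zs))"
    by (simp add: flat)
  then show "same_type (terms_over (B \<union> set (concat (map a (ls @ rs))))) (list_env (?ys ks))
      (list_env (?ys ks'))"
  proof (rule same_type_transfer)
    fix t :: "('c, 'g option) trm" assume "t \<in> terms_over (B \<union> set (concat (map a (ls @ rs))))"
    then have "params_trm t \<subseteq> B \<union> set (?xs @ ?zs)" by simp
    then obtain s where s: "params_trm s \<subseteq> B"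
      "\<forall>ys. length ys = length ks * (r * n) \<longrightarrow> ev (list_env (?xs @ ys @ ?zs)) s = ev (list_env ys) t"
      using unfreeze_trm by blast
    then show "\<exists>s\<in>terms_over B. ev (list_env (?ys ks)) t = ev (list_env (?xs @ ?ys ks @ ?zs)) s \<and>
        ev (list_env (?ys ks')) t = ev (list_env (?xs @ ?ys ks' @ ?zs)) s"
      using len ks(3-5) by (intro bexI[of _ s]) simp_all
  qed
qed

end

section \<open>Distality\<close>

lemma (in linorder) mono_const_or_less_last:
  fixes u :: "int \<Rightarrow> 'a" and M :: int
  defines "Z \<equiv> {-M..M} - {0}"
  assumes M: "2 \<le> M" and mono: "monotone_on {-M..M} (\<le>) (\<le>) u"
    and pattern: "\<And>i j i' j'. i \<in> Z \<Longrightarrow> j \<in> Z \<Longrightarrow> i' \<in> Z \<Longrightarrow> j' \<in> Z \<Longrightarrow> i < j \<Longrightarrow> i' < j' \<Longrightarrow>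
      u i = u j \<longleftrightarrow> u i' = u j'"
  shows "(\<forall>k\<in>{-M..M}. u k = u M) \<or> (\<forall>k\<in>{-M<..<M}. u k < u M)"
proof (cases "u (-1) = u 1")
  case True
  then have Z: "u k = u M" if "k \<in> Z" for k
    using pattern[of "-1" 1 k M] that M by (cases "k = M") (auto simp: Z_def)
  have "u 0 = u M"
  proof (rule order.antisym)
    show "u 0 \<le> u M" using M by (intro monotone_onD[OF mono]) auto
    have "u (-1) \<le> u 0" using M by (intro monotone_onD[OF mono]) auto
    then show "u M \<le> u 0" using Z[of "-1"] M by (simp add: Z_def)
  qed
  then have "u k = u M" if "k \<in> {-M..M}" for k
    using that Z[of k] by (cases "k = 0") (simp_all add: Z_def)
  then show ?thesis by blast
next
  case False
  have Z: "u k < u M" if "k \<in> Z" "k < M" for k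
  proof -
    have "u k \<noteq> u M" using pattern[of "-1" 1 k M] that M False by (auto simp: Z_def)
    moreover have "u k \<le> u M" using that by (intro monotone_onD[OF mono]) (auto simp: Z_def)
    ultimately show ?thesis by simp
  qed
  have "u 0 \<le> u 1" using M by (intro monotone_onD[OF mono]) auto
  moreover have "u 1 < u M" using M by (intro Z) (auto simp: Z_def)
  ultimately have "u k < u M" if "k \<in> {-M<..<M}" for k
    using that Z[of k] by (cases "k = 0") (auto simp: Z_def)
  then show ?thesis by blast
qed

lemma (in linorder) antimono_const_or_less_first:
  fixes u :: "int \<Rightarrow> 'a" and M :: int
  defines "Z \<equiv> {-M..M} - {0}"
  assumes M: "2 \<le> M" and antimono: "monotone_on {-M..M} (\<ge>) (\<le>) u"
    and pattern: "\<And>i j i' j'. i \<in> Z \<Longrightarrow> j \<in> Z \<Longrightarrow> i' \<in> Z \<Longrightarrow> j' \<in> Z \<Longrightarrow> i < j \<Longrightarrow> i' < j' \<Longrightarrow>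
      u i = u j \<longleftrightarrow> u i' = u j'"
  shows "(\<forall>k\<in>{-M..M}. u k = u M) \<or> (\<forall>k\<in>{-M<..<M}. u k < u (- M))"
proof -
  have reflect: "monotone_on {-M..M} (\<le>) (\<le>) (\<lambda>k. u (- k))"
    by (intro monotone_onI monotone_onD[OF antimono]) auto
  have "u (- i) = u (- j) \<longleftrightarrow> u (- i') = u (- j')"
    if "i \<in> Z" "j \<in> Z" "i' \<in> Z" "j' \<in> Z" "i < j" "i' < j'" for i j i' j'
    using pattern[of "- j" "- i" "- j'" "- i'"] that by (auto simp: Z_def)
  from mono_const_or_less_last[OF M reflect this[unfolded Z_def]]
  consider (const) "\<And>k. k \<in> {-M..M} \<Longrightarrow> u (- k) = u (- M)"
    | (less) "\<And>k. k \<in> {-M<..<M} \<Longrightarrow> u (- k) < u (- M)" by blast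
  then show ?thesis
  proof cases
    case const
    have "u k = u M" if "k \<in> {-M..M}" for k
      using const[of "- k"] const[of "- M"] that M by simp
    then show ?thesis by blast
  next
    case less
    have "u k < u (- M)" if "k \<in> {-M<..<M}" for k
      using less[of "- k"] that by simp
    then show ?thesis by blast
  qed
qed

lemma (in ordered_vector_space) increasing_sequence_same_side:
  fixes t :: "int \<Rightarrow> 'g" and M :: int
  assumes M: "1 \<le> M" and inc: "\<And>i j. - M \<le> i \<Longrightarrow> i < j \<Longrightarrow> j \<le> M \<Longrightarrow> lt (t i) (t j)"
    and cut: "\<And>i j. i \<in> {-M..M} - {0} \<Longrightarrow> j \<in> {-M..M} - {0} \<Longrightarrow>
      same_order (Some (t i)) (Some d) (Some (t j)) (Some d)"
  shows "(\<forall>k\<in>{-M..M}. lt (t k) d) \<or> (\<forall>k\<in>{-M..M}. lt d (t k))"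
proof -
  have ends: "-1 \<in> {-M..M} - {0}" "1 \<in> {-M..M} - {0}" using M by auto
  have zero: "lt (t (-1)) (t 0)" "lt (t 0) (t 1)" using inc M by auto
  show ?thesis
    using cut[OF ends]
  proof (cases rule: same_order_cases)
    case eq
    then show ?thesis using less_trans[OF zero] by simp
  next
    case less
    have "lt (t k) d" if "k \<in> {-M..M}" for k
    proof (cases "k = 0")
      case True
      then show ?thesis using less_trans[OF zero(2)] less by simp
    next
      case False
      then show ?thesis using cut[OF ends(2), of k] less that by (simp add: same_order_def)
    qed
    then show ?thesis by blast
  next
    case greater
    have "lt d (t k)" if "k \<in> {-M..M}" for k
    proof (cases "k = 0")
      case True
      then show ?thesis using less_trans[OF _ zero(1)] greater by simp
    next
      case False
      then show ?thesis
        using same_order_commute[THEN iffD1, OF cut[OF ends(2), of k]] greater that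
        by (simp add: same_order_def)
    qed
    then show ?thesis by blast
  qed
qed

context hamel_valuation
begin

lemma increasing_sequence_val_mono:
  fixes t :: "int \<Rightarrow> 'g" and M :: int
  assumes "1 \<le> M" and inc: "\<And>i j. - M \<le> i \<Longrightarrow> i < j \<Longrightarrow> j \<le> M \<Longrightarrow> lt1 (t i) (t j)"
    and "\<And>i j. i \<in> {-M..M} - {0} \<Longrightarrow> j \<in> {-M..M} - {0} \<Longrightarrow>
      o1.same_order (Some (t i)) (Some d) (Some (t j)) (Some d)"
  shows "monotone_on {-M..M} (\<le>) (le_inf lt0) (\<lambda>k. v (d - t k)) \<or>
    monotone_on {-M..M} (\<ge>) (le_inf lt0) (\<lambda>k. v (d - t k))"
proof -
  have le: "o1.le (t i) (t j)" if "i \<in> {-M..M}" "j \<in> {-M..M}" "i \<le> j" for i j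
    using inc[of i j] that unfolding o1.le_def by (cases "i = j") simp_all
  have "(\<forall>k\<in>{-M..M}. lt1 (t k) d) \<or> (\<forall>k\<in>{-M..M}. lt1 d (t k))"
    using assms by (rule o1.increasing_sequence_same_side)
  then consider (above) "\<And>k. k \<in> {-M..M} \<Longrightarrow> lt1 (t k) d"
    | (below) "\<And>k. k \<in> {-M..M} \<Longrightarrow> lt1 d (t k)" by blast
  then show ?thesis
  proof cases
    case above
    then have "monotone_on {-M..M} (\<le>) (le_inf lt0) (\<lambda>k. v (d - t k))"
      using le by (intro monotone_onI v_between) blast
    then show ?thesis ..
  next
    case below
    then have "monotone_on {-M..M} (\<ge>) (le_inf lt0) (\<lambda>k. v (d - t k))"
      using le by (intro monotone_onI v_between) blast
    then show ?thesis ..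
  qed
qed

lemma same_order_uminus:
  "o1.same_order (Some (- x)) (Some (- y)) (Some (- x')) (Some (- y')) \<longleftrightarrow>
    o1.same_order (Some y) (Some x) (Some y') (Some x')"
  by (auto simp: o1.same_order_def)

lemma monotone_sequence_val_mono:
  fixes t :: "int \<Rightarrow> 'g" and M :: int
  assumes M: "1 \<le> M"
    and mono: "\<And>i j. - M \<le> i \<Longrightarrow> i < j \<Longrightarrow> j \<le> M \<Longrightarrow>
      o1.same_order (Some (t i)) (Some (t j)) (Some (t 0)) (Some (t 1))"
    and cut: "\<And>i j. i \<in> {-M..M} - {0} \<Longrightarrow> j \<in> {-M..M} - {0} \<Longrightarrow>
      o1.same_order (Some (t i)) (Some d) (Some (t j)) (Some d)"
  shows "monotone_on {-M..M} (\<le>) (le_inf lt0) (\<lambda>k. v (d - t k)) \<or>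
    monotone_on {-M..M} (\<ge>) (le_inf lt0) (\<lambda>k. v (d - t k))"
proof -
  consider (increasing) "lt1 (t 0) (t 1)" | (const) "t 0 = t 1" | (decreasing) "lt1 (t 1) (t 0)"
    using o1.less_linear by blast
  then show ?thesis
  proof cases
    case increasing
    have "lt1 (t i) (t j)" if "- M \<le> i" "i < j" "j \<le> M" for i j
      using mono[OF that] increasing by (simp add: o1.same_order_def)
    then show ?thesis using M cut by (intro increasing_sequence_val_mono)
  next
    case const
    have "monotone_on {-M..M} (\<le>) (le_inf lt0) (\<lambda>k. v (d - t k))"
    proof (rule monotone_onI)
      fix i j assume "i \<in> {-M..M}" "j \<in> {-M..M}" "i \<le> j"
      then have "t i = t j"
        using mono[of i j] const by (cases "i = j") (simp_all add: o1.same_order_def)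
      then show "le_inf lt0 (v (d - t i)) (v (d - t j))" by simp
    qed
    then show ?thesis ..
  next
    case decreasing
    have "lt1 (t j) (t i)" if "- M \<le> i" "i < j" "j \<le> M" for i j
      using o1.same_order_commute[THEN iffD1, OF mono[OF that]] decreasing
      by (simp add: o1.same_order_def)
    then have "lt1 (- t i) (- t j)" if "- M \<le> i" "i < j" "j \<le> M" for i j using that by simp
    moreover have "o1.same_order (Some (- t i)) (Some (- d)) (Some (- t j)) (Some (- d))"
      if "i \<in> {-M..M} - {0}" "j \<in> {-M..M} - {0}" for i j
      unfolding same_order_uminus using cut[OF that] by (rule o1.same_order_commute[THEN iffD1])
    ultimately show ?thesis
      using increasing_sequence_val_mono[OF M, of "\<lambda>k. - t k" "- d"] by (simp only: v_uminus_diff)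
  qed
qed

text \<open>The hypotheses are what indiscernibility of \<open>t\<close>, and indiscernibility over \<open>d\<close> away from
  the index \<open>0\<close>, provide.\<close>

lemma val_diff_const_or_extreme:
  fixes t :: "int \<Rightarrow> 'g" and M :: int
  assumes M: "2 \<le> M"
    and mono: "\<And>i j. - M \<le> i \<Longrightarrow> i < j \<Longrightarrow> j \<le> M \<Longrightarrow>
      o1.same_order (Some (t i)) (Some (t j)) (Some (t 0)) (Some (t 1))"
    and cut: "\<And>i j. i \<in> {-M..M} - {0} \<Longrightarrow> j \<in> {-M..M} - {0} \<Longrightarrow>
      o1.same_order (Some (t i)) (Some d) (Some (t j)) (Some d)"
    and val: "\<And>i j i' j'. i \<in> {-M..M} - {0} \<Longrightarrow> j \<in> {-M..M} - {0} \<Longrightarrow> i' \<in> {-M..M} - {0} \<Longrightarrow>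
      j' \<in> {-M..M} - {0} \<Longrightarrow> i < j \<Longrightarrow> i' < j' \<Longrightarrow>
      v (d - t i) = v (d - t j) \<longleftrightarrow> v (d - t i') = v (d - t j')"
  shows "(\<forall>k\<in>{-M..M}. v (d - t k) = v (d - t M)) \<or>
    (\<exists>m\<in>{-M, M}. \<forall>k\<in>{-M<..<M}. v (d - t k) = v (t m - t k))"
proof -
  have extreme: "v (d - t k) = v (t m - t k)" if "less_inf lt0 (v (d - t k)) (v (d - t m))" for k m
    using v_add_less[of "d - t k" "t m - d"] that by (simp add: v_diff_commute[of "t m"])
  have "1 \<le> M" using M by simp
  from monotone_sequence_val_mono[OF this mono cut]
  consider (increasing) "monotone_on {-M..M} (\<le>) (le_inf lt0) (\<lambda>k. v (d - t k))"
    | (decreasing) "monotone_on {-M..M} (\<ge>) (le_inf lt0) (\<lambda>k. v (d - t k))" by blast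
  then show ?thesis
  proof cases
    case increasing
    have "(\<forall>k\<in>{-M..M}. v (d - t k) = v (d - t M)) \<or>
      (\<forall>k\<in>{-M<..<M}. less_inf lt0 (v (d - t k)) (v (d - t M)))"
      using M increasing val by (rule o0.ext.mono_const_or_less_last)
    then show ?thesis using extreme by blast
  next
    case decreasing
    have "(\<forall>k\<in>{-M..M}. v (d - t k) = v (d - t M)) \<or>
      (\<forall>k\<in>{-M<..<M}. less_inf lt0 (v (d - t k)) (v (d - t (- M))))"
      using M decreasing val by (rule o0.ext.antimono_const_or_less_first)
    then show ?thesis using extreme by blast
  qed
qed

end

locale centered_sequence = hamel_valuation sc lt0 lt1 v
  for sc :: "'c::linordered_field \<Rightarrow> 'g::ab_group_add \<Rightarrow> 'g"
    and lt0 lt1 :: "'g \<Rightarrow> 'g \<Rightarrow> bool"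
    and v :: "'g \<Rightarrow> 'g option" +
  fixes B0 B1 :: "'g option set" and b :: "int \<Rightarrow> 'g option list" and M :: int and r :: nat
  assumes ind0: "term_indiscernible B0 {-M..M} b"
    and ind1: "term_indiscernible B1 ({-M..M} - {0}) b"
    and length_b: "\<And>k. k \<in> {-M..M} \<Longrightarrow> length (b k) = r"
    and B0_subset_B1: "B0 \<subseteq> B1"
begin

abbreviation ev_at :: "int \<Rightarrow> ('c, 'g option) trm \<Rightarrow> 'g option" where
  "ev_at k \<equiv> ev (list_env (b k))"

definition outer :: "int \<Rightarrow> 'g option set" where
  "outer N = set (concat (map b ([-M..-N-1] @ [N+1..M])))"

lemma outer_antimono: "N \<le> N' \<Longrightarrow> outer N' \<subseteq> outer N"
  unfolding outer_def by auto

lemma entries_subset_outer: "m \<in> {-M..M} \<Longrightarrow> m \<notin> {-N..N} \<Longrightarrow> set (b m) \<subseteq> outer N"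
  unfolding outer_def by force

lemma term_indiscernible_outer:
  assumes "0 \<le> N" "N \<le> M"
  shows "term_indiscernible (B0 \<union> outer N) {-N..N} b"
    and "term_indiscernible (B1 \<union> outer N) ({-N..N} - {0}) b"
proof -
  have "term_indiscernible (B \<union> outer N) K (\<lambda>k. concat (map b [k]))"
    if "term_indiscernible B J b" "{-M..M} - {0} \<subseteq> J" "J \<subseteq> {-M..M}" "K = J \<inter> {-N..N}" for B J K
    unfolding outer_def
  proof (rule term_indiscernible_regroup[OF that(1)])
    show "length (b i) = r" if "i \<in> J" for i using \<open>J \<subseteq> _\<close> length_b that by blast
    have "concat (map (\<lambda>k. [k]) ks) = ks" for ks :: "int list" by (induction ks) simp_all
    then show "ascending_blocks K J [-M..-N-1] (\<lambda>k. [k]) [N+1..M]"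
      using that assms unfolding ascending_blocks_def by (auto simp: sorted_wrt_append)
  qed simp
  from this[OF ind0, of "{-N..N}"] this[OF ind1, of "{-N..N} - {0}"]
  show "term_indiscernible (B0 \<union> outer N) {-N..N} b"
    "term_indiscernible (B1 \<union> outer N) ({-N..N} - {0}) b"
    using assms by fastforce+
qed

lemma ev_at_None_iff:
  assumes "0 \<le> N" "N \<le> M" "params_trm s \<subseteq> B0 \<union> outer N" "k \<in> {-N..N}" "k' \<in> {-N..N}"
  shows "ev_at k s = None \<longleftrightarrow> ev_at k' s = None"
  using same_orders_eq[OF term_indiscernible_single[OF term_indiscernible_outer(1)[OF assms(1,2)],
    of s Infty k k']] assms(3-5) by simp

definition decomposes :: "int \<Rightarrow> ('c, 'g option) trm \<Rightarrow> bool" where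
  "decomposes N t \<longleftrightarrow> (\<exists>s d. params_trm s \<subseteq> B0 \<union> outer N \<and> params_trm d \<subseteq> B1 \<union> outer N \<and>
    vars_trm d = {} \<and> (\<forall>k\<in>{-N..N}. ev_at k t = oplus (ev_at k s) (ev_at k d)))"

lemma decomposesI:
  assumes "params_trm s \<subseteq> B0 \<union> outer N" "params_trm d \<subseteq> B1 \<union> outer N" "vars_trm d = {}"
    and "\<And>k. k \<in> {-N..N} \<Longrightarrow> ev_at k t = oplus (ev_at k s) (ev_at k d)"
  shows "decomposes N t"
  using assms unfolding decomposes_def by blast

lemma decomposesE:
  assumes "decomposes N t"
  obtains s d where "params_trm s \<subseteq> B0 \<union> outer N" "params_trm d \<subseteq> B1 \<union> outer N" "vars_trm d = {}"
    "\<And>k. k \<in> {-N..N} \<Longrightarrow> ev_at k t = oplus (ev_at k s) (ev_at k d)"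
  using assms unfolding decomposes_def by blast

lemma ev_at_closed: "vars_trm d = {} \<Longrightarrow> ev_at k d = ev_at k' d"
  by (rule eval_cong) simp

lemma decomposes_Plus:
  assumes "decomposes N t" "decomposes N t'" shows "decomposes N (Plus t t')"
proof -
  obtain s d where sd: "params_trm s \<subseteq> B0 \<union> outer N" "params_trm d \<subseteq> B1 \<union> outer N"
    "vars_trm d = {}" "\<And>k. k \<in> {-N..N} \<Longrightarrow> ev_at k t = oplus (ev_at k s) (ev_at k d)"
    using assms(1) decomposesE by blast
  obtain s' d' where sd': "params_trm s' \<subseteq> B0 \<union> outer N" "params_trm d' \<subseteq> B1 \<union> outer N"
    "vars_trm d' = {}" "\<And>k. k \<in> {-N..N} \<Longrightarrow> ev_at k t' = oplus (ev_at k s') (ev_at k d')"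
    using assms(2) decomposesE by blast
  show ?thesis
    using sd sd' by (intro decomposesI[of "Plus s s'" N "Plus d d'"])
      (simp_all add: oplus_oplus_swap[of _ "ev_at _ d"])
qed

lemma decomposes_Scal:
  assumes "decomposes N t" shows "decomposes N (Scal l t)"
proof -
  obtain s d where sd: "params_trm s \<subseteq> B0 \<union> outer N" "params_trm d \<subseteq> B1 \<union> outer N" "vars_trm d = {}"
    "\<And>k. k \<in> {-N..N} \<Longrightarrow> ev_at k t = oplus (ev_at k s) (ev_at k d)"
    using assms decomposesE by blast
  have "map_option (sc l) (oplus p q) = oplus (map_option (sc l) p) (map_option (sc l) q)" for p q
    by (cases p; cases q) (simp_all add: o0.vs.scale_right_distrib)
  then show ?thesis using sd by (intro decomposesI[of "Scal l s" N "Scal l d"]) simp_all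
qed

lemma decomposes_const:
  assumes "params_trm u \<subseteq> B1 \<union> outer N" "m \<in> {-M..M}" "m \<notin> {-N..N}"
    and "\<And>k. k \<in> {-N..N} \<Longrightarrow> ev_at k t = ev_at m u"
  shows "decomposes N t"
proof (rule decomposesI[of Zero N "closed_trm (b m) u"])
  show "params_trm (closed_trm (b m) u) \<subseteq> B1 \<union> outer N"
    using params_closed_trm[of "b m" u] entries_subset_outer[OF assms(2,3)] assms(1) by blast
qed (simp_all add: vars_closed_trm eval_closed_trm assms(4))

lemma decomposes_val_diff:
  assumes "params_trm w \<subseteq> B0 \<union> outer N" "m \<in> {-M..M}" "m \<notin> {-N..N}" "ev_at m w = Some z"
    and "\<And>k. k \<in> {-N..N} \<Longrightarrow> ev_at k w = Some (x k)"
    and "\<And>k. k \<in> {-N..N} \<Longrightarrow> ev_at k t = v (z - x k)"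
  shows "decomposes N t"
proof (rule decomposesI[of "Val (diff_trm (closed_trm (b m) w) w)" N Zero])
  have "params_trm (closed_trm (b m) w) \<subseteq> B0 \<union> outer N"
    using params_closed_trm[of "b m" w] entries_subset_outer[OF assms(2,3)] assms(1) by blast
  then show "params_trm (Val (diff_trm (closed_trm (b m) w) w)) \<subseteq> B0 \<union> outer N"
    using assms(1) by simp
qed (simp_all add: eval_closed_trm assms(4-6))

lemma val_diff_at_const_or_extreme:
  assumes K: "2 \<le> K" "K \<le> M"
    and w: "params_trm w \<subseteq> B0 \<union> outer K" "\<And>k. k \<in> {-K..K} \<Longrightarrow> ev_at k w = Some (x k)"
    and d: "params_trm d \<subseteq> B1 \<union> outer K" "\<And>k. k \<in> {-K..K} \<Longrightarrow> ev_at k d = Some y"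
  shows "(\<forall>k\<in>{-K..K}. v (y - x k) = v (y - x K)) \<or>
    (\<exists>m\<in>{-K, K}. \<forall>k\<in>{-K<..<K}. v (y - x k) = v (x m - x k))"
proof (rule val_diff_const_or_extreme[OF K(1)])
  have "0 \<le> K" using K by simp
  note ind = term_indiscernible_outer[OF this K(2)]
  have length_b: "length (b k) = r" if "k \<in> {-K..K}" for k using length_b that K by simp
  have w': "params_trm w \<subseteq> B1 \<union> outer K" using w(1) B0_subset_B1 by blast
  show "o1.same_order (Some (x i)) (Some (x j)) (Some (x 0)) (Some (x 1))"
    if "- K \<le> i" "i < j" "j \<le> K" for i j
  proof -
    have "same_orders (ev_at i w) (ev_at j w) (ev_at 0 w) (ev_at 1 w)"
      using K that by (intro term_indiscernible_pair[OF ind(1) length_b w(1,1)]) simp_all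
    then show ?thesis using w(2) K that by (simp add: same_orders_def)
  qed
  show "o1.same_order (Some (x i)) (Some y) (Some (x j)) (Some y)"
    if "i \<in> {-K..K} - {0}" "j \<in> {-K..K} - {0}" for i j
    using term_indiscernible_single[OF ind(2) w' d(1) that] w(2) d(2) that
    by (simp add: same_orders_def)
  show "v (y - x i) = v (y - x j) \<longleftrightarrow> v (y - x i') = v (y - x j')"
    if "i \<in> {-K..K} - {0}" "j \<in> {-K..K} - {0}" "i' \<in> {-K..K} - {0}" "j' \<in> {-K..K} - {0}" "i < j"
      "i' < j'"
    for i j i' j'
  proof -
    let ?t = "Val (diff_trm d w)"
    have t: "params_trm ?t \<subseteq> B1 \<union> outer K" using w' d(1) by simp
    have "same_orders (ev_at i ?t) (ev_at j ?t) (ev_at i' ?t) (ev_at j' ?t)"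
      using length_b by (intro term_indiscernible_pair[OF ind(2) _ t t that]) simp
    moreover have "ev_at k ?t = v (y - x k)" if "k \<in> {-K..K}" for k using w(2) d(2) that by simp
    ultimately show ?thesis using same_orders_eq that by (metis DiffD1)
  qed
qed

lemma decomposes_val_diff_const_or_extreme:
  assumes N: "1 \<le> N" "N + 1 \<le> M"
    and w: "params_trm w \<subseteq> B0 \<union> outer (N + 1)" "\<And>k. k \<in> {-(N + 1)..N + 1} \<Longrightarrow> ev_at k w = Some (x k)"
    and d: "params_trm d \<subseteq> B1 \<union> outer (N + 1)" "\<And>k. ev_at k d = Some y"
    and t: "\<And>k. k \<in> {-N..N} \<Longrightarrow> ev_at k t = v (y - x k)"
  shows "decomposes N t"
proof -
  let ?K = "N + 1"
  have outer: "outer ?K \<subseteq> outer N" by (rule outer_antimono) simp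
  have "2 \<le> ?K" "{-N..N} = {-?K<..<?K}" using N(1) by auto
  then consider (const) "\<And>k. k \<in> {-?K..?K} \<Longrightarrow> v (y - x k) = v (y - x ?K)"
    | (extreme) m where "m \<in> {-?K, ?K}" "\<And>k. k \<in> {-N..N} \<Longrightarrow> v (y - x k) = v (x m - x k)"
    using val_diff_at_const_or_extreme[OF _ N(2) w d] by metis
  then show ?thesis
  proof cases
    case const
    show ?thesis
    proof (rule decomposes_const[of "Val (diff_trm d w)" N ?K])
      show "params_trm (Val (diff_trm d w)) \<subseteq> B1 \<union> outer N"
        using w(1) d(1) outer B0_subset_B1 by auto
      show "ev_at k t = ev_at ?K (Val (diff_trm d w))" if "k \<in> {-N..N}" for k
        using t[OF that] const[of k] w(2)[of ?K] d(2) N(1) that by simp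
    qed (use N in auto)
  next
    case extreme
    then have m: "m \<in> {-?K..?K}" "m \<notin> {-N..N}" using N(1) by auto
    show ?thesis
    proof (rule decomposes_val_diff[OF _ _ m(2) w(2)[OF m(1)]])
      show "params_trm w \<subseteq> B0 \<union> outer N" using w(1) outer by blast
      show "m \<in> {-M..M}" using m(1) N(2) by auto
      show "ev_at k w = Some (x k)" if "k \<in> {-N..N}" for k using w(2) that by simp
      show "ev_at k t = v (x m - x k)" if "k \<in> {-N..N}" for k using t extreme(2) that by simp
    qed
  qed
qed

lemma decomposes_Val:
  assumes "decomposes (N + 1) t" "1 \<le> N" "N + 1 \<le> M" shows "decomposes N (Val t)"
proof -
  let ?K = "N + 1"
  obtain s d where s: "params_trm s \<subseteq> B0 \<union> outer ?K"
    and d: "params_trm d \<subseteq> B1 \<union> outer ?K" "vars_trm d = {}"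
    and t: "\<And>k. k \<in> {-?K..?K} \<Longrightarrow> ev_at k t = oplus (ev_at k s) (ev_at k d)"
    using assms(1) decomposesE by blast
  have none: "ev_at k s = None \<longleftrightarrow> ev_at 0 s = None" if "k \<in> {-?K..?K}" for k
    using ev_at_None_iff[OF _ assms(3) s that] assms(2) by simp
  show ?thesis
  proof (cases "ev_at 0 s = None \<or> ev_at 0 d = None")
    case True
    then have "ev_at k (Val t) = None" if "k \<in> {-N..N}" for k
      using t[of k] none[of k] ev_at_closed[OF d(2), of k 0] that by auto
    then show ?thesis by (intro decomposesI[of Infty N Zero]) simp_all
  next
    case False
    then obtain y where y: "ev_at k d = Some y" for k using ev_at_closed[OF d(2), of _ 0] by auto
    define x where "x k = - the (ev_at k s)" for k
    show ?thesis
    proof (rule decomposes_val_diff_const_or_extreme[OF assms(2,3) _ _ d(1) y])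
      show "params_trm (Scal (- 1) s) \<subseteq> B0 \<union> outer ?K" using s by simp
      show "ev_at k (Scal (- 1) s) = Some (x k)" if "k \<in> {-?K..?K}" for k
        using none[OF that] False by (auto simp: x_def)
      show "ev_at k (Val t) = v (y - x k)" if "k \<in> {-N..N}" for k
        using t[of k] none[of k] that False y by (auto simp: x_def add.commute)
    qed
  qed
qed

lemma decomposes:
  assumes "params_trm t \<subseteq> B1" "1 \<le> N" "N + int (val_depth t) \<le> M"
  shows "decomposes N t"
  using assms
proof (induction t arbitrary: N)
  case (Var q)
  show ?case by (intro decomposesI[of "Var q" N Zero]) simp_all
next
  case (Cst u)
  then show ?case by (intro decomposesI[of Zero N "Cst u"]) auto
next
  case Zero
  show ?case by (intro decomposesI[of Zero N Zero]) simp_all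
next
  case Infty
  show ?case by (intro decomposesI[of Infty N Zero]) simp_all
next
  case (Plus t1 t2)
  then show ?case by (intro decomposes_Plus) simp_all
next
  case (Scal l t)
  then show ?case by (intro decomposes_Scal) simp_all
next
  case (Val t)
  then show ?case by (intro decomposes_Val) simp_all
qed

lemma same_orders_plus_const_center:
  assumes M: "1 \<le> M"
    and s: "params_trm s \<subseteq> B0 \<union> outer 1" "\<And>k. k \<in> {-1..1} \<Longrightarrow> ev_at k s = Some (x k)"
    and s': "params_trm s' \<subseteq> B0 \<union> outer 1" "\<And>k. k \<in> {-1..1} \<Longrightarrow> ev_at k s' = Some (x' k)"
    and d: "params_trm d \<subseteq> B1 \<union> outer 1" "\<And>k. ev_at k d = Some y"
    and d': "params_trm d' \<subseteq> B1 \<union> outer 1" "\<And>k. ev_at k d' = Some y'"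
  shows "same_orders (Some (x 0 + y)) (Some (x' 0 + y')) (Some (x 1 + y)) (Some (x' 1 + y'))"
proof -
  note ind = term_indiscernible_outer[OF zero_le_one M]
  let ?z = "diff_trm s s'" and ?c = "diff_trm d' d"
  have z: "ev_at k ?z = Some (x k - x' k)" if "k \<in> {-1..1}" for k using s(2) s'(2) that by simp
  have c: "ev_at k ?c = Some (y' - y)" for k using d(2) d'(2) by simp
  have "same_orders (ev_at (-1) ?z) (ev_at 0 ?z) (ev_at 0 ?z) (ev_at 1 ?z)"
    using s(1) s'(1) length_b M by (intro term_indiscernible_pair[OF ind(1), where n = r]) simp_all
  moreover have "same_orders (ev_at (-1) ?z) (ev_at (-1) ?c) (ev_at 1 ?z) (ev_at 1 ?c)"
    using s(1) s'(1) d(1) d'(1) B0_subset_B1 by (intro term_indiscernible_single[OF ind(2)]) auto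
  ultimately have "same_orders (ev_at 0 ?z) (ev_at 0 ?c) (ev_at 1 ?z) (ev_at 1 ?c)"
    unfolding c[of "-1"] c[of 0] c[of 1] by (rule same_orders_between)
  then show ?thesis
    using z[of 0] z[of 1] c by (simp add: same_orders_add_iff del: eval.simps eval_Plus)
qed

lemma same_orders_center:
  assumes "params_trm t \<subseteq> B1" "params_trm t' \<subseteq> B1"
    and "1 + int (val_depth t) \<le> M" "1 + int (val_depth t') \<le> M"
  shows "same_orders (ev_at 0 t) (ev_at 0 t') (ev_at 1 t) (ev_at 1 t')"
proof -
  have M: "1 \<le> M" using assms(3) by linarith
  obtain s d where s: "params_trm s \<subseteq> B0 \<union> outer 1"
    and d: "params_trm d \<subseteq> B1 \<union> outer 1" "vars_trm d = {}"
    and t: "\<And>k. k \<in> {-1..1} \<Longrightarrow> ev_at k t = oplus (ev_at k s) (ev_at k d)"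
    using decomposes[OF assms(1) order_refl assms(3)] decomposesE by blast
  obtain s' d' where s': "params_trm s' \<subseteq> B0 \<union> outer 1"
    and d': "params_trm d' \<subseteq> B1 \<union> outer 1" "vars_trm d' = {}"
    and t': "\<And>k. k \<in> {-1..1} \<Longrightarrow> ev_at k t' = oplus (ev_at k s') (ev_at k d')"
    using decomposes[OF assms(2) order_refl assms(4)] decomposesE by blast
  have none: "ev_at k s = None \<longleftrightarrow> ev_at 0 s = None" "ev_at k s' = None \<longleftrightarrow> ev_at 0 s' = None"
    if "k \<in> {-1..1}" for k
    using ev_at_None_iff[OF zero_le_one M s that] ev_at_None_iff[OF zero_le_one M s' that]
    by simp_all
  have closed: "ev_at k d = ev_at 0 d" "ev_at k d' = ev_at 0 d'" for k
    using ev_at_closed d(2) d'(2) by blast+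
  show ?thesis
  proof (cases "ev_at 0 s = None \<or> ev_at 0 d = None \<or> ev_at 0 s' = None \<or> ev_at 0 d' = None")
    case True
    have "ev_at 0 t = None \<longleftrightarrow> ev_at 1 t = None" "ev_at 0 t' = None \<longleftrightarrow> ev_at 1 t' = None"
      using t[of 0] t[of 1] t'[of 0] t'[of 1] none[of 1] closed[of 1]
      by (simp_all add: oplus_eq_None_iff)
    moreover have "ev_at 0 t = None \<or> ev_at 0 t' = None"
      using True t[of 0] t'[of 0] by (auto simp: oplus_eq_None_iff)
    ultimately show ?thesis by (intro same_orders_None)
  next
    case False
    then obtain y y' where y: "ev_at k d = Some y" "ev_at k d' = Some y'" for k using closed by auto
    define x x' where "x k = the (ev_at k s)" and "x' k = the (ev_at k s')" for k
    have x: "ev_at k s = Some (x k)" "ev_at k s' = Some (x' k)" if "k \<in> {-1..1}" for k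
      using none[OF that] False by (auto simp: x_def x'_def)
    have "same_orders (Some (x 0 + y)) (Some (x' 0 + y')) (Some (x 1 + y)) (Some (x' 1 + y'))"
      by (rule same_orders_plus_const_center[OF M s x(1) s' x(2) d(1) y(1) d'(1) y(2)])
    then show ?thesis
      using t[of 0] t[of 1] t'[of 0] t'[of 1] x[of 0] x[of 1] y by simp
  qed
qed

end

lemma infinite_gap:
  fixes xs :: "'i::linorder list"
  assumes "sorted_wrt (<) xs" "infinite L" "L \<inter> set xs = {}"
  shows "\<exists>ys zs. xs = ys @ zs \<and> infinite {l \<in> L. (\<forall>x\<in>set ys. x < l) \<and> (\<forall>x\<in>set zs. l < x)}"
  using assms
proof (induction xs arbitrary: L)
  case Nil
  then show ?case by simp
next
  case (Cons x xs)
  show ?case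
  proof (cases "finite {l \<in> L. l < x}")
    case False
    have "{l \<in> L. l < x} \<subseteq> {l \<in> L. (\<forall>y\<in>set []. y < l) \<and> (\<forall>y\<in>set (x # xs). l < y)}"
      using Cons.prems(1) by (auto intro: less_trans)
    then have "infinite {l \<in> L. (\<forall>y\<in>set []. y < l) \<and> (\<forall>y\<in>set (x # xs). l < y)}"
      using False finite_subset by blast
    then show ?thesis by (intro exI[of _ "[]"] exI[of _ "x # xs"]) simp
  next
    case True
    have "L = {l \<in> L. l < x} \<union> {l \<in> L. x < l}" using Cons.prems(3) by auto
    then have "infinite {l \<in> L. x < l}" using True Cons.prems(2) by (metis finite_Un)
    then obtain ys zs where yz: "xs = ys @ zs"
      "infinite {l \<in> {l \<in> L. x < l}. (\<forall>x\<in>set ys. x < l) \<and> (\<forall>x\<in>set zs. l < x)}"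
      using Cons.IH[of "{l \<in> L. x < l}"] Cons.prems by auto
    moreover have "{l \<in> {l \<in> L. x < l}. (\<forall>x\<in>set ys. x < l) \<and> (\<forall>x\<in>set zs. l < x)}
      = {l \<in> L. (\<forall>y\<in>set (x # ys). y < l) \<and> (\<forall>x\<in>set zs. l < x)}" by auto
    ultimately show ?thesis by (intro exI[of _ "x # ys"] exI[of _ zs]) simp
  qed
qed

lemma sorted_lists_in_gap:
  fixes xs :: "'i::linorder list"
  assumes "sorted_wrt (<) xs" "infinite L"
  obtains ys zs where "xs = ys @ zs"
    "\<And>m. \<exists>l. sorted_wrt (<) (ys @ l @ zs) \<and> set l \<subseteq> L \<and> length l = m"
proof -
  have "infinite (L - set xs)" "(L - set xs) \<inter> set xs = {}" using assms(2) by auto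
  then obtain ys zs where xs: "xs = ys @ zs"
    and inf: "infinite {l \<in> L - set xs. (\<forall>x\<in>set ys. x < l) \<and> (\<forall>x\<in>set zs. l < x)}"
    using infinite_gap[OF assms(1)] by blast
  have "\<exists>l. sorted_wrt (<) (ys @ l @ zs) \<and> set l \<subseteq> L \<and> length l = m" for m
  proof -
    obtain T where T: "finite T" "card T = m"
      "T \<subseteq> {l \<in> L - set xs. (\<forall>x\<in>set ys. x < l) \<and> (\<forall>x\<in>set zs. l < x)}"
      using infinite_arbitrarily_large[OF inf] by blast
    then have "sorted_wrt (<) (ys @ sorted_list_of_set T @ zs)"
      using assms(1) unfolding xs sorted_wrt_append by auto
    then show ?thesis using T by (intro exI[of _ "sorted_list_of_set T"]) auto
  qed
  then show ?thesis using that[OF xs] by blast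
qed

definition chunk :: "nat \<Rightarrow> 'a list \<Rightarrow> nat \<Rightarrow> 'a list" where
  "chunk r w q = take r (drop (q * r) w)"

lemma set_chunk_subset: "set (chunk r w q) \<subseteq> set w"
  unfolding chunk_def by (rule subset_trans[OF set_take_subset set_drop_subset])

lemma length_chunk: "Suc q * r \<le> length w \<Longrightarrow> length (chunk r w q) = r"
  by (simp add: chunk_def)

lemma chunk_less:
  assumes "sorted_wrt (<) w" "q < q'" "x \<in> set (chunk r w q)" "y \<in> set (chunk r w q')"
  shows "x < y"
proof -
  have "chunk r w q = drop (q * r) (take (Suc q * r) w)"
    by (simp add: chunk_def take_drop add.commute)
  then have "x \<in> set (take (Suc q * r) w)" using assms(3) by (metis in_set_dropD)
  moreover have "Suc q * r \<le> q' * r" using assms(2) by (intro mult_le_mono1) simp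
  then have "y \<in> set (drop (Suc q * r) w)"
    using in_set_takeD[OF assms(4)[unfolded chunk_def]]
    by (rule subsetD[OF set_drop_subset_set_drop])
  moreover have "sorted_wrt (<) (take (Suc q * r) w @ drop (Suc q * r) w)" using assms(1) by simp
  ultimately show ?thesis unfolding sorted_wrt_append by blast
qed

lemma sorted_concat_chunks:
  assumes "sorted_wrt (<) w" "sorted_wrt (<) qs"
  shows "sorted_wrt (<) (concat (map (chunk r w) qs))"
  using assms(2)
proof (induction qs)
  case (Cons q qs)
  have "sorted_wrt (<) (chunk r w q)"
    using assms(1) unfolding chunk_def by (intro sorted_wrt_take sorted_wrt_drop)
  moreover have "x < y" if "x \<in> set (chunk r w q)" "y \<in> set (concat (map (chunk r w) qs))" for x y
    using that Cons.prems chunk_less[OF assms(1)] by auto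
  ultimately show ?case using Cons by (simp add: sorted_wrt_append)
qed simp

lemma pad_around_element:
  fixes I :: "'i::linorder set" and M :: nat
  assumes "infinite {i \<in> I. i < c}" "infinite {i \<in> I. c < i}"
    and "sorted_wrt (<) is" "c \<in> set is"
  obtains ls l mid u rs where "is = ls @ mid @ rs" "c \<in> set mid"
    and "length l = M * length mid" "length u = M * length mid" "set l \<union> set u \<subseteq> I"
    and "sorted_wrt (<) (ls @ l @ mid @ u @ rs)"
proof -
  obtain xs ys where split: "is = xs @ c # ys" using assms(4) split_list by metis
  have xs: "sorted_wrt (<) xs" "\<forall>x\<in>set xs. x < c" and ys: "sorted_wrt (<) ys" "\<forall>y\<in>set ys. c < y"
    using assms(3) unfolding split by (auto simp: sorted_wrt_append)
  obtain ls bs where xs_split: "xs = ls @ bs"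
    and lower: "\<And>m. \<exists>l. sorted_wrt (<) (ls @ l @ bs) \<and> set l \<subseteq> {i \<in> I. i < c} \<and> length l = m"
    using sorted_lists_in_gap[OF xs(1) assms(1)] by blast
  obtain gs rs where ys_split: "ys = gs @ rs"
    and upper: "\<And>m. \<exists>l. sorted_wrt (<) (gs @ l @ rs) \<and> set l \<subseteq> {i \<in> I. c < i} \<and> length l = m"
    using sorted_lists_in_gap[OF ys(1) assms(2)] by blast
  let ?mid = "bs @ c # gs"
  obtain l where l: "sorted_wrt (<) (ls @ l @ bs)" "set l \<subseteq> {i \<in> I. i < c}"
    "length l = M * length ?mid"
    using lower by blast
  obtain u where u: "sorted_wrt (<) (gs @ u @ rs)" "set u \<subseteq> {i \<in> I. c < i}"
    "length u = M * length ?mid"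
    using upper by blast
  show thesis
  proof (rule that)
    show "is = ls @ ?mid @ rs" by (simp add: split xs_split ys_split)
    have "\<forall>x\<in>set (ls @ l @ bs). x < c" "\<forall>y\<in>set (gs @ u @ rs). c < y"
      using l(2) u(2) xs(2) ys(2) unfolding xs_split ys_split by auto
    then have "sorted_wrt (<) ((ls @ l @ bs) @ c # (gs @ u @ rs))"
      using l(1) u(1) less_trans[of _ c] by (subst sorted_wrt_append) auto
    then show "sorted_wrt (<) (ls @ l @ ?mid @ u @ rs)" by simp
  qed (use l u in auto)
qed

text \<open>A tuple containing \<open>c\<close> is \<open>ls @ blk 0 @ rs\<close>, where \<open>blk 0\<close> contains \<open>c\<close> and can be moved to
  either side through \<open>M\<close> disjoint copies.\<close>

lemma movable_block:
  fixes I :: "'i::linorder set" and M :: nat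
  assumes "infinite {i \<in> I. i < c}" "infinite {i \<in> I. c < i}"
    and "sorted_wrt (<) is" "set is \<subseteq> I" "c \<in> set is"
  obtains ls rs blk r where "is = ls @ blk 0 @ rs" "c \<in> set (blk 0)"
    and "\<And>k. k \<in> {- int M..int M} \<Longrightarrow> length (blk k) = r"
    and "ascending_blocks {- int M..int M} I ls blk rs"
proof -
  obtain ls l mid u rs where split: "is = ls @ mid @ rs" and c: "c \<in> set mid"
    and len: "length l = M * length mid" "length u = M * length mid" and I: "set l \<union> set u \<subseteq> I"
    and sorted: "sorted_wrt (<) (ls @ l @ mid @ u @ rs)"
    using pad_around_element[OF assms(1-3,5)] by metis
  let ?w = "l @ mid @ u" and ?r = "length mid"
  have length_w: "length ?w = (2 * M + 1) * ?r" by (simp add: len)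
  define blk where "blk k = chunk ?r ?w (nat (k + int M))" for k
  show thesis
  proof (rule that)
    have "blk 0 = mid" by (simp add: blk_def chunk_def len)
    then show "is = ls @ blk 0 @ rs" "c \<in> set (blk 0)" by (simp_all add: split c)
    show "length (blk k) = ?r" if "k \<in> {- int M..int M}" for k
    proof -
      have "Suc (nat (k + int M)) \<le> 2 * M + 1" using that by auto
      then show ?thesis unfolding blk_def by (intro length_chunk) (metis mult_le_mono1 length_w)
    qed
    show "ascending_blocks {- int M..int M} I ls blk rs"
      unfolding ascending_blocks_def
    proof (intro allI impI conjI)
      fix ks assume ks: "sorted_wrt (<) ks" "set ks \<subseteq> {- int M..int M}"
      have "sorted_wrt (<) (map (\<lambda>k. nat (k + int M)) ks)"
        using ks(2) unfolding sorted_wrt_map by (intro sorted_wrt_mono_rel[OF _ ks(1)]) auto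
      moreover have "sorted_wrt (<) ?w" using sorted by (auto simp: sorted_wrt_append)
      ultimately have "sorted_wrt (<) (concat (map blk ks))"
        using sorted_concat_chunks by (fastforce simp: blk_def[abs_def] comp_def)
      moreover have w: "set (concat (map blk ks)) \<subseteq> set ?w"
        using set_chunk_subset[of ?r ?w] by (auto simp: blk_def)
      moreover have "sorted_wrt (<) (ls @ ?w @ rs)" using sorted by simp
      ultimately show "sorted_wrt (<) (ls @ concat (map blk ks) @ rs)"
        unfolding sorted_wrt_append[of _ _ "_ @ rs"] sorted_wrt_append[of _ _ rs] by auto
      show "set (ls @ concat (map blk ks) @ rs) \<subseteq> I" using w I assms(4) by (auto simp: split)
    qed
  qed
qed

context hamel_valuation
begin

lemma centered_sequence_regroup:
  fixes I :: "'i::linorder set"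
  assumes length_a: "\<And>i. i \<in> I \<Longrightarrow> length (a i) = n"
    and ind: "term_indiscernible {} I a" "term_indiscernible A (I - {c}) a"
    and blk: "ascending_blocks {-M..M} I ls blk rs" "\<And>k. k \<in> {-M..M} \<Longrightarrow> length (blk k) = r"
    and center: "0 \<le> M" "c \<in> set (blk 0)"
  defines "E \<equiv> set (concat (map a (ls @ rs)))"
  shows "centered_sequence sc lt0 lt1 v E (A \<union> E) (\<lambda>k. concat (map a (blk k))) M (r * n)"
proof
  have "term_indiscernible ({} \<union> E) {-M..M} (\<lambda>k. concat (map a (blk k)))"
    unfolding E_def using length_a blk by (intro term_indiscernible_regroup[OF ind(1)]) auto
  then show "term_indiscernible E {-M..M} (\<lambda>k. concat (map a (blk k)))" by simp
  have "ascending_blocks ({-M..M} - {0}) (I - {c}) ls blk rs"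
    using center by (intro ascending_blocks_delete[OF blk(1)]) simp_all
  then show "term_indiscernible (A \<union> E) ({-M..M} - {0}) (\<lambda>k. concat (map a (blk k)))"
    unfolding E_def using length_a blk(2) by (intro term_indiscernible_regroup[OF ind(2)]) auto
  show "length (concat (map a (blk k))) = r * n" if "k \<in> {-M..M}" for k
    using length_concat_const[of "blk k" a n] length_a ascending_blocks_subset(2)[OF blk(1) that]
      blk(2)[OF that]
    by auto
qed simp

lemma same_orders_avoiding_index:
  fixes I :: "'i::linorder set"
  assumes length_a: "\<And>i. i \<in> I \<Longrightarrow> length (a i) = n"
    and inf: "infinite {i \<in> I. i < c}" "infinite {i \<in> I. c < i}"
    and ind: "term_indiscernible {} I a" "term_indiscernible A (I - {c}) a"
    and is': "sorted_wrt (<) is" "set is \<subseteq> I" and t: "params_trm t \<subseteq> A" "params_trm t' \<subseteq> A"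
  shows "\<exists>js. sorted_wrt (<) js \<and> set js \<subseteq> I - {c} \<and> length js = length is \<and>
    same_orders (ev (list_env (concat (map a is))) t) (ev (list_env (concat (map a is))) t')
      (ev (list_env (concat (map a js))) t) (ev (list_env (concat (map a js))) t')"
proof (cases "c \<in> set is")
  case False
  then show ?thesis using is' same_orders_refl by (intro exI[of _ "is"]) auto
next
  case True
  define M where "M = Suc (max (val_depth t) (val_depth t'))"
  obtain ls rs blk r where split: "is = ls @ blk 0 @ rs" and c: "c \<in> set (blk 0)"
    and length_blk: "\<And>k. k \<in> {- int M..int M} \<Longrightarrow> length (blk k) = r"
    and blocks: "ascending_blocks {- int M..int M} I ls blk rs"
    using movable_block[OF inf is' True] by metis
  let ?E = "set (concat (map a (ls @ rs)))"
  interpret centered_sequence sc lt0 lt1 v ?E "A \<union> ?E" "\<lambda>k. concat (map a (blk k))" "int M" "r * n"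
    by (rule centered_sequence_regroup[OF length_a ind blocks length_blk _ c]) simp_all
  let ?freeze = "freeze_trm (concat (map a ls)) (r * n) (concat (map a rs))"
  have eval: "ev_at k (?freeze s) = ev (list_env (concat (map a (ls @ blk k @ rs)))) s"
    if "k \<in> {- int M..int M}" for k and s :: "('c, 'g option) trm"
    using eval_freeze_trm[OF length_b[OF that]] by simp
  have params: "params_trm (?freeze s) \<subseteq> A \<union> ?E"
    if "params_trm s \<subseteq> A" for s :: "('c, 'g option) trm"
    using params_freeze_trm[of "concat (map a ls)" "r * n" "concat (map a rs)" s] that by auto
  have one: "1 \<in> {- int M..int M} - {0}" and zero: "0 \<in> {- int M..int M}" by (auto simp: M_def)
  let ?js = "ls @ blk 1 @ rs"
  have "same_orders (ev_at 0 (?freeze t)) (ev_at 0 (?freeze t')) (ev_at 1 (?freeze t))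
      (ev_at 1 (?freeze t'))"
    by (intro same_orders_center params t) (simp_all add: val_depth_freeze_trm M_def)
  then have "same_orders (ev (list_env (concat (map a is))) t)
      (ev (list_env (concat (map a is))) t')
      (ev (list_env (concat (map a ?js))) t) (ev (list_env (concat (map a ?js))) t')"
    using eval[OF zero] eval[of 1] one by (simp add: split)
  moreover have "length ?js = length is" using length_blk zero one by (simp add: split)
  moreover have "sorted_wrt (<) ?js" "set ?js \<subseteq> I - {c}"
    using ascending_blocksD[OF ascending_blocks_delete[OF blocks zero c], of "[1]"] one by simp_all
  ultimately show ?thesis by blast
qed

theorem term_indiscernible_distal:
  fixes I :: "'i::linorder set"
  assumes length_a: "\<And>i. i \<in> I \<Longrightarrow> length (a i) = n"
    and inf: "infinite {i \<in> I. i < c}" "infinite {i \<in> I. c < i}"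
    and ind: "term_indiscernible {} I a" "term_indiscernible A (I - {c}) a"
  shows "term_indiscernible A I a"
  unfolding term_indiscernible_def same_type_def
proof (intro allI impI ballI)
  fix ks ks' and t t' :: "('c, 'g option) trm"
  assume ks: "sorted_wrt (<) ks" "sorted_wrt (<) ks'" "set ks \<subseteq> I" "set ks' \<subseteq> I"
    "length ks = length ks'"
    and t: "t \<in> terms_over A" "t' \<in> terms_over A"
  let ?ev = "\<lambda>is. ev (list_env (concat (map a is)))"
  note avoid = same_orders_avoiding_index[OF length_a inf ind]
  obtain js where js: "sorted_wrt (<) js" "set js \<subseteq> I - {c}" "length js = length ks"
    "same_orders (?ev ks t) (?ev ks t') (?ev js t) (?ev js t')"
    using avoid[OF _ ks(1,3), of t t'] t by auto
  obtain js' where js': "sorted_wrt (<) js'" "set js' \<subseteq> I - {c}" "length js' = length ks'"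
    "same_orders (?ev ks' t) (?ev ks' t') (?ev js' t) (?ev js' t')"
    using avoid[OF _ ks(2,4), of t t'] t by auto
  have "same_orders (?ev js t) (?ev js t') (?ev js' t) (?ev js' t')"
    using js(1-3) js'(1-3) ks(5) by (intro same_typeD[OF term_indiscernibleD[OF ind(2)] t]) simp_all
  moreover have "same_orders (?ev js' t) (?ev js' t') (?ev ks' t) (?ev ks' t')"
    using js'(4) by (rule same_orders_sym[THEN iffD1])
  ultimately show "same_orders (?ev ks t) (?ev ks t') (?ev ks' t) (?ev ks' t')"
    using js(4) by (blast intro: same_orders_trans)
qed

end

lemma (in T_Ham_model) indiscernible_iff_term_indiscernible:
  assumes "\<And>i. i \<in> J \<Longrightarrow> length (a i) = n"
  shows "indiscernible sc lt0 lt1 v B J n a \<longleftrightarrow> term_indiscernible B J a"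
proof -
  have env: "seq_env n a is = list_env (concat (map a is))" if "set is \<subseteq> J" for "is"
    using that assms by (intro seq_env_eq_list_env) blast
  show ?thesis
  proof
    assume ind: "indiscernible sc lt0 lt1 v B J n a"
    show "term_indiscernible B J a"
      unfolding term_indiscernible_def
    proof (intro allI impI)
      fix ks ks' assume ks: "sorted_wrt (<) ks" "sorted_wrt (<) ks'" "set ks \<subseteq> J" "set ks' \<subseteq> J"
        "length ks = length ks'"
      let ?e = "list_env (concat (map a ks))" and ?e' = "list_env (concat (map a ks'))"
      have sat: "sat sc lt0 lt1 v ?e f \<longleftrightarrow> sat sc lt0 lt1 v ?e' f"
        if "params_fm f \<subseteq> B" for f :: "('c, 'g option) fm"
        using ind that ks
        unfolding indiscernible_def env[OF ks(3), symmetric] env[OF ks(4), symmetric] by blast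
      have "same_orders (ev ?e s) (ev ?e t) (ev ?e' s) (ev ?e' t)"
        if "s \<in> terms_over B" "t \<in> terms_over B" for s t :: "('c, 'g option) trm"
        using sat[of "Eq s t"] sat[of "Less0 s t"] sat[of "Less1 s t"] that
        by (simp add: same_orders_def o0.same_order_def o1.same_order_def)
      then show "same_type (terms_over B) ?e ?e'" unfolding same_type_def by blast
    qed
  next
    assume "term_indiscernible B J a"
    then show "indiscernible sc lt0 lt1 v B J n a"
      unfolding indiscernible_def term_indiscernible_def by (metis env same_type_sat)
  qed
qed

theorem theorem5p1:
  fixes sc :: "'c::linordered_field \<Rightarrow> 'g::ab_group_add \<Rightarrow> 'g"
    and lt0 lt1 :: "'g \<Rightarrow> 'g \<Rightarrow> bool"
    and v :: "'g \<Rightarrow> 'g option"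
    and A :: "'g option set"
    and I :: "'i::linorder set" and c :: 'i
    and n :: nat and a :: "'i \<Rightarrow> 'g option list"
  assumes "model_T_Ham sc lt0 lt1 v"
    and "c \<in> I" and "infinite {i \<in> I. i < c}" and "infinite {i \<in> I. c < i}"
    and "\<forall>i \<in> I. length (a i) = n"
    and "indiscernible sc lt0 lt1 v {} I n a"
    and "indiscernible sc lt0 lt1 v A (I - {c}) n a"
  shows "indiscernible sc lt0 lt1 v A I n a"
proof -
  interpret T_Ham_model sc lt0 lt1 v
    using assms(1) by unfold_locales (simp_all add: model_T_Ham_def)
  have iff: "indiscernible sc lt0 lt1 v B J n a \<longleftrightarrow> term_indiscernible B J a" if "J \<subseteq> I" for B J
    using that assms(5) by (intro indiscernible_iff_term_indiscernible) blast
  have "term_indiscernible A I a"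
  proof (rule term_indiscernible_distal)
    show "infinite {i \<in> I. i < c}" "infinite {i \<in> I. c < i}" by fact+
    show "length (a i) = n" if "i \<in> I" for i using that assms(5) by blast
    show "term_indiscernible {} I a" "term_indiscernible A (I - {c}) a"
      using assms(6,7) by (simp_all add: iff)
  qed
  then show ?thesis by (simp add: iff)
qed

end
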